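(* Let $K$ be a number field and $\Phi$ an endomorphism of $\mathbb{P}_1$ of degree $\geq 2$ defined over $K$. Then $\Phi$ is finitely critical if and only if $\mathcal{R}_\Phi\subset \mathrm{PrePer}(\Phi,\overline{K})$.
   Context: $\mathcal{R}_\Phi\subset\mathbb{P}_1(\overline{K})$ denotes the set of ramification (critical) points of $\Phi$, and $\mathrm{PrePer}(\Phi,\overline{K})$ the set of preperiodic points of $\Phi$ in $\mathbb{P}_1(\overline{K})$. For a non-archimedean valuation $v$ of $K$ (extended to $\overline{K}$), $\Phi$ has critically good reduction at $v$ if distinct points of $\Phi(\mathcal{R}_\Phi)$ have distinct reductions modulo $v$ (i.e. $\#\Phi(\mathcal{R}_\Phi)=\#(\Phi(\mathcal{R}_\Phi))_v$) and distinct points of $\mathcal{R}_\Phi$ have distinct reductions modulo $v$ (i.e. $\#\mathcal{R}_\Phi=\#(\mathcal{R}_\Phi)_v$). $\Phi$ is finitely critical if there is a finite set $S$ of valuations of $K$, containing all archimedean ones, such that every iterate $\Phi^n$, $n\geq1$, has critically good reduction at every valuation outside $S$. *)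

theory Defs
  imports "HOL-Algebra.Algebraic_Closure_Type"
begin

section \<open>Number fields\<close>

definition number_field :: "'k :: field_char_0 itself \<Rightarrow> bool" where
  "number_field (_ :: 'k itself) \<longleftrightarrow>
     (\<exists>B. finite_dimensional_vector_space (\<lambda>(q :: rat) (x :: 'k). of_rat q * x) B)"


section \<open>The projective line\<close>

definition proj_rel :: "'a :: field \<times> 'a \<Rightarrow> 'a \<times> 'a \<Rightarrow> bool" where
  "proj_rel p q \<longleftrightarrow> p \<noteq> (0, 0) \<and> q \<noteq> (0, 0) \<and>
     (\<exists>c. c \<noteq> 0 \<and> fst q = c * fst p \<and> snd q = c * snd p)"

lemma part_equivp_proj_rel: "part_equivp (proj_rel :: 'a :: field \<times> 'a \<Rightarrow> _)"
proof (rule part_equivpI)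
  show "\<exists>x :: 'a \<times> 'a. proj_rel x x"
    by (rule exI[of _ "(1, 0)"]) (auto simp: proj_rel_def intro!: exI[of _ 1])
  show "symp (proj_rel :: 'a \<times> 'a \<Rightarrow> _)"
  proof (rule sympI)
    fix p q :: "'a \<times> 'a" assume "proj_rel p q"
    then obtain c where "p \<noteq> (0, 0)" "q \<noteq> (0, 0)" "c \<noteq> 0" "fst q = c * fst p" "snd q = c * snd p"
      by (auto simp: proj_rel_def)
    then show "proj_rel q p"
      unfolding proj_rel_def by (intro conjI exI[of _ "inverse c"]) auto
  qed
  show "transp (proj_rel :: 'a \<times> 'a \<Rightarrow> _)"
  proof (rule transpI)
    fix p q r :: "'a \<times> 'a" assume "proj_rel p q" "proj_rel q r"
    then obtain c e where "p \<noteq> (0, 0)" "r \<noteq> (0, 0)" "c \<noteq> 0" "fst q = c * fst p" "snd q = c * snd p"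
        "e \<noteq> 0" "fst r = e * fst q" "snd r = e * snd q"
      by (auto simp: proj_rel_def)
    then show "proj_rel p r"
      unfolding proj_rel_def by (intro conjI exI[of _ "e * c"]) auto
  qed
qed

quotient_type (overloaded) 'a proj_line = "'a :: field \<times> 'a" / partial: proj_rel
  by (rule part_equivp_proj_rel)

text \<open>
  \<open>hpt x y\<close> is the point with homogeneous coordinates \<open>[x : y]\<close>; it is meaningful only for
  \<open>(x, y) \<noteq> (0, 0)\<close>.
\<close>

definition hpt :: "'a :: field \<Rightarrow> 'a \<Rightarrow> 'a proj_line" where
  "hpt x y = abs_proj_line (x, y)"

lemma hpt_eq_iff:
  assumes "(x, y) \<noteq> (0, 0)" "(x', y') \<noteq> (0, 0)"
  shows "hpt x y = hpt x' y' \<longleftrightarrow> (\<exists>c. c \<noteq> 0 \<and> x' = c * x \<and> y' = c * y)"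
proof -
  have refl: "proj_rel (a, b) (a, b)" if "(a, b) \<noteq> (0, 0)" for a b :: 'a
    using that by (auto simp: proj_rel_def intro!: exI[of _ 1])
  have "hpt x y = hpt x' y' \<longleftrightarrow> proj_rel (x, y) (x', y')"
    unfolding hpt_def
    using Quotient_rel[OF Quotient_proj_line, of "(x, y)" "(x', y')"] refl assms by simp
  then show ?thesis
    using assms by (simp add: proj_rel_def)
qed

lemma hpt_cases:
  obtains x y where "(x, y) \<noteq> (0, 0)" "P = hpt x y"
proof -
  obtain x y where xy: "rep_proj_line P = (x, y)"
    by (cases "rep_proj_line P")
  have "proj_rel (x, y) (x, y)"
    using Quotient_rep_reflp[OF Quotient_proj_line, of P] xy by simp
  then have "(x, y) \<noteq> (0, 0)"
    by (simp add: proj_rel_def)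
  moreover have "P = hpt x y"
    using Quotient_abs_rep[OF Quotient_proj_line, of P] xy by (simp add: hpt_def)
  ultimately show thesis
    by (rule that)
qed


section \<open>Endomorphisms of the projective line and ramification\<close>

text \<open>
  A univariate polynomial \<open>f\<close> of degree at most \<open>d\<close> encodes the binary form
  \<open>F(X, Y) = Y ^ d * f (X / Y)\<close> of degree \<open>d\<close>.
\<close>

definition form_eval :: "nat \<Rightarrow> 'a :: field poly \<Rightarrow> 'a \<Rightarrow> 'a \<Rightarrow> 'a" where
  "form_eval d f x y = (\<Sum>i\<le>d. Polynomial.coeff f i * x ^ i * y ^ (d - i))"

text \<open>
  The order of vanishing of the non-zero form \<open>F\<close> at \<open>[a : b]\<close>, that is, the multiplicity of the
  linear form \<open>b X - a Y\<close> in \<open>F\<close>. At \<open>[1 : 0]\<close> it is the exact power of \<open>Y\<close> dividing \<open>F\<close>.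
\<close>

definition form_order :: "nat \<Rightarrow> 'a :: field poly \<Rightarrow> 'a \<Rightarrow> 'a \<Rightarrow> nat" where
  "form_order d f a b = (if b = 0 then d - Polynomial.degree f else Polynomial.order (a / b) f)"

text \<open>
  \<open>\<Phi>\<close> is the morphism \<open>[x : y] \<mapsto> [F(x, y) : G(x, y)]\<close>, where \<open>F\<close> and \<open>G\<close> are the forms of degree
  \<open>d\<close> encoded by \<open>f\<close> and \<open>g\<close>. These forms have no common factor iff \<open>f\<close> and \<open>g\<close> are coprime and
  \<open>Y\<close> does not divide both of them, i.e. one of \<open>f\<close>, \<open>g\<close> has degree exactly \<open>d\<close>.
\<close>

definition has_lift :: "nat \<Rightarrow> 'a :: field poly \<Rightarrow> 'a poly \<Rightarrow> ('a proj_line \<Rightarrow> 'a proj_line) \<Rightarrow> bool"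
  where "has_lift d f g \<Phi> \<longleftrightarrow>
    coprime f g \<and> max (Polynomial.degree f) (Polynomial.degree g) = d \<and>
    (\<forall>x y. (x, y) \<noteq> (0, 0) \<longrightarrow> \<Phi> (hpt x y) = hpt (form_eval d f x y) (form_eval d g x y))"

text \<open>Endomorphisms of degree \<open>d\<close> of the projective line that are defined over \<open>'k\<close>, given by
  their action on the points over the algebraic closure.\<close>

definition endomorphism_over_base ::
    "nat \<Rightarrow> ('k :: field alg_closure proj_line \<Rightarrow> 'k alg_closure proj_line) \<Rightarrow> bool" where
  "endomorphism_over_base d \<Phi> \<longleftrightarrow> (\<exists>f g. has_lift d (map_poly to_ac f) (map_poly to_ac g) \<Phi>)"

text \<open>
  If \<open>\<Phi> [a : b] = [c : e]\<close>, then \<open>(e X - c Y) / L\<close>, with \<open>L\<close> a linear form not vanishing at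
  \<open>[c : e]\<close>, is a uniformizer at \<open>[c : e]\<close>; the order at \<open>[a : b]\<close> of its pullback is that of the
  form \<open>e F - c G\<close>. The index depends neither on the lift nor on the coordinates chosen.
\<close>

definition has_ramification_index ::
    "('a :: field proj_line \<Rightarrow> 'a proj_line) \<Rightarrow> 'a proj_line \<Rightarrow> nat \<Rightarrow> bool" where
  "has_ramification_index \<Phi> P n \<longleftrightarrow> (\<exists>d f g a b c e.
     has_lift d f g \<Phi> \<and>
     (a, b) \<noteq> (0, 0) \<and> P = hpt a b \<and>
     (c, e) \<noteq> (0, 0) \<and> \<Phi> P = hpt c e \<and>
     n = form_order d (Polynomial.smult e f - Polynomial.smult c g) a b)"

definition ramification_points :: "('a :: field proj_line \<Rightarrow> 'a proj_line) \<Rightarrow> 'a proj_line set" where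
  "ramification_points \<Phi> = {P. \<exists>n\<ge>2. has_ramification_index \<Phi> P n}"

definition preperiodic_points :: "('a \<Rightarrow> 'a) \<Rightarrow> 'a set" where
  "preperiodic_points \<Phi> = {P. \<exists>m n. n \<ge> 1 \<and> (\<Phi> ^^ (m + n)) P = (\<Phi> ^^ m) P}"


section \<open>Absolute values and places\<close>

definition absolute_value :: "('a :: field \<Rightarrow> real) \<Rightarrow> bool" where
  "absolute_value v \<longleftrightarrow>
     (\<forall>x. v x \<ge> 0) \<and> (\<forall>x. v x = 0 \<longleftrightarrow> x = 0) \<and>
     (\<forall>x y. v (x * y) = v x * v y) \<and> (\<forall>x y. v (x + y) \<le> v x + v y)"

definition nontrivial_absolute_value :: "('a :: field \<Rightarrow> real) \<Rightarrow> bool" where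
  "nontrivial_absolute_value v \<longleftrightarrow> absolute_value v \<and> (\<exists>x. x \<noteq> 0 \<and> v x \<noteq> 1)"

definition nonarchimedean :: "('a :: field \<Rightarrow> real) \<Rightarrow> bool" where
  "nonarchimedean v \<longleftrightarrow> (\<forall>x y. v (x + y) \<le> max (v x) (v y))"

definition absolute_value_equiv :: "(('a :: field \<Rightarrow> real) \<times> ('a \<Rightarrow> real)) set" where
  "absolute_value_equiv = {(v, w). nontrivial_absolute_value v \<and> nontrivial_absolute_value w \<and>
     (\<exists>s>0. \<forall>x. w x = v x powr s)}"

lemma equiv_absolute_value_equiv:
  "equiv {v :: 'a :: field \<Rightarrow> real. nontrivial_absolute_value v} absolute_value_equiv"
proof (rule equivI)
  have nonneg: "v x \<ge> 0" if "nontrivial_absolute_value v" for v :: "'a \<Rightarrow> real" and x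
    using that by (simp add: nontrivial_absolute_value_def absolute_value_def)
  show "absolute_value_equiv \<subseteq>
      {v :: 'a \<Rightarrow> real. nontrivial_absolute_value v} \<times> {v. nontrivial_absolute_value v}"
    by (auto simp: absolute_value_equiv_def)
  show "refl_on {v :: 'a \<Rightarrow> real. nontrivial_absolute_value v} absolute_value_equiv"
    by (rule refl_onI) (auto simp: absolute_value_equiv_def nonneg intro!: exI[of _ 1])
  show "sym (absolute_value_equiv :: (('a \<Rightarrow> real) \<times> _) set)"
  proof (rule symI)
    fix v w :: "'a \<Rightarrow> real" assume "(v, w) \<in> absolute_value_equiv"
    then obtain s where "nontrivial_absolute_value v" "nontrivial_absolute_value w"
        "s > 0" "\<And>x. w x = v x powr s"
      by (auto simp: absolute_value_equiv_def)
    then show "(w, v) \<in> absolute_value_equiv"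
      by (auto simp: absolute_value_equiv_def powr_powr nonneg intro!: exI[of _ "1 / s"])
  qed
  show "trans (absolute_value_equiv :: (('a \<Rightarrow> real) \<times> _) set)"
  proof (rule transI)
    fix u v w :: "'a \<Rightarrow> real"
    assume "(u, v) \<in> absolute_value_equiv" "(v, w) \<in> absolute_value_equiv"
    then obtain s t where "nontrivial_absolute_value u" "nontrivial_absolute_value w"
        "s > 0" "\<And>x. v x = u x powr s" "t > 0" "\<And>x. w x = v x powr t"
      by (auto simp: absolute_value_equiv_def)
    then show "(u, w) \<in> absolute_value_equiv"
      by (auto simp: absolute_value_equiv_def powr_powr intro!: exI[of _ "s * t"])
  qed
qed

definition places :: "('a :: field \<Rightarrow> real) set set" where
  "places = {v. nontrivial_absolute_value v} // absolute_value_equiv"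

definition archimedean_places :: "('a :: field \<Rightarrow> real) set set" where
  "archimedean_places = {V \<in> places. \<exists>v\<in>V. \<not> nonarchimedean v}"


section \<open>Reduction of points\<close>

text \<open>For \<open>x\<close> in the valuation ring, its class in the residue field, as a coset of the maximal
  ideal.\<close>

definition residue_class :: "('a :: field \<Rightarrow> real) \<Rightarrow> 'a \<Rightarrow> 'a set" where
  "residue_class v x = {y. v (y - x) < 1}"

text \<open>
  The reduction of \<open>P\<close> is the point of the projective line over the residue field whose homogeneous
  coordinates are the residue classes of coordinates \<open>(x, y)\<close> of \<open>P\<close> normalized by
  \<open>max (v x) (v y) = 1\<close>. As such \<open>(x, y)\<close> are determined up to units of the valuation ring, the set
  of all pairs of residue classes so obtained is exactly one class of non-zero pairs over the
  residue field modulo its non-zero scalars, i.e. a point; see \<open>reduction_hpt\<close> below.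
\<close>

definition reduction :: "('a :: field \<Rightarrow> real) \<Rightarrow> 'a proj_line \<Rightarrow> ('a set \<times> 'a set) set" where
  "reduction v P = {(residue_class v x, residue_class v y) | x y.
     max (v x) (v y) = 1 \<and> P = hpt x y}"

lemma reduction_hpt:
  assumes "absolute_value v" "max (v x) (v y) = 1"
  shows "reduction v (hpt x y) = {(residue_class v (u * x), residue_class v (u * y)) | u. v u = 1}"
proof -
  have mult: "v (a * b) = v a * v b" and zero: "v a = 0 \<longleftrightarrow> a = 0" and nn: "v a \<ge> 0" for a b
    using assms(1) by (auto simp: absolute_value_def)
  have nz: "(a, b) \<noteq> (0, 0)" if "max (v a) (v b) = 1" for a b
    using that zero[of 0] by auto
  have scale: "max (v (c * a)) (v (c * b)) = v c * max (v a) (v b)" for a b c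
    using max_mult_distrib_left[of "v c" "v a" "v b"] nn[of c] by (simp add: mult)
  have "(max (v x') (v y') = 1 \<and> hpt x y = hpt x' y') \<longleftrightarrow> (\<exists>u. v u = 1 \<and> x' = u * x \<and> y' = u * y)"
    for x' y'
  proof
    assume *: "max (v x') (v y') = 1 \<and> hpt x y = hpt x' y'"
    then obtain u where u: "x' = u * x" "y' = u * y"
      using hpt_eq_iff[OF nz[OF assms(2)] nz, of x' y'] by auto
    then have "v u = 1"
      using * scale[of u x y] assms(2) by simp
    with u show "\<exists>u. v u = 1 \<and> x' = u * x \<and> y' = u * y"
      by blast
  next
    assume "\<exists>u. v u = 1 \<and> x' = u * x \<and> y' = u * y"
    then obtain u where u: "v u = 1" "x' = u * x" "y' = u * y"
      by blast
    have max1: "max (v x') (v y') = 1"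
      using scale[of u x y] u assms(2) by simp
    moreover have "u \<noteq> 0"
      using u(1) zero[of 0] by auto
    ultimately show "max (v x') (v y') = 1 \<and> hpt x y = hpt x' y'"
      using hpt_eq_iff[OF nz[OF assms(2)] nz[OF max1]] u by blast
  qed
  then have "reduction v (hpt x y) =
      {(residue_class v x', residue_class v y') | x' y'. \<exists>u. v u = 1 \<and> x' = u * x \<and> y' = u * y}"
    unfolding reduction_def by presburger
  also have "\<dots> = {(residue_class v (u * x), residue_class v (u * y)) | u. v u = 1}"
    by auto
  finally show ?thesis .
qed


section \<open>Critically good reduction\<close>

definition critically_good_at ::
    "('a :: field \<Rightarrow> real) \<Rightarrow> ('a proj_line \<Rightarrow> 'a proj_line) \<Rightarrow> bool" where
  "critically_good_at w \<Phi> \<longleftrightarrow>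
     inj_on (reduction w) (\<Phi> ` ramification_points \<Phi>) \<and>
     inj_on (reduction w) (ramification_points \<Phi>)"

text \<open>The non-archimedean absolute values on the algebraic closure that extend the place \<open>V\<close>.\<close>

definition extensions :: "('k :: field \<Rightarrow> real) set \<Rightarrow> ('k alg_closure \<Rightarrow> real) set" where
  "extensions V = {w. absolute_value w \<and> nonarchimedean w \<and> w \<circ> to_ac \<in> V}"

text \<open>
  For \<open>\<Phi>\<close> defined over the base field the choice of the extension is immaterial, since any two
  extensions of one absolute value are conjugate by an automorphism of the closure, under which the
  set of ramification points is stable.
\<close>

definition critically_good_reduction ::
    "('k :: field \<Rightarrow> real) set \<Rightarrow> ('k alg_closure proj_line \<Rightarrow> 'k alg_closure proj_line) \<Rightarrow> bool"
  where "critically_good_reduction V \<Phi> \<longleftrightarrow> (\<forall>w\<in>extensions V. critically_good_at w \<Phi>)"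

definition finitely_critical ::
    "('k :: field alg_closure proj_line \<Rightarrow> 'k alg_closure proj_line) \<Rightarrow> bool" where
  "finitely_critical \<Phi> \<longleftrightarrow> (\<exists>S :: ('k \<Rightarrow> real) set set.
     finite S \<and> S \<subseteq> places \<and> archimedean_places \<subseteq> S \<and>
     (\<forall>n\<ge>1. \<forall>V\<in>places - S. critically_good_reduction V (\<Phi> ^^ n)))"

end

theory Submission
  imports Defs
begin

text \<open>
  If \<open>\<Phi>\<close> is finitely critical, choose a prime \<open>p\<close> and a place above it at which all iterates have
  critically good reduction. The forward orbit of a ramification point consists of points with
  coordinates in one finite extension of the rationals, hence has finitely many reductions. Two
  points of the orbit with the same reduction lie in \<open>\<Phi>\<^sup>n(\<R>)\<close> for some \<open>n\<close>, where \<open>\<R>\<close> is the set of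
  ramification points of \<open>\<Phi>\<^sup>n\<close>; so they are equal.

  Conversely, if the set \<open>C\<close> of postcritical points is finite, then outside finitely many places \<open>\<Phi>\<close>
  has good reduction, the integers up to the degree are units, and points of \<open>C\<close> have distinct
  reductions. At such a place a non-archimedean Rolle theorem holds: if \<open>A \<noteq> B\<close> have the same
  reduction and the same image, then a ramification point \<open>R\<close> has the same reduction as \<open>A\<close> but a
  different image. Then \<open>\<Phi>(A)\<close> and \<open>\<Phi>(R) \<in> C\<close> have the same reduction, which is impossible when
  \<open>\<Phi>(A) \<in> C\<close>. If only an iterate of \<open>\<Phi>(A)\<close> lies in \<open>C\<close>, then the orbits of \<open>\<Phi>(A)\<close> and \<open>\<Phi>(R)\<close>
  merge, and the theorem is applied again at the point where they do. Hence two ramification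
  points of an iterate with the same reduction coincide.

  The finiteness of the exceptional set rests on Ostrowski's argument and weak approximation, and
  the existence of places above \<open>p\<close> on a subring of the algebraic closure that is maximal among
  those not containing \<open>1 / p\<close>.
\<close>

section \<open>Absolute values\<close>

text \<open>The Rolle theorem fails without the condition on integers: for x^p at a place above p,
  the points 1 and a primitive p-th root of unity have the same reduction and the same image, but
  the ramification points are 0 and infinity. The condition concerns the integers up to the degree,
  so applying the theorem to \<open>\<Phi> ^^ n\<close> would make the exceptional set grow with n.
  It is therefore applied to \<Phi> alone, and a coincidence of n-th iterates is first reduced to a
  single step at which two orbits merge. The image at that step need not be postcritical yet. This
  is why the theorem is used twice and must produce a ramification point R with a different image:
  the orbit of \<open>\<Phi> R\<close> is postcritical and replaces the one that is not yet known to
  be so.\<close>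

locale absval =
  fixes v :: "'a :: field \<Rightarrow> real"
  assumes absolute_value: "absolute_value v"
begin

lemma nonneg [simp]: "v x \<ge> 0"
  and eq_0_iff [simp]: "v x = 0 \<longleftrightarrow> x = 0"
  and mult: "v (x * y) = v x * v y"
  and triangle: "v (x + y) \<le> v x + v y"
  using absolute_value by (auto simp: absolute_value_def)

lemma zero [simp]: "v 0 = 0"
  by simp

lemma pos_iff [simp]: "v x > 0 \<longleftrightarrow> x \<noteq> 0"
  using nonneg[of x] eq_0_iff[of x] by linarith

lemma one [simp]: "v 1 = 1"
  using mult[of 1 1] by simp

lemma power: "v (x ^ n) = v x ^ n"
  by (induction n) (auto simp: mult)

lemma inverse: "v (inverse x) = inverse (v x)"
proof (cases "x = 0")
  case False
  then have "v x * v (inverse x) = 1"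
    by (metis mult one right_inverse)
  with False show ?thesis
    by (metis inverse_unique)
qed simp

lemma divide: "v (x / y) = v x / v y"
  by (simp add: divide_inverse mult inverse)

lemma power_int: "v (x powi n) = v x powi n"
  by (simp add: power_int_def power inverse)

lemma minus_one [simp]: "v (- 1) = 1"
proof -
  have "v (- 1) ^ 2 = 1 ^ 2"
    by (simp flip: power)
  then show ?thesis
    using nonneg[of "- 1"] by (metis power2_eq_iff_nonneg zero_le_one)
qed

lemma minus [simp]: "v (- x) = v x"
  using mult[of "- 1" x] by simp

lemma diff_commute: "v (x - y) = v (y - x)"
  by (metis minus minus_diff_eq)

lemma diff_triangle: "v x - v y \<le> v (x - y)"
  using triangle[of "x - y" y] by simp

lemma sum_le: "v (sum f I) \<le> (\<Sum>i\<in>I. v (f i))"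
proof (induction I rule: infinite_finite_induct)
  case (insert i I)
  then show ?case
    using triangle[of "f i" "sum f I"] by simp
qed auto

lemma prod: "v (prod f I) = (\<Prod>i\<in>I. v (f i))"
  by (induction I rule: infinite_finite_induct) (auto simp: mult)

lemma tendsto_one_plus:
  assumes "(\<lambda>n. v (e n)) \<longlonglongrightarrow> 0"
  shows "(\<lambda>n. v (1 + e n)) \<longlonglongrightarrow> 1"
proof -
  have "norm (v (1 + e n) - 1) \<le> v (e n)" for n
    using triangle[of 1 "e n"] diff_triangle[of 1 "- e n"] by auto
  then have "(\<lambda>n. v (1 + e n) - 1) \<longlonglongrightarrow> 0"
    by (intro tendsto_0_le[OF assms, of _ 1]) auto
  then show ?thesis
    by (simp add: LIM_zero_iff)
qed

end

lemma nontrivial_absvalD: "nontrivial_absolute_value v \<Longrightarrow> absval v"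
  by (simp add: absval_def nontrivial_absolute_value_def)

section \<open>Equivalence of absolute values and weak approximation\<close>

lemma nontrivial_absolute_value_gt_1:
  assumes "nontrivial_absolute_value v"
  obtains x where "v x > 1"
proof -
  interpret absval v
    using assms by (rule nontrivial_absvalD)
  obtain x where x: "x \<noteq> 0" "v x \<noteq> 1"
    using assms by (auto simp: nontrivial_absolute_value_def)
  show thesis
  proof (cases "v x > 1")
    case False
    with x have "v (inverse x) > 1"
      by (simp add: inverse one_less_inverse_iff)
    then show thesis by (rule that)
  qed (rule that)
qed

text \<open>A rational m / n strictly between the two ratios would violate \<open>imp\<close>. Since
  m and n may be negative, passing to -m, -n reverses the inequalities, so the one-sided implication
  excludes both orders.\<close>

lemma real_ratio_eqI:
  fixes a b c d :: real
  assumes "b > 0" "d > 0"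
    and imp: "\<And>m n. of_int n * a < of_int m * b \<Longrightarrow> of_int n * c < of_int m * d"
  shows "a / b = c / d"
proof (rule ccontr)
  assume "a / b \<noteq> c / d"
  then consider "a / b < c / d" | "c / d < a / b" by linarith
  then show False
  proof cases
    case 1
    then obtain q where q: "q \<in> \<rat>" "a / b < q" "q < c / d"
      using Rats_dense_in_real by blast
    from q(1) obtain m n where mn: "q = of_int m / of_int n" "n > 0"
      by (elim Rats_cases') auto
    have m: "of_int m = q * of_int n"
      using mn by simp
    have "n * a < m * b" "m * d < n * c"
      using mn(2) q assms(1,2) by (auto simp: m field_simps)
    with imp[where m = m and n = n] show False by linarith
  next
    case 2
    then obtain q where q: "q \<in> \<rat>" "c / d < q" "q < a / b"
      using Rats_dense_in_real by blast
    from q(1) obtain m n where mn: "q = of_int m / of_int n" "n > 0"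
      by (elim Rats_cases') auto
    have m: "of_int m = q * of_int n"
      using mn by simp
    have "m * b < n * a" "n * c < m * d"
      using mn(2) q assms(1,2) by (auto simp: m field_simps)
    with imp[where m = "- m" and n = "- n"] show False by simp
  qed
qed

lemma ln_powi: "x > 0 \<Longrightarrow> ln (x powi n) = of_int n * ln (x :: real)"
  using ln_powr[of x "of_int n"] powr_real_of_int'[of x n] by simp

text \<open>Fix y with v y > 1. Applied to x^n / y^m, the hypothesis transfers every comparison of
  ln (v x) / ln (v y) with a rational m / n from v to w. So the ratios agree, and the exponent is ln
  (w y) / ln (v y).\<close>

lemma absolute_value_equivI:
  assumes v: "nontrivial_absolute_value v" and w: "nontrivial_absolute_value w"
    and le: "\<And>x. v x < 1 \<Longrightarrow> w x < 1"
  shows "(v, w) \<in> absolute_value_equiv"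
proof -
  interpret v: absval v using v by (rule nontrivial_absvalD)
  interpret w: absval w using w by (rule nontrivial_absvalD)
  obtain y where y: "v y > 1"
    using v by (rule nontrivial_absolute_value_gt_1)
  have y0: "y \<noteq> 0" using y by auto
  have "inverse (w y) < 1"
    using le[of "inverse y"] y by (simp add: v.inverse w.inverse inverse_less_1_iff)
  then have wy: "w y > 1"
    using y0 w.nonneg[of y] by (auto simp: inverse_less_1_iff not_le dest: order.antisym)
  define s where "s = ln (w y) / ln (v y)"
  have lny: "ln (v y) > 0" "ln (w y) > 0"
    using y wy by (auto intro: ln_gt_zero)
  have "w x = v x powr s" for x
  proof (cases "x = 0")
    case False
    have "ln (v x) / ln (v y) = ln (w x) / ln (w y)"
    proof (rule real_ratio_eqI[OF lny])
      fix m n :: int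
      assume *: "of_int n * ln (v x) < of_int m * ln (v y)"
      have eq: "ln (u (x powi n / y powi m)) = n * ln (u x) - m * ln (u y)" if "absval u" for u
      proof -
        interpret u: absval u by fact
        show ?thesis
          using False y0 by (simp add: u.divide u.power_int ln_div ln_powi)
      qed
      have "ln (v (x powi n / y powi m)) < 0"
        using * eq[OF v.absval_axioms] by simp
      then have "v (x powi n / y powi m) < 1"
        using False y0 by (subst (asm) ln_less_zero_iff) auto
      then have "w (x powi n / y powi m) < 1"
        by (rule le)
      then have "ln (w (x powi n / y powi m)) < 0"
        using False y0 by (subst ln_less_zero_iff) auto
      then show "of_int n * ln (w x) < of_int m * ln (w y)"
        using eq[OF w.absval_axioms] by simp
    qed
    then have "ln (w x) = s * ln (v x)"
      using lny by (simp add: s_def field_simps)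
    then have "exp (ln (w x)) = exp (s * ln (v x))"
      by simp
    then show ?thesis
      using False by (simp add: powr_def)
  qed auto
  moreover have "s > 0"
    using lny by (simp add: s_def)
  ultimately show ?thesis
    using v w unfolding absolute_value_equiv_def by blast
qed

lemma absolute_value_equiv_sym:
  "(v, w) \<in> absolute_value_equiv \<longleftrightarrow> (w, v) \<in> absolute_value_equiv"
  using equiv_absolute_value_equiv by (meson equivE symE)

lemma inequivalent_separation:
  assumes v: "nontrivial_absolute_value v" and w: "nontrivial_absolute_value w"
    and ne: "(v, w) \<notin> absolute_value_equiv"
  obtains x where "v x > 1" "w x < 1"
proof -
  interpret v: absval v using v by (rule nontrivial_absvalD)
  interpret w: absval w using w by (rule nontrivial_absvalD)
  obtain x where x: "v x < 1" "w x \<ge> 1"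
    using absolute_value_equivI[OF v w] ne by force
  obtain y where y: "w y < 1" "v y \<ge> 1"
    using absolute_value_equivI[OF w v] ne absolute_value_equiv_sym by force
  have "x \<noteq> 0" using x by auto
  then have "v (y / x) > 1" "w (y / x) < 1"
    using x y by (auto simp: v.divide w.divide field_simps)
  then show thesis by (rule that)
qed

text \<open>Induction on \<open>T\<close>: x serves for \<open>T\<close>, and y separates v from the
  new u. Take x if u x < 1, x^k * y if u x = 1, and y / (1 + x^(-k)) if u x > 1, with k large; the
  last expression tends to y where x is large and to 0 where x is small.\<close>

lemma absolute_value_approximation:
  assumes "finite T" "nontrivial_absolute_value v"
    and "\<And>u. u \<in> T \<Longrightarrow> nontrivial_absolute_value u \<and> (v, u) \<notin> absolute_value_equiv"
  shows "\<exists>x. v x > 1 \<and> (\<forall>u\<in>T. u x < 1)"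
  using assms(1,3)
proof (induction T rule: finite_induct)
  case empty
  then show ?case
    using nontrivial_absolute_value_gt_1[OF assms(2)] by auto
next
  case (insert u T)
  interpret v: absval v using assms(2) by (rule nontrivial_absvalD)
  interpret u: absval u using insert.prems by (auto intro: nontrivial_absvalD)
  have T: "absval t" if "t \<in> T" for t
    using insert.prems that by (auto intro: nontrivial_absvalD)
  obtain x where x: "v x > 1" "\<And>t. t \<in> T \<Longrightarrow> t x < 1"
    using insert.IH insert.prems by auto
  obtain y where y: "v y > 1" "u y < 1"
    using inequivalent_separation[of v u] assms(2) insert.prems by auto
  have t0: "(\<lambda>k. t (x ^ k)) \<longlonglongrightarrow> 0" if "t \<in> T" for t
  proof -
    interpret t: absval t using T that .
    show ?thesis
      using x(2)[OF that] by (simp add: t.power LIMSEQ_realpow_zero)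
  qed
  consider "u x < 1" | "u x = 1" | "u x > 1" by linarith
  then show ?case
  proof cases
    case 1
    then show ?thesis using x by auto
  next
    case 2
    have "\<forall>\<^sub>F k in sequentially. t (x ^ k * y) < 1" if "t \<in> T" for t
    proof -
      interpret t: absval t using T that .
      have "(\<lambda>k. t (x ^ k) * t y) \<longlonglongrightarrow> 0"
        using tendsto_mult_right[OF t0[OF that], of "t y"] by simp
      from order_tendstoD(2)[OF this, of 1] show ?thesis
        by (simp add: t.mult)
    qed
    then have "\<forall>\<^sub>F k in sequentially. \<forall>t\<in>T. t (x ^ k * y) < 1"
      using insert.hyps(1) by (intro eventually_ball_finite) auto
    then obtain k where "\<forall>t\<in>T. t (x ^ k * y) < 1"
      using eventually_happens'[OF sequentially_bot] by blast
    moreover have "u (x ^ k * y) < 1"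
      using 2 y by (simp add: u.mult u.power)
    moreover have "v (x ^ k * y) > 1"
    proof -
      have "1 \<le> v x ^ k"
        using x(1) by (intro one_le_power) simp
      then have "1 * v y \<le> v x ^ k * v y"
        by (rule mult_right_mono) simp
      with y(1) show ?thesis
        unfolding v.mult v.power by linarith
    qed
    ultimately show ?thesis by blast
  next
    case 3
    define z where "z k = y / (1 + inverse x ^ k)" for k
    have lim: "(\<lambda>k. w (z k)) \<longlonglongrightarrow> w y" if "absval w" "w x > 1" for w
    proof -
      interpret w: absval w by fact
      have "(\<lambda>k. w (inverse x ^ k)) \<longlonglongrightarrow> 0"
        using LIMSEQ_inverse_realpow_zero[OF that(2)] by (simp add: w.power w.inverse power_inverse)
      then have "(\<lambda>k. w (1 + inverse x ^ k)) \<longlonglongrightarrow> 1"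
        by (rule w.tendsto_one_plus)
      then have "(\<lambda>k. w y / w (1 + inverse x ^ k)) \<longlonglongrightarrow> w y / 1"
        by (intro tendsto_intros) auto
      then show ?thesis
        by (simp add: z_def w.divide)
    qed
    have x0: "x \<noteq> 0" using x(1) by auto
    have "\<forall>\<^sub>F k in sequentially. v (z k) > 1"
      using order_tendstoD(1)[OF lim[OF v.absval_axioms x(1)] y(1)] .
    moreover have "\<forall>\<^sub>F k in sequentially. u (z k) < 1"
      using order_tendstoD(2)[OF lim[OF u.absval_axioms 3] y(2)] .
    moreover have "\<forall>\<^sub>F k in sequentially. \<forall>t\<in>T. t (z k) < 1"
    proof (intro eventually_ball_finite insert.hyps ballI)
      fix t assume t: "t \<in> T"
      interpret t: absval t using T t .
      have eq: "z k = y * x ^ k / (1 + x ^ k)" for k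
        using x0 by (simp add: z_def field_simps)
      have "(\<lambda>k. t y * t (x ^ k) / t (1 + x ^ k)) \<longlonglongrightarrow> t y * 0 / 1"
        by (intro tendsto_intros t0 t t.tendsto_one_plus) auto
      then have "(\<lambda>k. t (z k)) \<longlonglongrightarrow> 0"
        by (simp add: eq t.divide t.mult)
      then show "\<forall>\<^sub>F k in sequentially. t (z k) < 1"
        by (rule order_tendstoD) simp
    qed
    ultimately have "\<forall>\<^sub>F k in sequentially. v (z k) > 1 \<and> (\<forall>t\<in>insert u T. t (z k) < 1)"
      by eventually_elim auto
    then show ?thesis
      using eventually_happens'[OF sequentially_bot] by blast
  qed
qed

section \<open>Counting the places above one place of the rationals\<close>

lemma vector_space_rat: "vector_space (\<lambda>(q :: rat) (x :: 'a :: field_char_0). of_rat q * x)"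
  by unfold_locales (auto simp: algebra_simps of_rat_add of_rat_mult)

text \<open>Weak approximation gives elements z v that are large at v and at most 1 at the other
  members of \<open>T\<close>. They are independent over the rationals, because in a relation the
  term with the largest coefficient dominates at its own v. Members of \<open>T\<close> may be
  normalized differently, so they are compared through the common order \<open>u\<close>, which
  makes one coefficient largest for all of them.\<close>

lemma card_inequivalent_le:
  fixes T :: "('k :: field_char_0 \<Rightarrow> real) set"
  assumes basis: "finite_dimensional_vector_space (\<lambda>(q :: rat) (x :: 'k). of_rat q * x) B"
    and fin: "finite T"
    and nontriv: "\<And>v. v \<in> T \<Longrightarrow> nontrivial_absolute_value v"
    and inequiv: "\<And>v w. v \<in> T \<Longrightarrow> w \<in> T \<Longrightarrow> v \<noteq> w \<Longrightarrow> (v, w) \<notin> absolute_value_equiv"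
    and order: "\<And>v p q. v \<in> T \<Longrightarrow> v (of_rat p) \<le> v (of_rat q) \<longleftrightarrow> u p \<le> (u q :: real)"
  shows "card T \<le> card B"
proof -
  interpret finite_dimensional_vector_space "\<lambda>(q :: rat) (x :: 'k). of_rat q * x" B
    by (rule basis)
  have absval: "absval v" if "v \<in> T" for v
    using nontriv[OF that] by (rule nontrivial_absvalD)
  have "\<exists>x. v x > 1 \<and> (\<forall>t\<in>T - {v}. t x < 1)" if "v \<in> T" for v
    using that fin nontriv inequiv by (intro absolute_value_approximation) auto
  then obtain x where x: "\<And>v. v \<in> T \<Longrightarrow> v (x v) > 1"
      "\<And>v t. v \<in> T \<Longrightarrow> t \<in> T \<Longrightarrow> t \<noteq> v \<Longrightarrow> t (x v) < 1"
    by (metis DiffI singletonD)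
  \<comment> \<open>The bound \<open>card T\<close> lets one term of a linear relation outweigh all
    the others together.\<close>
  have "\<forall>\<^sub>F n in sequentially. \<forall>v\<in>T. v (x v) ^ n > card T"
  proof (intro eventually_ball_finite fin ballI)
    fix v assume "v \<in> T"
    then have "filterlim (\<lambda>n. v (x v) ^ n) at_top sequentially"
      using filterlim_realpow_sequentially_gt1[of "v (x v)"] x(1)[of v]
      by (intro filterlim_at_infinity_imp_filterlim_at_top) (auto intro!: always_eventually)
    then show "\<forall>\<^sub>F n in sequentially. v (x v) ^ n > card T"
      by (auto simp: filterlim_at_top_dense)
  qed
  then obtain N where N: "\<And>v. v \<in> T \<Longrightarrow> v (x v) ^ N > card T"
    using eventually_happens'[OF sequentially_bot] by blast
  define z where "z v = x v ^ N" for v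
  have big: "v (z v) > card T" if "v \<in> T" for v
    using N[OF that] absval.power[OF absval[OF that]] by (simp add: z_def)
  have small: "t (z v) \<le> 1" if "v \<in> T" "t \<in> T" "t \<noteq> v" for v t
    using x(2)[OF that] absval.power[OF absval[OF that(2)]] absval.nonneg[OF absval[OF that(2)]]
    by (auto simp: z_def intro: power_le_one)
  have card_pos: "card T \<ge> 1" if "v \<in> T" for v
    using that fin by (auto simp: Suc_le_eq card_gt_0_iff)
  have inj: "inj_on z T"
  proof (rule inj_onI, rule ccontr)
    fix v w assume *: "v \<in> T" "w \<in> T" "z v = z w" "v \<noteq> w"
    then show False
      using big[of v] small[of w v] card_pos[of v] by auto
  qed
  have "independent (z ` T)"
  proof
    assume "dependent (z ` T)"
    then obtain c where c: "(\<Sum>y\<in>z ` T. of_rat (c y) * y) = 0" "\<exists>y\<in>z ` T. c y \<noteq> 0"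
      using fin by (auto simp: dependent_finite)
    define b where "b v = c (z v)" for v
    have sum0: "(\<Sum>v\<in>T. of_rat (b v) * z v) = 0"
      using c(1) by (simp add: sum.reindex[OF inj] b_def)
    have "T \<noteq> {}" using c by auto
    then have "Max ((\<lambda>t. u (b t)) ` T) \<in> (\<lambda>t. u (b t)) ` T"
      using fin by (intro Max_in) auto
    then obtain v where "v \<in> T" "Max ((\<lambda>t. u (b t)) ` T) = u (b v)"
      by auto
    then have v: "v \<in> T" "\<And>t. t \<in> T \<Longrightarrow> u (b t) \<le> u (b v)"
      using fin by (auto simp flip: Max_ge_iff intro: Max_ge[THEN order_trans])
    interpret v: absval v using v(1) by (rule absval)
    have le: "v (of_rat (b t)) \<le> v (of_rat (b v))" if "t \<in> T" for t
      using v(2)[OF that] order[OF v(1)] by simp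
    have "b v \<noteq> 0"
    proof
      assume "b v = 0"
      then have "b t = 0" if "t \<in> T" for t
        using le[OF that] v.nonneg[of "of_rat (b t)"] by (simp add: order.antisym)
      with c(2) show False by (auto simp: b_def)
    qed
    have "of_rat (b v) * z v = - (\<Sum>t\<in>T - {v}. of_rat (b t) * z t)"
      using sum0 sum.remove[OF fin v(1), of "\<lambda>t. of_rat (b t) * z t"] by (simp add: add_eq_0_iff)
    then have "v (of_rat (b v) * z v) \<le> (\<Sum>t\<in>T - {v}. v (of_rat (b t) * z t))"
      using v.sum_le by simp
    also have "\<dots> \<le> (\<Sum>t\<in>T - {v}. v (of_rat (b v)))"
    proof (rule sum_mono)
      fix t assume t: "t \<in> T - {v}"
      then have "v (of_rat (b t)) * v (z t) \<le> v (of_rat (b v)) * 1"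
        using le small v(1) by (intro mult_mono) auto
      then show "v (of_rat (b t) * z t) \<le> v (of_rat (b v))"
        by (simp add: v.mult)
    qed
    also have "\<dots> \<le> card T * v (of_rat (b v))"
      using fin by (simp add: card_Diff1_le mult_right_mono)
    also have "\<dots> < v (z v) * v (of_rat (b v))"
      using big[OF v(1)] \<open>b v \<noteq> 0\<close> by (intro mult_strict_right_mono) auto
    finally show False
      by (simp add: v.mult mult.commute)
  qed
  then have "card (z ` T) \<le> card B"
    using independent_span_bound[OF finite_Basis] span_Basis by auto
  with inj show ?thesis by (simp add: card_image)
qed

lemma place_memD:
  assumes "V \<in> places" "v \<in> V"
  shows "nontrivial_absolute_value v"
  using assms by (auto simp: places_def absolute_value_equiv_def elim!: quotientE)

lemma place_eqI:
  assumes "V \<in> places" "W \<in> places" "v \<in> V" "w \<in> W" "(v, w) \<in> absolute_value_equiv"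
  shows "V = W"
  using assms quotient_eqI[OF equiv_absolute_value_equiv] unfolding places_def by blast

text \<open>\<open>P\<close> picks absolute values above one place of the rationals, all of which
  order the rationals as \<open>u\<close> does. One representative is chosen per place; every finite
  set of representatives is bounded by the size of a basis.\<close>

lemma finite_places_over:
  fixes P :: "('k :: field_char_0 \<Rightarrow> real) \<Rightarrow> bool"
  assumes "number_field TYPE('k)"
    and order: "\<And>v p q. absolute_value v \<Longrightarrow> P v \<Longrightarrow>
      v (of_rat p) \<le> v (of_rat q) \<longleftrightarrow> u p \<le> (u q :: real)"
  shows "finite {V \<in> places. \<exists>v\<in>V. P v}" (is "finite ?S")
proof -
  obtain B where B: "finite_dimensional_vector_space (\<lambda>(q :: rat) (x :: 'k). of_rat q * x) B"
    using assms(1) by (auto simp: number_field_def)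
  have "\<forall>V\<in>?S. \<exists>v. v \<in> V \<and> P v" by blast
  then obtain r where r: "\<And>V. V \<in> ?S \<Longrightarrow> r V \<in> V" "\<And>V. V \<in> ?S \<Longrightarrow> P (r V)"
    by (metis (no_types, lifting) bchoice)
  have eq: "V = W" if "V \<in> ?S" "W \<in> ?S" "(r V, r W) \<in> absolute_value_equiv" for V W
    using that r by (intro place_eqI[of V W "r V" "r W"]) auto
  have nt: "nontrivial_absolute_value (r V)" if "V \<in> ?S" for V
    using that r place_memD by blast
  have inj: "inj_on r ?S"
  proof (rule inj_onI)
    fix V W assume *: "V \<in> ?S" "W \<in> ?S" "r V = r W"
    have "(r V, r V) \<in> absolute_value_equiv"
      using nt[OF *(1)] equiv_absolute_value_equiv by (metis equivE mem_Collect_eq refl_onD)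
    with * eq[of V W] show "V = W" by auto
  qed
  have "finite (r ` ?S) \<and> card (r ` ?S) \<le> card B"
  proof (rule finite_if_finite_subsets_card_bdd)
    fix T assume T: "T \<subseteq> r ` ?S" "finite T"
    show "card T \<le> card B"
    proof (rule card_inequivalent_le[OF B T(2)])
      fix v assume "v \<in> T"
      then obtain V where V: "V \<in> ?S" "v = r V" using T by blast
      show "nontrivial_absolute_value v" using nt V by auto
      then show "v (of_rat p) \<le> v (of_rat q) \<longleftrightarrow> u p \<le> u q" for p q
        using order r V by (auto simp: nontrivial_absolute_value_def)
      fix w assume "w \<in> T" "v \<noteq> w"
      then obtain W where W: "W \<in> ?S" "w = r W" using T by blast
      show "(v, w) \<notin> absolute_value_equiv"
        using eq[OF V(1) W(1)] V W \<open>v \<noteq> w\<close> by auto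
    qed
  qed
  then show ?thesis
    using inj by (blast dest: finite_imageD)
qed

section \<open>Archimedean and non-archimedean absolute values\<close>

text \<open>Exponential growth beats linear growth. This removes factors linear in k from estimates
  of k-th powers.\<close>

lemma power_le_linear_imp_le_1:
  fixes a :: real
  assumes "\<And>k :: nat. a ^ k \<le> of_nat k * b + c"
  shows "a \<le> 1"
proof (rule ccontr)
  assume "\<not> a \<le> 1"
  then have a: "a > 1" by simp
  have "((\<lambda>k. (real k * b + c) / a ^ k) \<longlongrightarrow> 0) sequentially"
  proof -
    have 1: "(\<lambda>k. real k / a ^ k) \<longlonglongrightarrow> 0"
      using lim_n_over_pown[of a] a by simp
    have 2: "(\<lambda>k. c / a ^ k) \<longlonglongrightarrow> 0"
      using a by (intro LIMSEQ_divide_realpow_zero)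
    show ?thesis
      using tendsto_add[OF tendsto_mult_right[OF 1, of b] 2]
      by (simp add: add_divide_distrib mult.commute)
  qed
  from order_tendstoD(2)[OF this, of 1] have "\<forall>\<^sub>F k in sequentially. (real k * b + c) / a ^ k < 1"
    by simp
  then obtain k where "(real k * b + c) / a ^ k < 1"
    using eventually_happens'[OF sequentially_bot] by blast
  with a have "real k * b + c < a ^ k"
    by (simp add: divide_less_eq)
  with assms[of k] show False by simp
qed

lemma (in absval) of_nat_le: "v (of_nat n) \<le> of_nat n"
proof (induction n)
  case (Suc n)
  then show ?case
    using triangle[of 1 "of_nat n"] by simp
qed simp

text \<open>With M the larger of v x and v y, the binomial expansion of (x + y)^k has k + 1 terms,
  each at most M^k; the factor k + 1 disappears as k grows.\<close>

lemma (in absval) nonarchimedeanI: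
  assumes "\<And>n :: nat. v (of_nat n) \<le> 1"
  shows "nonarchimedean v"
  unfolding nonarchimedean_def
proof (intro allI)
  fix x y
  define M where "M = max (v x) (v y)"
  show "v (x + y) \<le> max (v x) (v y)"
  proof (cases "M = 0")
    case True
    then have "v x = 0" "v y = 0"
      using nonneg[of x] nonneg[of y] unfolding M_def by linarith+
    then show ?thesis by simp
  next
    case False
    then have M: "M > 0"
      using nonneg[of x] unfolding M_def by linarith
    have "(v (x + y) / M) ^ k \<le> of_nat k * 1 + 1" for k
    proof -
      have "v (x + y) ^ k = v (\<Sum>i\<le>k. of_nat (k choose i) * x ^ i * y ^ (k - i))"
        by (simp add: binomial_ring flip: power)
      also have "\<dots> \<le> (\<Sum>i\<le>k. v (of_nat (k choose i) * x ^ i * y ^ (k - i)))"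
        by (rule sum_le)
      also have "\<dots> \<le> (\<Sum>i\<le>k. M ^ k)"
      proof (rule sum_mono)
        fix i assume "i \<in> {..k}"
        have "v (of_nat (k choose i)) * v x ^ i * v y ^ (k - i) \<le> 1 * M ^ i * M ^ (k - i)"
          using M assms by (intro mult_mono power_mono) (auto simp: M_def)
        then show "v (of_nat (k choose i) * x ^ i * y ^ (k - i)) \<le> M ^ k"
          using \<open>i \<in> {..k}\<close> by (simp add: mult power flip: power_add)
      qed
      finally show ?thesis
        using M by (simp add: power_divide divide_le_eq add.commute)
    qed
    then have "v (x + y) / M \<le> 1"
      by (rule power_le_linear_imp_le_1)
    then show ?thesis
      using M by (simp add: M_def divide_le_eq)
  qed
qed

text \<open>An integer below n^k has k digits in base n, and the absolute value of a digit is at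
  most n by the triangle inequality.\<close>

lemma (in absval) of_nat_digits_le:
  assumes "n \<ge> 2" "m < n ^ k"
  shows "v (of_nat m) \<le> of_nat k * of_nat n * max 1 (v (of_nat n)) ^ k"
  using assms(2)
proof (induction k arbitrary: m)
  case (Suc k)
  define M where "M = max 1 (v (of_nat n))"
  have M: "M \<ge> 1" "v (of_nat n) \<le> M" by (auto simp: M_def)
  define q r where "q = m div n" and "r = m mod n"
  have m: "m = n * q + r" by (simp add: q_def r_def)
  have "q < n ^ k"
    using Suc.prems by (simp add: q_def less_mult_imp_div_less mult.commute)
  have r: "v (of_nat r) \<le> of_nat n"
    using assms(1) by (intro order.trans[OF of_nat_le]) (simp add: r_def)
  have "v (of_nat m) \<le> v (of_nat n) * v (of_nat q) + v (of_nat r)"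
    unfolding m of_nat_add of_nat_mult using triangle by (metis mult)
  also have "\<dots> \<le> M * (of_nat k * of_nat n * M ^ k) + of_nat n"
    using Suc.IH[OF \<open>q < n ^ k\<close>] r M by (intro add_mono mult_mono) (auto simp: M_def)
  also have "\<dots> \<le> M * (of_nat k * of_nat n * M ^ k) + of_nat n * M ^ Suc k"
    using M by (simp add: mult_le_cancel_left1 one_le_power del: power_Suc)
  also have "\<dots> = of_nat (Suc k) * of_nat n * M ^ Suc k"
    by (simp add: algebra_simps)
  finally show ?case by (simp add: M_def)
qed simp

text \<open>Ostrowski's argument: expand \<open>m ^ k\<close> in base \<open>n\<close> and let \<open>k\<close> tend to infinity.\<close>

lemma (in absval) ln_of_nat_le:
  assumes n: "n \<ge> 2" and m: "m \<ge> 2" and vm: "v (of_nat m) > 1"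
  shows "v (of_nat n) > 1 \<and> ln (v (of_nat m)) * ln (of_nat n) \<le> ln (v (of_nat n)) * ln (of_nat m)"
proof -
  define M where "M = max 1 (v (of_nat n))"
  define c where "c = ln (of_nat m) / ln (of_nat n :: real)"
  have M: "M \<ge> 1" by (simp add: M_def)
  have ln_n: "ln (real n) > 0" and ln_m: "ln (real m) > 0"
    using n m by auto
  then have c: "c > 0" by (simp add: c_def)
  define A where "A = v (of_nat m) / M powr c"
  have "A ^ k \<le> of_nat k * (c * n * M) + n * M" for k :: nat
  proof -
    \<comment> \<open>m^k has at most \<open>L\<close> digits in base n. As L is at most k * c + 1,
      the digit bound is (M powr c)^k times a linear function of k.\<close>
    define L where "L = nat \<lfloor>k * c\<rfloor> + 1"
    have L: "real L > k * c" "real L \<le> k * c + 1"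
      using c unfolding L_def by (auto simp: nat_le_iff; linarith)+
    have "real (m ^ k) = exp (k * ln m)"
      using m by (simp add: exp_of_nat_mult)
    also have "k * ln m = (k * c) * ln n"
      using ln_n by (simp add: c_def)
    also have "\<dots> < L * ln n"
      using L ln_n by (intro mult_strict_right_mono)
    also have "exp (L * ln n) = real (n ^ L)"
      using n by (simp add: exp_of_nat_mult)
    finally have "m ^ k < n ^ L"
      by (simp only: of_nat_less_iff exp_less_mono)
    then have "v (of_nat (m ^ k)) \<le> real L * real n * M ^ L"
      unfolding M_def by (rule of_nat_digits_le[OF n])
    then have "v (of_nat m) ^ k \<le> real L * real n * M powr L"
      using M by (simp add: power powr_realpow)
    also have "\<dots> \<le> (k * c + 1) * n * M powr (k * c + 1)"
      using L M by (intro mult_mono powr_mono) auto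
    also have "\<dots> = (k * c + 1) * n * M * (M powr c) ^ k"
      using M by (simp add: powr_add powr_powr mult.commute flip: powr_realpow)
    finally show ?thesis
      using M by (simp add: A_def power_divide divide_le_eq algebra_simps)
  qed
  then have "A \<le> 1"
    by (rule power_le_linear_imp_le_1)
  then have le: "v (of_nat m) \<le> M powr c"
    using M by (simp add: A_def divide_le_eq)
  have "v (of_nat n) > 1"
  proof (rule ccontr)
    assume "\<not> ?thesis"
    then have "M = 1" by (simp add: M_def)
    with le vm show False by simp
  qed
  moreover from this have "M = v (of_nat n)" by (simp add: M_def)
  with le vm have "ln (v (of_nat m)) \<le> ln (v (of_nat n) powr c)"
    by (subst ln_le_cancel_iff) (use \<open>v (of_nat n) > 1\<close> in auto)
  then have "ln (v (of_nat m)) \<le> c * ln (v (of_nat n))"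
    using \<open>v (of_nat n) > 1\<close> by (subst (asm) ln_powr) auto
  then have "ln (v (of_nat m)) * ln (of_nat n) \<le> ln (v (of_nat n)) * ln (of_nat m)"
    using ln_n by (simp add: c_def field_simps)
  ultimately show ?thesis by simp
qed

text \<open>\<open>ln_of_nat_le\<close> used in both directions shows that ln (v m) / ln m is the
  same positive number for all m \<ge> 2, so v is increasing there; 0 and 1 are compared by
  hand.\<close>

lemma (in absval) archimedean_of_nat_le_iff:
  assumes "\<not> nonarchimedean v"
  shows "v (of_nat m) \<le> v (of_nat n) \<longleftrightarrow> m \<le> n"
proof -
  obtain N :: nat where N: "v (of_nat N) > 1"
    using nonarchimedeanI assms by (meson not_le)
  then have N2: "N \<ge> 2"
    by (cases "N = 0 \<or> N = 1") auto
  have gt: "v (of_nat n) > 1" if "n \<ge> 2" for n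
    using ln_of_nat_le[OF that N2 N] by simp
  have eq: "ln (v (of_nat m)) * ln (of_nat n) = ln (v (of_nat n)) * ln (of_nat m)"
    if "m \<ge> 2" "n \<ge> 2" for m n
    using ln_of_nat_le[of m n] ln_of_nat_le[of n m] gt that by (auto intro: antisym)
  have less: "v (of_nat m) < v (of_nat n)" if "m < n" for m n
  proof (cases "m \<ge> 2")
    case True
    have "ln (v (of_nat m)) * ln (of_nat n) < ln (v (of_nat n)) * ln (of_nat n)"
      unfolding eq[OF True order.trans[OF True less_imp_le[OF that]]]
      using that True gt[of n] by (intro mult_strict_left_mono) (auto intro: ln_gt_zero)
    then have "ln (v (of_nat m)) < ln (v (of_nat n))"
      using that True by (subst (asm) mult_less_cancel_right_pos) auto
    then show ?thesis
      using gt[OF True] gt[of n] True that by (subst (asm) ln_less_cancel_iff) auto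
  next
    case False
    then consider "m = 0" "n = 1" | "m = 0" "n \<ge> 2" | "m = 1" "n \<ge> 2"
      using \<open>m < n\<close> by linarith
    then show ?thesis
      using gt[of n] by cases auto
  qed
  show ?thesis
    by (cases m n rule: linorder_cases) (use less[of m n] less[of n m] in auto)
qed

lemma (in absval) of_int: "v (of_int a) = v (of_nat (nat \<bar>a\<bar>))"
  by (cases a rule: int_cases2) auto

lemma archimedean_of_rat_le_iff:
  fixes v :: "'a :: field_char_0 \<Rightarrow> real"
  assumes "absolute_value v" "\<not> nonarchimedean v"
  shows "v (of_rat p) \<le> v (of_rat q) \<longleftrightarrow> \<bar>p\<bar> \<le> \<bar>q\<bar>"
proof -
  interpret absval v by unfold_locales fact
  obtain a b where p: "p = Rat.Fract a b" "b > 0" by (cases p) auto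
  obtain c d where q: "q = Rat.Fract c d" "d > 0" by (cases q) auto
  have "v (of_rat p) \<le> v (of_rat q) \<longleftrightarrow> v (of_int a * of_int d) \<le> v (of_int c * of_int b)"
    using p q by (simp add: of_rat_rat divide mult divide_simps)
  also have "\<dots> \<longleftrightarrow> nat \<bar>a * d\<bar> \<le> nat \<bar>c * b\<bar>"
    unfolding of_int_mult[symmetric] of_int archimedean_of_nat_le_iff[OF assms(2)] ..
  also have "\<dots> \<longleftrightarrow> \<bar>a\<bar> * d \<le> \<bar>c\<bar> * b"
    using p q by (simp add: abs_mult nat_le_eq_zle)
  also have "\<dots> \<longleftrightarrow> \<bar>p\<bar> \<le> \<bar>q\<bar>"
    using p q by (simp add: abs_rat mult.commute)
  finally show ?thesis .
qed

lemma finite_archimedean_places: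
  assumes "number_field TYPE('k :: field_char_0)"
  shows "finite (archimedean_places :: ('k \<Rightarrow> real) set set)"
  unfolding archimedean_places_def
proof (rule finite_places_over[OF assms, where u = "\<lambda>q. real_of_rat \<bar>q\<bar>"])
  fix v :: "'k \<Rightarrow> real" and p q :: rat
  assume "absolute_value v" "\<not> nonarchimedean v"
  then show "v (of_rat p) \<le> v (of_rat q) \<longleftrightarrow> real_of_rat \<bar>p\<bar> \<le> real_of_rat \<bar>q\<bar>"
    unfolding of_rat_less_eq by (rule archimedean_of_rat_le_iff)
qed

section \<open>Non-archimedean absolute values and the places above a prime\<close>

locale nonarch_absval = absval +
  assumes nonarchimedean: "nonarchimedean v"
begin

lemma add_le_max: "v (x + y) \<le> max (v x) (v y)"
  using nonarchimedean by (simp add: nonarchimedean_def)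

lemma add_le: "v x \<le> B \<Longrightarrow> v y \<le> B \<Longrightarrow> v (x + y) \<le> B"
  using add_le_max[of x y] by linarith

lemma add_less: "v x < B \<Longrightarrow> v y < B \<Longrightarrow> v (x + y) < B"
  using add_le_max[of x y] by linarith

lemma diff_le: "v x \<le> B \<Longrightarrow> v y \<le> B \<Longrightarrow> v (x - y) \<le> B"
  using add_le_max[of x "- y"] by simp

lemma diff_less: "v x < B \<Longrightarrow> v y < B \<Longrightarrow> v (x - y) < B"
  using add_le_max[of x "- y"] by simp

lemma add_eq: "v y < v x \<Longrightarrow> v (x + y) = v x"
  using add_le_max[of x y] add_le_max[of "x + y" "- y"] by simp

lemma sum_le_bound: "(\<And>i. i \<in> I \<Longrightarrow> v (f i) \<le> B) \<Longrightarrow> 0 \<le> B \<Longrightarrow> v (sum f I) \<le> B"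
  by (induction I rule: infinite_finite_induct) (auto intro: add_le)

lemma of_nat_le_1: "v (of_nat n) \<le> 1"
  by (induction n) (auto intro: add_le)

lemma of_int_le_1: "v (of_int n) \<le> 1"
  unfolding of_int by (rule of_nat_le_1)

lemma mult_le_1: "v x \<le> 1 \<Longrightarrow> v y \<le> 1 \<Longrightarrow> v (x * y) \<le> 1"
  by (simp add: mult mult_le_one)

lemma mult_less_1: "v x < 1 \<Longrightarrow> v y \<le> 1 \<Longrightarrow> v (x * y) < 1"
  using mult_left_mono[of "v y" 1 "v x"] by (simp add: mult)

lemma power_le_1: "v x \<le> 1 \<Longrightarrow> v (x ^ n) \<le> 1"
  by (simp add: power power_le_one)

lemma of_nat_eq_1:
  assumes "prime p" "v (of_nat p) < 1" "\<not> p dvd n"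
  shows "v (of_nat n) = 1"
proof (rule ccontr)
  assume "v (of_nat n) \<noteq> 1"
  with of_nat_le_1[of n] have n: "v (of_nat n) < 1" by simp
  have "coprime (int p) (int n)"
    using assms prime_imp_coprime[of p n] by simp
  then obtain x y where "x * int p + y * int n = 1"
    using bezout_int[of "int p" "int n"] by auto
  then have "(of_int (x * int p + y * int n) :: 'a) = 1" by simp
  moreover have "v (of_int (x * int p + y * int n)) < 1"
    using assms(2) n mult_less_1[of "of_nat p" "of_int x"] mult_less_1[of "of_nat n" "of_int y"]
    by (auto simp: of_int_le_1 mult.commute intro!: add_less)
  ultimately show False by simp
qed

lemma of_nat_eq_power:
  assumes "prime p" "v (of_nat p) < 1" "n > 0"
  shows "v (of_nat n) = v (of_nat p) ^ multiplicity p n"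
proof -
  obtain m where m: "n = p ^ multiplicity p n * m" "\<not> p dvd m"
    using assms(1,3) multiplicity_decompose'[of n p] not_prime_unit[of p] by blast
  have "v (of_nat n) = v (of_nat (p ^ multiplicity p n * m))"
    by (rule arg_cong[OF m(1), of "\<lambda>n. v (of_nat n)"])
  then have "v (of_nat n) = v (of_nat p) ^ multiplicity p n * v (of_nat m)"
    by (simp only: of_nat_mult of_nat_power mult power)
  then show ?thesis
    using of_nat_eq_1[OF assms(1,2) m(2)] by simp
qed

end

lemma power_int_le_power_int_iff:
  fixes a :: real
  assumes "0 < a" "a < 1"
  shows "a powi k \<le> a powi l \<longleftrightarrow> l \<le> k"
proof (cases "l \<le> k")
  case True
  then show ?thesis
    using assms power_int_decreasing[of l k a] by simp
next
  case False
  then show ?thesis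
    using assms power_int_strict_decreasing[of k l a] by simp
qed

text \<open>On nonzero rationals v is v p raised to the p-adic exponent. The base v p depends on v,
  but all bases strictly between 0 and 1 order the powers alike, so the single base 1 / 2 in
  \<open>u\<close> serves for every v.\<close>

lemma nonarchimedean_of_rat_le_iff:
  assumes "prime p"
  obtains u :: "rat \<Rightarrow> real"
  where "\<And>(v :: 'a :: field_char_0 \<Rightarrow> real) q r.
    absolute_value v \<Longrightarrow> nonarchimedean v \<Longrightarrow> v (of_nat p) < 1 \<Longrightarrow>
    v (of_rat q) \<le> v (of_rat r) \<longleftrightarrow> u q \<le> u r"
proof -
  define k :: "rat \<Rightarrow> int" where "k q = (case quotient_of q of (a, b) \<Rightarrow>
    int (multiplicity p (nat \<bar>a\<bar>)) - int (multiplicity p (nat b)))" for q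
  define u :: "rat \<Rightarrow> real" where "u q = (if q = 0 then 0 else (1 / 2) powi k q)" for q
  have "v (of_rat q) \<le> v (of_rat r) \<longleftrightarrow> u q \<le> u r"
    if v: "absolute_value v" "nonarchimedean v" "v (of_nat p) < 1"
    for v :: "'a \<Rightarrow> real" and q r
  proof -
    interpret nonarch_absval v by unfold_locales fact+
    have p0: "v (of_nat p) > 0"
      using assms by (simp add: prime_gt_0_nat)
    have eq: "v (of_rat q) = v (of_nat p) powi k q" if "q \<noteq> 0" for q
    proof -
      obtain a b where ab: "quotient_of q = (a, b)" by (cases "quotient_of q")
      have b: "b > 0" using quotient_of_denom_pos[OF ab] .
      have q: "q = of_int a / of_int b" using quotient_of_div[OF ab] .
      with that have a: "a \<noteq> 0" by auto
      have "v (of_int a) = v (of_nat p) ^ multiplicity p (nat \<bar>a\<bar>)"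
        unfolding of_int using a by (intro of_nat_eq_power assms v(3)) auto
      moreover have "v (of_int b) = v (of_nat p) ^ multiplicity p (nat b)"
        unfolding of_int using b by (subst of_nat_eq_power[OF assms v(3)]) auto
      moreover have "v (of_rat q) = v (of_int a) / v (of_int b)"
        by (simp add: q of_rat_divide divide)
      ultimately show ?thesis
        using p0 by (simp add: k_def ab power_int_diff)
    qed
    have pos: "v (of_rat q) > 0" "u q > 0" if "q \<noteq> 0" for q
      using that by (auto simp: u_def)
    show ?thesis
    proof (cases "q = 0 \<or> r = 0")
      case True
      then consider "q = 0" | "q \<noteq> 0" "r = 0" by blast
      then show ?thesis
      proof cases
        case 1
        then show ?thesis
          using pos(2)[of r] by (cases "r = 0") (auto simp: less_imp_le u_def)
      next
        case 2
        have "u r = 0" "v (of_rat r) = 0"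
          using 2 by (auto simp: u_def)
        then show ?thesis
          using pos[OF 2(1)] by linarith
      qed
    next
      case False
      then show ?thesis
        using power_int_le_power_int_iff[OF p0 v(3)] power_int_le_power_int_iff[of "1 / 2"]
        by (auto simp: eq u_def)
    qed
  qed
  then show thesis by (rule that)
qed

lemma finite_places_above_prime:
  assumes "number_field TYPE('k :: field_char_0)" "prime p"
  shows "finite {V \<in> places. \<exists>v\<in>V. nonarchimedean v \<and> v (of_nat p :: 'k) < 1}"
proof -
  obtain u :: "rat \<Rightarrow> real" where u: "\<And>(v :: 'k \<Rightarrow> real) q r.
      absolute_value v \<Longrightarrow> nonarchimedean v \<Longrightarrow> v (of_nat p) < 1 \<Longrightarrow>
      v (of_rat q) \<le> v (of_rat r) \<longleftrightarrow> u q \<le> u r"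
    using nonarchimedean_of_rat_le_iff[OF assms(2)] by blast
  show ?thesis
  proof (rule finite_places_over[OF assms(1), where u = u])
    fix v :: "'k \<Rightarrow> real" and q r :: rat
    assume "absolute_value v" "nonarchimedean v \<and> v (of_nat p) < 1"
    then show "v (of_rat q) \<le> v (of_rat r) \<longleftrightarrow> u q \<le> u r"
      using u by blast
  qed
qed

section \<open>Extending the \<open>p\<close>-adic absolute value\<close>

definition subring_set :: "'a :: comm_ring_1 set \<Rightarrow> bool" where
  "subring_set A \<longleftrightarrow> 1 \<in> A \<and> (\<forall>x\<in>A. \<forall>y\<in>A. x - y \<in> A \<and> x * y \<in> A)"

context
  fixes A :: "'a :: comm_ring_1 set"
  assumes A: "subring_set A"
begin

lemma subring_set_one: "1 \<in> A"
  and subring_set_diff: "x \<in> A \<Longrightarrow> y \<in> A \<Longrightarrow> x - y \<in> A"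
  and subring_set_mult: "x \<in> A \<Longrightarrow> y \<in> A \<Longrightarrow> x * y \<in> A"
  using A by (auto simp: subring_set_def)

lemma subring_set_zero: "0 \<in> A"
  using subring_set_diff[OF subring_set_one subring_set_one] by simp

lemma subring_set_uminus: "x \<in> A \<Longrightarrow> - x \<in> A"
  using subring_set_diff[OF subring_set_zero, of x] by simp

lemma subring_set_add: "x \<in> A \<Longrightarrow> y \<in> A \<Longrightarrow> x + y \<in> A"
  using subring_set_diff[of x "- y"] subring_set_uminus[of y] by simp

lemma subring_set_sum: "(\<And>i. i \<in> I \<Longrightarrow> f i \<in> A) \<Longrightarrow> sum f I \<in> A"
  by (induction I rule: infinite_finite_induct) (auto intro: subring_set_add subring_set_zero)

lemma subring_set_power: "x \<in> A \<Longrightarrow> x ^ n \<in> A"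
  by (induction n) (auto intro: subring_set_mult subring_set_one)

lemma subring_set_of_nat: "of_nat n \<in> A"
  by (induction n) (auto intro: subring_set_add subring_set_zero subring_set_one)

lemma subring_set_of_int: "of_int n \<in> A"
  by (cases n rule: int_cases2) (auto intro: subring_set_of_nat subring_set_uminus)

text \<open>The set is the ring A[x], the extension to which the maximality of a subring will be
  applied.\<close>

lemma subring_set_adjoin:
  "subring_set {poly q x | q. \<forall>i. coeff q i \<in> A}" (is "subring_set ?B")
  unfolding subring_set_def
proof (intro conjI ballI)
  show "1 \<in> ?B"
    by (rule CollectI, rule exI[of _ "[:1:]"])
      (auto simp: coeff_pCons subring_set_zero subring_set_one split: nat.splits)
  fix y z assume "y \<in> ?B" "z \<in> ?B"
  then obtain q r where q: "y = poly q x" "\<And>i. coeff q i \<in> A"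
    and r: "z = poly r x" "\<And>i. coeff r i \<in> A" by auto
  show "y - z \<in> ?B"
    by (rule CollectI, rule exI[of _ "q - r"]) (use q r in \<open>auto intro: subring_set_diff\<close>)
  show "y * z \<in> ?B"
    by (rule CollectI, rule exI[of _ "q * r"])
      (use q r in \<open>auto simp: coeff_mult intro: subring_set_sum subring_set_mult\<close>)
qed

lemma adjoin_superset: "A \<subseteq> {poly q x | q. \<forall>i. coeff q i \<in> A}"
proof
  fix a assume "a \<in> A"
  then show "a \<in> {poly q x | q. \<forall>i. coeff q i \<in> A}"
    by (intro CollectI exI[of _ "[:a:]"]) (auto simp: coeff_pCons subring_set_zero split: nat.splits)
qed

lemma adjoin_mem: "x \<in> {poly q x | q. \<forall>i. coeff q i \<in> A}"
  by (intro CollectI exI[of _ "[:0, 1:]"])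
    (auto simp: coeff_pCons subring_set_zero subring_set_one split: nat.splits)

end

lemma subring_set_Ints: "subring_set \<int>"
  by (auto simp: subring_set_def)

lemma subring_set_Union_chain:
  assumes "C \<noteq> {}" "subset.chain {A. subring_set A} C"
  shows "subring_set (\<Union>C)"
proof -
  have sub: "subring_set A" if "A \<in> C" for A
    using assms(2) that by (auto simp: subset.chain_def)
  have both: "\<exists>D\<in>C. x \<in> D \<and> y \<in> D" if "x \<in> \<Union>C" "y \<in> \<Union>C" for x y
  proof -
    from that obtain D E where "D \<in> C" "E \<in> C" "x \<in> D" "y \<in> E" by auto
    moreover from this have "D \<subseteq> E \<or> E \<subseteq> D"
      using assms(2) unfolding subset.chain_def by blast
    ultimately show ?thesis by auto
  qed
  have "x - y \<in> \<Union>C \<and> x * y \<in> \<Union>C" if "x \<in> \<Union>C" "y \<in> \<Union>C" for x y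
  proof -
    from both[OF that] obtain D where "D \<in> C" "x \<in> D" "y \<in> D"
      by blast
    then show ?thesis
      using subring_set_diff[OF sub] subring_set_mult[OF sub] by blast
  qed
  moreover have "1 \<in> \<Union>C"
    using assms(1) sub subring_set_one by auto
  ultimately show ?thesis
    unfolding subring_set_def by blast
qed

text \<open>Such an \<open>A\<close> turns out to be a valuation ring; leaving out 1 / p keeps p
  from being a unit.\<close>

locale maximal_subring =
  fixes A :: "'a :: field_char_0 set" and p :: nat
  assumes prime: "prime p"
    and subring: "subring_set A"
    and inverse_p: "inverse (of_nat p) \<notin> A"
    and maximal: "\<And>B. subring_set B \<Longrightarrow> A \<subseteq> B \<Longrightarrow> inverse (of_nat p) \<notin> B \<Longrightarrow> B = A"

lemma maximal_subring_exists:
  assumes "prime p"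
  shows "\<exists>A :: ('a :: field_char_0) set. maximal_subring A p"
proof -
  define S where "S = {A :: 'a set. subring_set A \<and> inverse (of_nat p) \<notin> A}"
  have p0: "(of_nat p :: 'a) \<noteq> 0" using assms by (simp add: prime_gt_0_nat)
  have "inverse (of_nat p :: 'a) \<notin> \<int>"
  proof
    assume "inverse (of_nat p :: 'a) \<in> \<int>"
    then obtain k where "inverse (of_nat p :: 'a) = of_int k" by (auto elim: Ints_cases)
    then have "(of_int (k * int p) :: 'a) = of_int 1"
      using p0 by (simp add: field_simps)
    then have "k * int p = 1" unfolding of_int_eq_iff .
    then have "int p dvd 1" by (metis dvd_triv_right)
    then show False using assms by (simp add: prime_nat_iff)
  qed
  then have "S \<noteq> {}"
    using subring_set_Ints by (auto simp: S_def)
  moreover have "\<Union>C \<in> S" if "C \<noteq> {}" "subset.chain S C" for C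
  proof -
    have "subset.chain {A. subring_set A} C" "\<And>D. D \<in> C \<Longrightarrow> inverse (of_nat p) \<notin> D"
      using that(2) by (auto simp: S_def subset.chain_def)
    then show ?thesis
      using that(1) subring_set_Union_chain by (auto simp: S_def)
  qed
  ultimately have "\<exists>M\<in>S. \<forall>B\<in>S. M \<subseteq> B \<longrightarrow> B = M"
    by (rule subset_Zorn_nonempty)
  then obtain A where A: "A \<in> S" and max: "\<And>B. B \<in> S \<Longrightarrow> A \<subseteq> B \<Longrightarrow> B = A"
    by blast
  then have "maximal_subring A p"
    using assms A max by unfold_locales (auto simp: S_def)
  then show ?thesis ..
qed

section \<open>The maximal subring is a valuation ring\<close>

context maximal_subring
begin

lemmas intros = subring_set_one[OF subring] subring_set_diff[OF subring] subring_set_mult[OF subring]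
  subring_set_zero[OF subring] subring_set_uminus[OF subring] subring_set_add[OF subring]
  subring_set_sum[OF subring] subring_set_power[OF subring] subring_set_of_nat[OF subring]
  subring_set_of_int[OF subring]

abbreviation "P \<equiv> (of_nat p :: 'a)"

lemma p_pos [simp]: "p > 0"
  using prime by (simp add: prime_gt_0_nat)

text \<open>A[x] is strictly larger than \<open>A\<close>, so it contains 1 / p. All later arguments
  use maximality in this form.\<close>

lemma adjoin_inverse_P:
  assumes "x \<notin> A"
  obtains q where "\<And>i. coeff q i \<in> A" "poly q x = inverse P"
proof -
  define B where "B = {poly q x | q. \<forall>i. coeff q i \<in> A}"
  have B: "subring_set B" "A \<subseteq> B" "x \<in> B"
    unfolding B_def by (rule subring_set_adjoin[OF subring] adjoin_superset[OF subring]
      adjoin_mem[OF subring])+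
  have "inverse P \<in> B"
  proof (rule ccontr)
    assume "inverse P \<notin> B"
    then have "B = A" by (rule maximal[OF B(1,2)])
    with B(3) assms show False by simp
  qed
  then have "\<exists>q. inverse P = poly q x \<and> (\<forall>i. coeff q i \<in> A)"
    unfolding B_def by simp
  then show thesis using that by metis
qed

lemma one_minus_nonzero: "b \<in> A \<Longrightarrow> 1 - P * b \<noteq> 0"
proof
  assume "b \<in> A" "1 - P * b = 0"
  then have "inverse P = b"
    by (simp add: field_simps)
  with \<open>b \<in> A\<close> inverse_p show False by simp
qed

lemma one_minus_power:
  assumes "b \<in> A"
  shows "\<exists>c\<in>A. (1 - P * b) ^ n = 1 - P * c"
proof (induction n)
  case 0
  then show ?case by (intro bexI[of _ 0]) (auto intro: intros)
next
  case (Suc n)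
  then obtain c where c: "c \<in> A" "(1 - P * b) ^ n = 1 - P * c" by auto
  have "(1 - P * b) ^ Suc n = 1 - P * (c + b - P * b * c)"
    unfolding power_Suc c(2) by (simp add: algebra_simps)
  moreover have "c + b - P * b * c \<in> A"
    by (intro intros assms c)
  ultimately show ?case by blast
qed

text \<open>Put u = 1 - p b. If 1 / u were missing from \<open>A\<close>, then 1 / p would be a
  polynomial in 1 / u, and multiplying by u^n would put u^n into p A. But u^n lies in 1 - p A, so 1
  would lie in p A.\<close>

lemma inverse_one_minus:
  assumes b: "b \<in> A"
  shows "inverse (1 - P * b) \<in> A"
proof (rule ccontr)
  define u where "u = 1 - P * b"
  assume "inverse (1 - P * b) \<notin> A"
  then obtain q where q: "\<And>i. coeff q i \<in> A" "poly q (inverse u) = inverse P"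
    unfolding u_def by (metis adjoin_inverse_P)
  define n where "n = degree q"
  have u0: "u \<noteq> 0" and uA: "u \<in> A"
    using one_minus_nonzero[OF b] b by (auto simp: u_def intro: intros)
  define a where "a = (\<Sum>i\<le>n. coeff q i * u ^ (n - i))"
  have "inverse P * u ^ n = a"
    unfolding q(2)[symmetric] poly_altdef a_def n_def sum_distrib_right
    using u0 by (intro sum.cong) (auto simp: power_diff field_simps)
  then have "u ^ n = P * a" by (simp add: field_simps)
  moreover obtain c where "c \<in> A" "u ^ n = 1 - P * c"
    using one_minus_power[OF b] unfolding u_def by blast
  moreover have "a \<in> A"
    unfolding a_def by (intro intros q uA)
  ultimately show False
    using one_minus_nonzero[of "a + c"] by (auto simp: algebra_simps intro: intros)
qed

text \<open>The relation \<open>r\<close> reads u = p * (r_1 / x + ... + r_m / x^m) with the unit u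
  = 1 - p r_0. Multiplied by x^n / u, where n is the degree of \<open>q\<close>, it expresses x^n by
  lower powers of x; they are not negative because the degree of \<open>r\<close> is at most n.
  Substituting for the leading term of \<open>q\<close> lowers its degree.\<close>

lemma lower_degree:
  assumes x: "x \<noteq> 0"
    and q: "\<And>i. coeff q i \<in> A" "poly q x = inverse P"
    and r: "\<And>i. coeff r i \<in> A" "poly r (inverse x) = inverse P"
    and deg: "degree r \<le> degree q" "degree q > 0"
  shows "\<exists>q'. (\<forall>i. coeff q' i \<in> A) \<and> poly q' x = inverse P \<and> degree q' < degree q"
proof -
  define n m where "n = degree q" and "m = degree r"
  define u where "u = 1 - P * coeff r 0"
  have u0: "u \<noteq> 0" and uA: "inverse u \<in> A"
    using one_minus_nonzero inverse_one_minus r(1) by (auto simp: u_def)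
  define c where "c = coeff q n * P * inverse u"
  have cA: "c \<in> A" unfolding c_def by (intro intros q uA)
  define s where "s = (\<Sum>j=1..m. monom (coeff r j) (n - j))"
  define q' where "q' = q - monom (coeff q n) n + smult c s"
  have sA: "coeff s i \<in> A" for i
    unfolding s_def coeff_sum by (intro intros) (auto simp: r intro: intros)
  have "inverse P = coeff r 0 + (\<Sum>j=1..m. coeff r j * inverse x ^ j)"
    unfolding r(2)[symmetric] poly_altdef m_def[symmetric]
    by (subst sum.atMost_shift) (simp add: sum.atLeast1_atMost_eq)
  then have eq: "u = P * (\<Sum>j=1..m. coeff r j * inverse x ^ j)"
    by (simp add: u_def field_simps)
  have "poly s x = (\<Sum>j=1..m. coeff r j * inverse x ^ j) * x ^ n"
    unfolding s_def poly_sum sum_distrib_right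
    using x deg by (intro sum.cong) (auto simp: poly_monom n_def m_def power_diff field_simps)
  then have "P * poly s x = u * x ^ n"
    by (simp add: eq)
  then have "c * poly s x = coeff q n * x ^ n"
    using u0 by (simp add: c_def field_simps)
  then have "poly q' x = inverse P"
    by (simp add: q'_def poly_monom q)
  moreover have "coeff q' i \<in> A" for i
    unfolding q'_def coeff_add coeff_diff coeff_smult
    by (intro intros q sA cA) (auto intro: q intros)
  moreover have "coeff q' i = 0" if "i \<ge> n" for i
  proof -
    have "coeff s i = 0"
      unfolding s_def coeff_sum using that deg(2) by (intro sum.neutral) (auto simp: n_def)
    then show ?thesis
      using that by (auto simp: q'_def n_def coeff_eq_0)
  qed
  then have "degree q' < n"
    using deg(2) by (intro degree_lessI) (auto simp: n_def)
  ultimately show ?thesis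
    by (auto simp: n_def)
qed

text \<open>If x and 1 / x both lay outside \<open>A\<close>, consider for each the least degree of
  a polynomial expressing 1 / p in it. Both degrees are positive, as a constant would put 1 / p into
  \<open>A\<close>, and \<open>lower_degree\<close> undercuts the larger one.\<close>

lemma valuation_ring:
  assumes "x \<notin> A"
  shows "inverse x \<in> A"
proof (rule ccontr)
  assume inv: "inverse x \<notin> A"
  have x: "x \<noteq> 0" using assms by (auto intro: intros)
  define good where "good y n \<longleftrightarrow> (\<exists>q. (\<forall>i. coeff q i \<in> A) \<and> poly q y = inverse P \<and> degree q = n)" for y n
  have ex: "\<exists>n. good y n" if "y \<notin> A" for y
    using adjoin_inverse_P[OF that] unfolding good_def by metis
  have pos: "n > 0" if n: "good y n" for y n
  proof (rule ccontr)
    assume "\<not> n > 0"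
    with n obtain q where "\<And>i. coeff q i \<in> A" "poly q y = inverse P" "degree q = 0"
      by (auto simp: good_def)
    then have "coeff q 0 = inverse P"
      by (auto elim!: degree_eq_zeroE)
    then show False using \<open>\<And>i. coeff q i \<in> A\<close>[of 0] inverse_p by simp
  qed
  define N where "N y = (LEAST n. good y n)" for y
  have good: "good y (N y)" if "y \<notin> A" for y
    unfolding N_def using ex[OF that] by (rule LeastI_ex)
  have not_good: "\<not> good y n" if "n < N y" for y n
    using that unfolding N_def by (rule not_less_Least)
  have impossible: False if y: "y \<notin> A" "inverse y \<notin> A" "N (inverse y) \<le> N y" for y
  proof -
    have "y \<noteq> 0" using y by (auto intro: intros)
    obtain q where q: "\<forall>i. coeff q i \<in> A" "poly q y = inverse P" "degree q = N y"
      using good[OF y(1)] unfolding good_def by blast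
    obtain r where r: "\<forall>i. coeff r i \<in> A" "poly r (inverse y) = inverse P" "degree r = N (inverse y)"
      using good[OF y(2)] unfolding good_def by blast
    have "degree q > 0" using q(3) pos[OF good[OF y(1)]] by simp
    then obtain q' where "\<forall>i. coeff q' i \<in> A" "poly q' y = inverse P" "degree q' < degree q"
      using lower_degree[OF \<open>y \<noteq> 0\<close>, of q r] q r y(3) by auto
    then have "good y (degree q')" "degree q' < N y"
      using q(3) unfolding good_def by auto
    then show False using not_good by blast
  qed
  show False
    using impossible[OF assms inv] impossible[of "inverse x"] assms inv by (cases "N (inverse x) \<le> N x") auto
qed

end

section \<open>Units, rational exponents and the resulting absolute value\<close>

context maximal_subring
begin

definition units :: "'a set" where
  "units = {x \<in> A. x \<noteq> 0 \<and> inverse x \<in> A}"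

lemma units_mult: "x \<in> units \<Longrightarrow> y \<in> units \<Longrightarrow> x * y \<in> units"
  and units_inverse: "x \<in> units \<Longrightarrow> inverse x \<in> units"
  and units_power: "x \<in> units \<Longrightarrow> x ^ n \<in> units"
  and units_in_A: "x \<in> units \<Longrightarrow> x \<in> A"
  and units_nonzero: "x \<in> units \<Longrightarrow> x \<noteq> 0"
  by (auto simp: units_def simp flip: power_inverse intro: intros)

lemma units_divide: "x \<in> units \<Longrightarrow> y \<in> units \<Longrightarrow> x / y \<in> units"
  by (simp add: divide_inverse units_mult units_inverse)

text \<open>One of y / x and x / y is in \<open>A\<close>. If it is y / x and x + y were a unit,
  then 1 / x = (1 + y / x) / (x + y) would be in \<open>A\<close>.\<close>

lemma nonunits_add:
  assumes "x \<in> A - units" "y \<in> A - units"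
  shows "x + y \<in> A - units"
proof -
  have *: "x + y \<notin> units" if "x \<in> A - units" "y \<in> A - units" "y / x \<in> A" for x y
  proof
    assume u: "x + y \<in> units"
    have "x \<noteq> 0"
      using that u by auto
    have "inverse x = inverse (x + y) * (1 + y / x)"
      using \<open>x \<noteq> 0\<close> units_nonzero[OF u] by (simp add: field_simps)
    also have "\<dots> \<in> A"
      using u that by (intro intros) (auto simp: units_def)
    finally show False
      using that \<open>x \<noteq> 0\<close> by (simp add: units_def)
  qed
  have "y / x \<in> A \<or> x / y \<in> A"
    using valuation_ring[of "y / x"] by auto
  then have "x + y \<notin> units"
    using *[of x y] *[of y x] assms by (auto simp: add.commute)
  then show ?thesis
    using assms by (auto intro: intros)
qed

lemma nonunits_sum:
  "(\<And>i. i \<in> I \<Longrightarrow> f i \<in> A - units) \<Longrightarrow> sum f I \<in> A - units"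
proof (induction I rule: infinite_finite_induct)
  case (insert i I)
  then show ?case
    using nonunits_add[of "f i" "sum f I"] by simp
qed (auto simp: units_def intro: intros)

lemma coprime_unit:
  assumes "\<not> p dvd n"
  shows "of_nat n \<in> units"
proof -
  have "coprime (int p) (int n)"
    using assms prime prime_imp_coprime[of p n] by simp
  then obtain x y where "x * int p + y * int n = 1"
    using bezout_int[of "int p" "int n"] by auto
  then have "(of_int (x * int p + y * int n) :: 'a) = of_int 1" by (rule arg_cong)
  then have eq: "of_int y * of_nat n = 1 - P * of_int x"
    by (simp add: algebra_simps)
  have ne: "1 - P * of_int x \<noteq> 0"
    by (intro one_minus_nonzero intros)
  have "inverse (of_nat n) = of_int y * inverse (1 - P * of_int x)"
    unfolding eq[symmetric] using ne eq by (auto simp: field_simps)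
  also have "\<dots> \<in> A"
    by (intro intros inverse_one_minus)
  finally have "inverse (of_nat n) \<in> A" .
  moreover have "(of_nat n :: 'a) \<noteq> 0" using assms by (cases "n = 0") auto
  ultimately show ?thesis
    unfolding units_def by (auto intro: intros)
qed

text \<open>A negative power of p in \<open>A\<close> would yield 1 / p. So p has infinite order
  modulo the units, which makes exponents with respect to p well defined.\<close>

lemma power_int_P_unitsD:
  assumes "P powi k \<in> units"
  shows "k = 0"
proof -
  have *: "n = 0" if "inverse P ^ n \<in> A" for n
  proof (rule ccontr)
    assume "n \<noteq> 0"
    then have "inverse P = P ^ (n - 1) * inverse P ^ n"
      by (cases n) (auto simp: field_simps)
    also have "\<dots> \<in> A" by (intro intros that)
    finally show False using inverse_p by simp
  qed
  have "inverse (P powi k) \<in> A" "P powi k \<in> A"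
    using assms by (auto simp: units_def)
  then show ?thesis
    using *[of "nat k"] *[of "nat (- k)"] by (cases "k \<ge> 0") (auto simp: power_int_def power_inverse)
qed

lemma of_int_unit:
  assumes "c \<noteq> 0"
  shows "\<exists>k :: int. of_int c / P powi k \<in> units"
proof -
  define n where "n = nat \<bar>c\<bar>"
  have n: "n \<noteq> 0" using assms by (simp add: n_def)
  obtain m where m: "n = p ^ multiplicity p n * m" "\<not> p dvd m"
    using n multiplicity_decompose'[of n p] not_prime_unit[of p] prime by blast
  have "c = int n \<or> c = - int n"
    by (auto simp: n_def)
  then have "of_int c = (of_nat n :: 'a) \<or> of_int c = - (of_nat n :: 'a)"
    by auto
  moreover have "of_nat n = P ^ multiplicity p n * of_nat m"
    using arg_cong[OF m(1), of "of_nat :: nat \<Rightarrow> 'a"] by simp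
  ultimately have "of_int c / P powi multiplicity p n \<in> {of_nat m, - of_nat m}"
    by auto
  moreover have "- x \<in> units" if "x \<in> units" for x
    using that by (auto simp: units_def intro: intros)
  ultimately show ?thesis
    using coprime_unit[OF m(2)] by (intro exI[of _ "int (multiplicity p n)"]) auto
qed

text \<open>
  \<open>exponent_rep x n k\<close> says that \<open>k / n\<close> is the valuation of \<open>x\<close>. Such \<open>n\<close>, \<open>k\<close> exist for algebraic
  \<open>x\<close>, since in an algebraic relation two different terms must have the same valuation.
\<close>

definition exponent_rep :: "'a \<Rightarrow> nat \<Rightarrow> int \<Rightarrow> bool" where
  "exponent_rep x n k \<longleftrightarrow> n > 0 \<and> x ^ n / P powi k \<in> units"

text \<open>Divisibility in a valuation ring is total, so some member of the family divides all the
  others: the one of least valuation.\<close>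

lemma ex_dominant:
  assumes "finite I" "I \<noteq> {}" "\<And>i. i \<in> I \<Longrightarrow> t i \<noteq> 0"
  shows "\<exists>i\<in>I. \<forall>j\<in>I. t j / t i \<in> A"
  using assms
proof (induction I rule: finite_ne_induct)
  case (singleton i)
  then show ?case by (auto intro: intros)
next
  case (insert i I)
  then obtain m where m: "m \<in> I" "\<And>j. j \<in> I \<Longrightarrow> t j / t m \<in> A" by auto
  show ?case
  proof (cases "t i / t m \<in> A")
    case True
    then show ?thesis using m by auto
  next
    case False
    then have mi: "t m / t i \<in> A"
      using valuation_ring[of "t i / t m"] by simp
    have "t j / t i \<in> A" if "j \<in> I" for j
    proof -
      have "t j / t i = (t j / t m) * (t m / t i)"
        using insert.prems m(1) by auto
      also have "\<dots> \<in> A" using m(2)[OF that] mi by (intro intros)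
      finally show ?thesis .
    qed
    then show ?thesis
      using insert.prems by (auto intro: intros)
  qed
qed

lemma exponent_rep_exists:
  assumes "algebraic x" "x \<noteq> 0"
  shows "\<exists>n k. exponent_rep x n k"
proof -
  obtain q where q: "q \<noteq> 0" "poly (map_poly of_int q) x = 0"
    using assms(1) by (rule algebraicE')
  define I where "I = {i. i \<le> degree q \<and> coeff q i \<noteq> 0}"
  define t where "t i = of_int (coeff q i) * x ^ i" for i
  have I: "finite I" "degree q \<in> I"
    using q(1) by (auto simp: I_def)
  have t0: "t i \<noteq> 0" if "i \<in> I" for i
    using that assms(2) by (simp add: t_def I_def)
  \<comment> \<open>After division by a dominant term the other quotients sum to -1. Sums of
    nonunits are nonunits, so one of these quotients is a unit, and two terms have the same
    valuation.\<close>
  obtain m where m: "m \<in> I" "\<And>j. j \<in> I \<Longrightarrow> t j / t m \<in> A"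
    using ex_dominant[of I t] I t0 by blast
  have "0 = (\<Sum>i\<le>degree q. t i)"
    using q(2) by (simp add: poly_altdef degree_map_poly coeff_map_poly t_def)
  also have "\<dots> = (\<Sum>i\<in>I. t i)"
    by (rule sum.mono_neutral_right) (auto simp: I_def t_def)
  also have "\<dots> = t m + (\<Sum>i\<in>I - {m}. t i)"
    using I(1) m(1) by (rule sum.remove)
  finally have "(\<Sum>i\<in>I - {m}. t i / t m) = - 1"
    using t0[OF m(1)] by (simp add: field_simps eq_neg_iff_add_eq_0 flip: sum_divide_distrib)
  moreover have "- 1 \<in> units"
    by (auto simp: units_def intro: intros)
  ultimately have "\<exists>j\<in>I - {m}. t j / t m \<in> units"
    using nonunits_sum[of "I - {m}" "\<lambda>i. t i / t m"] m(2) by auto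
  then obtain j where j: "j \<in> I" "j \<noteq> m" "t j / t m \<in> units" by auto
  \<comment> \<open>The nonzero integer coefficients are powers of p up to units, so a unit quotient
    of two terms determines x^(j - i) up to units.\<close>
  have main: "\<exists>n k. exponent_rep x n k"
    if ij: "i \<in> I" "j \<in> I" "i < j" "t j / t i \<in> units" for i j
  proof -
    obtain k l where kl: "of_int (coeff q i) / P powi k \<in> units" "of_int (coeff q j) / P powi l \<in> units"
      using of_int_unit[of "coeff q i"] of_int_unit[of "coeff q j"] ij by (auto simp: I_def)
    have "x ^ (j - i) / P powi (k - l) =
        (t j / t i) * ((of_int (coeff q i) / P powi k) / (of_int (coeff q j) / P powi l))"
      using ij assms(2) by (simp add: t_def I_def power_diff power_int_diff field_simps)
    also have "\<dots> \<in> units"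
      by (rule units_mult[OF ij(4) units_divide[OF kl]])
    finally have "exponent_rep x (j - i) (k - l)"
      using ij by (simp add: exponent_rep_def)
    then show ?thesis by blast
  qed
  show ?thesis
  proof (cases "m < j")
    case True
    then show ?thesis using main[of m j] m j by simp
  next
    case False
    then show ?thesis using main[of j m] m j units_inverse[OF j(3)] by simp
  qed
qed

lemma exponent_rep_unique:
  assumes "exponent_rep x n k" "exponent_rep x m l"
  shows "k * int m = l * int n"
proof -
  have x: "x \<noteq> 0"
    using assms by (auto simp: exponent_rep_def units_def)
  have "x ^ n / P powi k \<in> units" "x ^ m / P powi l \<in> units"
    using assms by (auto simp: exponent_rep_def)
  then have "(x ^ n / P powi k) ^ m / (x ^ m / P powi l) ^ n \<in> units"
    by (rule units_divide[OF units_power units_power])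
  also have "(x ^ n / P powi k) ^ m / (x ^ m / P powi l) ^ n = P powi (l * int n - k * int m)"
    using x by (simp add: power_divide power_int_diff power_int_mult mult.commute[of n m]
        flip: power_mult)
  finally show ?thesis
    using power_int_P_unitsD by force
qed

lemma exponent_rep_mult:
  assumes "exponent_rep x n k" "exponent_rep y m l"
  shows "exponent_rep (x * y) (n * m) (k * int m + l * int n)"
proof -
  have "(x ^ n / P powi k) ^ m * (y ^ m / P powi l) ^ n \<in> units"
    using assms by (intro units_mult units_power) (auto simp: exponent_rep_def)
  also have "(x ^ n / P powi k) ^ m * (y ^ m / P powi l) ^ n =
      (x * y) ^ (n * m) / P powi (k * int m + l * int n)"
    by (simp add: power_divide power_int_add power_int_mult power_mult_distrib mult.commute[of m n]
        flip: power_mult)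
  finally show ?thesis
    using assms by (simp add: exponent_rep_def)
qed

text \<open>For k \<ge> 0 and x outside \<open>A\<close>, the inverse is in \<open>A\<close>, and x
  = (x^n / p^k) * p^k * (1 / x)^(n - 1) would be a product of elements of \<open>A\<close>. For k <
  0 and x in \<open>A\<close>, 1 / p would be such a product.\<close>

lemma exponent_rep_mem_iff:
  assumes "exponent_rep x n k"
  shows "x \<in> A \<longleftrightarrow> k \<ge> 0"
proof
  have n: "n > 0" and u: "x ^ n / P powi k \<in> units"
    using assms by (auto simp: exponent_rep_def)
  have x: "x \<noteq> 0"
    using u n by (auto simp: units_def)
  show "k \<ge> 0" if "x \<in> A"
  proof (rule ccontr)
    assume "\<not> k \<ge> 0"
    define j where "j = nat (- k) - 1"
    have k: "P powi k = inverse P ^ Suc j"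
      using \<open>\<not> k \<ge> 0\<close> by (simp add: j_def power_int_def power_inverse Suc_diff_Suc)
    have "inverse P = x ^ n * P ^ j * inverse (x ^ n / P powi k)"
      unfolding k using x by (simp add: field_simps)
    also have "\<dots> \<in> A"
      using u that by (intro intros) (auto simp: units_def)
    finally show False using inverse_p by simp
  qed
  show "x \<in> A" if "k \<ge> 0"
  proof (rule ccontr)
    assume "x \<notin> A"
    then have inv: "inverse x \<in> A" by (rule valuation_ring)
    have "x = (x ^ n / P powi k) * P ^ nat k * inverse x ^ (n - 1)"
      using that n x by (cases n) (auto simp: power_int_def field_simps)
    also have "\<dots> \<in> A"
      by (intro subring_set_mult[OF subring] subring_set_power[OF subring]
          subring_set_of_nat[OF subring] units_in_A[OF u] inv)
    finally show False using \<open>x \<notin> A\<close> by simp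
  qed
qed

end

text \<open>A nonzero x of exponent k / n gets the value 2 to the power -k / n; the base is a
  normalization. The value is at most 1 exactly on \<open>A\<close>, so the ultrametric inequality
  reduces to closure of \<open>A\<close> under adding 1.\<close>

lemma padic_absolute_value_exists:
  assumes "prime p" and alg: "\<And>x :: 'a :: field_char_0. algebraic x"
  obtains v :: "'a :: field_char_0 \<Rightarrow> real" where "absolute_value v" "nonarchimedean v" "v (of_nat p) < 1"
proof -
  obtain A :: "'a set" where "maximal_subring A p"
    using maximal_subring_exists[OF assms(1)] by blast
  then interpret maximal_subring A p .
  have "\<exists>n k. x \<noteq> 0 \<longrightarrow> exponent_rep x n k" for x
    using exponent_rep_exists[OF alg] by blast
  then obtain N K where NK: "\<And>x. x \<noteq> 0 \<Longrightarrow> exponent_rep x (N x) (K x)"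
    by metis
  define v :: "'a \<Rightarrow> real" where
    "v x = (if x = 0 then 0 else 2 powr (- of_int (K x) / of_nat (N x)))" for x
  have eq: "v x = 2 powr (- of_int k / of_nat n)" if "exponent_rep x n k" for x n k
  proof -
    have x: "x \<noteq> 0" using that by (auto simp: exponent_rep_def units_def)
    have "real_of_int (K x * int n) = real_of_int (k * int (N x))"
      using exponent_rep_unique[OF NK[OF x] that] by simp
    moreover have "n > 0" "N x > 0"
      using that NK[OF x] by (auto simp: exponent_rep_def)
    ultimately have "real_of_int (K x) / N x = k / n"
      by (simp add: field_simps)
    then show ?thesis using x by (simp add: v_def)
  qed
  have mult: "v (x * y) = v x * v y" for x y
  proof (cases "x = 0 \<or> y = 0")
    case False
    then have x: "exponent_rep x (N x) (K x)" and y: "exponent_rep y (N y) (K y)"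
      using NK by auto
    then have "N x > 0" "N y > 0" by (auto simp: exponent_rep_def)
    then show ?thesis
      unfolding eq[OF x] eq[OF y] eq[OF exponent_rep_mult[OF x y]]
      by (simp add: field_simps flip: powr_add)
  qed (auto simp: v_def)
  have le_1: "v x \<le> 1 \<longleftrightarrow> x \<in> A" for x
  proof (cases "x = 0")
    case False
    have N: "N x > 0" using NK[OF False] by (auto simp: exponent_rep_def)
    have "v x \<le> 1 \<longleftrightarrow> (2 :: real) powr (- of_int (K x) / of_nat (N x)) \<le> 2 powr 0"
      using False by (simp add: v_def)
    also have "\<dots> \<longleftrightarrow> K x \<ge> 0"
      using N by (subst powr_le_cancel_iff) (auto simp: divide_le_0_iff zero_le_divide_iff)
    finally show ?thesis
      using exponent_rep_mem_iff[OF NK[OF False]] by simp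
  qed (auto simp: v_def intro: intros)
  have zero: "v x = 0 \<longleftrightarrow> x = 0" and nn: "v x \<ge> 0" for x
    by (auto simp: v_def)
  have *: "v (x + y) \<le> v x" if "v y \<le> v x" for x y
  proof (cases "x = 0")
    case False
    then have vx: "v x > 0" using zero[of x] nn[of x] by linarith
    have "v x * v (y / x) = v y"
      using False by (simp flip: mult)
    then have "v (y / x) \<le> 1"
      using that vx by (metis less_eq_real_def mult.right_neutral mult_le_cancel_left_pos)
    then have "1 + y / x \<in> A"
      by (auto simp: le_1 intro: intros)
    then have "v (1 + y / x) \<le> 1" by (simp add: le_1)
    then have "v x * v (1 + y / x) \<le> v x * 1"
      using nn by (intro mult_left_mono)
    then show ?thesis
      using False by (simp add: algebra_simps flip: mult)
  qed (use that nn[of y] zero in auto)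
  have nonarch: "v (x + y) \<le> max (v x) (v y)" for x y
    using *[of x y] *[of y x] by (cases "v y \<le> v x") (auto simp: add.commute)
  have "v (x + y) \<le> v x + v y" for x y
    using nonarch[of x y] nn[of x] nn[of y] by linarith
  then have "absolute_value v"
    unfolding absolute_value_def using zero nn mult by blast
  moreover have "nonarchimedean v"
    using nonarch by (simp add: nonarchimedean_def)
  moreover have "exponent_rep P 1 1"
    by (auto simp: exponent_rep_def units_def intro: intros)
  then have "v P < 1"
    by (simp add: eq powr_minus)
  ultimately show thesis by (rule that)
qed

section \<open>Finite extensions of the rationals\<close>

interpretation rat_vs: vector_space "\<lambda>(q :: rat) (x :: 'a :: field_char_0). of_rat q * x"
  by (rule vector_space_rat)

lemma to_ac_of_rat: "to_ac (of_rat q :: 'k :: field_char_0) = of_rat q"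
proof -
  obtain a b where q: "q = Rat.Fract a b" "b > 0" by (cases q) auto
  then show ?thesis by (simp add: of_rat_rat)
qed

text \<open>More than \<open>card S\<close> powers are dependent. Dependence concerns the set of
  powers, so coinciding powers are treated apart; they give an equation at once.\<close>

lemma algebraic_if_powers_in_span:
  fixes x :: "'a :: field_char_0"
  assumes "finite S" "\<And>i. x ^ i \<in> rat_vs.span S"
  shows "algebraic x"
proof -
  let ?I = "{..card S}"
  show ?thesis
  proof (cases "inj_on (\<lambda>i. x ^ i) ?I")
    case False
    then obtain i j where ij: "i \<noteq> j" "x ^ i = x ^ j"
      by (auto simp: inj_on_def)
    show ?thesis
    proof (rule algebraicI')
      show "monom 1 i - monom 1 j \<noteq> (0 :: 'a poly)"
        using ij(1) by (metis monom_eq_iff' right_minus_eq zero_neq_one)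
      show "poly (monom 1 i - monom 1 j) x = 0"
        using ij(2) by (simp add: poly_monom)
      show "coeff (monom 1 i - monom 1 j) k \<in> (\<rat> :: 'a set)" for k
        by auto
    qed
  next
    case True
    let ?T = "(\<lambda>i. x ^ i) ` ?I"
    have "card ?T = Suc (card S)"
      using True by (simp add: card_image)
    then have "rat_vs.dependent ?T"
      using rat_vs.independent_span_bound[OF assms(1), of ?T] assms(2) by auto
    then obtain c where c: "(\<Sum>y\<in>?T. of_rat (c y) * y) = 0" "\<exists>y\<in>?T. c y \<noteq> 0"
      by (auto simp: rat_vs.dependent_finite)
    from c(2) obtain m where m: "m \<le> card S" "c (x ^ m) \<noteq> 0" by auto
    define p where "p = (\<Sum>i\<in>?I. monom (of_rat (c (x ^ i)) :: 'a) i)"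
    have coeff_p: "coeff p i = (if i \<le> card S then of_rat (c (x ^ i)) else 0)" for i
      by (auto simp: p_def coeff_sum)
    show ?thesis
    proof (rule algebraicI')
      show "p \<noteq> 0" using m coeff_p[of m] by auto
      show "coeff p i \<in> \<rat>" for i by (simp add: coeff_p)
      show "poly p x = 0"
        using c(1) True by (simp add: p_def poly_sum poly_monom sum.reindex)
    qed
  qed
qed

text \<open>Cancelling factors x from an algebraic relation leaves a + x * q(x) = 0 with a nonzero,
  so the inverse is -q(x) / a.\<close>

lemma inverse_in_subspace:
  fixes x :: "'a :: field_char_0"
  assumes L: "\<And>i. x ^ i \<in> rat_vs.span S" and "x \<noteq> 0" "algebraic x"
  shows "inverse x \<in> rat_vs.span S"
proof -
  have mem: "poly q x \<in> rat_vs.span S" if "\<forall>i. coeff q i \<in> \<rat>" for q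
    unfolding poly_altdef
  proof (rule rat_vs.span_sum)
    fix i
    from that have "coeff q i \<in> \<rat>" by blast
    then obtain r where "coeff q i = of_rat r" by (rule Rats_cases)
    then show "coeff q i * x ^ i \<in> rat_vs.span S"
      using rat_vs.span_scale[OF L] by simp
  qed
  obtain p where p: "\<forall>i. coeff p i \<in> \<rat>" "p \<noteq> 0" "poly p x = 0"
    using assms(3) unfolding algebraic_altdef by blast
  from p show ?thesis
  proof (induction p)
    case (pCons a q)
    have q: "\<forall>i. coeff q i \<in> \<rat>" and a: "a \<in> \<rat>"
      using pCons.prems(1) by (metis coeff_pCons_Suc, metis coeff_pCons_0)
    show ?case
    proof (cases "a = 0")
      case True
      then show ?thesis
        using pCons q \<open>x \<noteq> 0\<close> by auto
    next
      case False
      obtain r where r: "a = of_rat r" using a by (elim Rats_cases)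
      have "x * poly q x = - of_rat r"
        using pCons.prems(3) by (simp add: r add_eq_0_iff)
      then have "x * (of_rat (- inverse r) * poly q x) = of_rat (- inverse r) * (- of_rat r)"
        by (metis mult.left_commute)
      also have "\<dots> = 1"
        using False r by (simp add: of_rat_minus of_rat_inverse)
      finally have "inverse x = of_rat (- inverse r) * poly q x"
        by (rule inverse_unique)
      then show ?thesis
        using rat_vs.span_scale[OF mem[OF q]] by metis
    qed
  qed simp
qed

text \<open>\<open>L\<close> is the field K(\<alpha>), with K embedded by \<open>to_ac\<close>. It
  is presented as a finite rational span because residue classes are counted for such spans.\<close>

lemma finite_extension:
  fixes \<alpha> :: "'k :: field_char_0 alg_closure"
  assumes "number_field TYPE('k)"
  obtains S L where "finite S" "L = rat_vs.span S" "range to_ac \<subseteq> L" "\<alpha> \<in> L"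
    "\<And>x y. x \<in> L \<Longrightarrow> y \<in> L \<Longrightarrow> x * y \<in> L" "\<And>x. x \<in> L \<Longrightarrow> inverse x \<in> L" "\<And>x. x \<in> L \<Longrightarrow> algebraic x"
proof -
  obtain B where B: "finite_dimensional_vector_space (\<lambda>(q :: rat) (x :: 'k). of_rat q * x) B"
    using assms by (auto simp: number_field_def)
  interpret K: finite_dimensional_vector_space "\<lambda>(q :: rat) (x :: 'k). of_rat q * x" B
    by (rule B)
  obtain f where f: "f \<noteq> 0" "poly (map_poly to_ac f) \<alpha> = 0"
    by (rule alg_closure_algebraic)
  define n where "n = degree f"
  have n: "n > 0"
  proof (rule ccontr)
    assume "\<not> n > 0"
    then obtain c where "f = [:c:]" unfolding n_def by (auto elim: degree_eq_zeroE)
    with f show False by (auto simp: map_poly_pCons)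
  qed
  define S where "S = (\<lambda>(b, i). to_ac b * \<alpha> ^ i) ` (B \<times> {..<n})"
  define L where "L = rat_vs.span S"
  have fin: "finite S" by (simp add: S_def K.finite_Basis)
  have sub: "rat_vs.subspace L" by (simp add: L_def)
  have low: "to_ac c * \<alpha> ^ i \<in> L" if "i < n" for c i
  proof -
    have "c \<in> rat_vs.span B" using K.span_Basis by simp
    then show ?thesis
    proof (induction rule: rat_vs.span_induct_alt)
      case base
      then show ?case by (simp add: L_def rat_vs.span_zero)
    next
      case (step q b y)
      have "to_ac b * \<alpha> ^ i \<in> S" using step that by (auto simp: S_def)
      then have "of_rat q * (to_ac b * \<alpha> ^ i) + to_ac y * \<alpha> ^ i \<in> L"
        using step.IH unfolding L_def
        by (rule rat_vs.span_add[OF rat_vs.span_scale[OF rat_vs.span_base]])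
      then show ?case by (simp add: to_ac_of_rat algebra_simps)
    qed
  qed
  \<comment> \<open>The equation of \<alpha>, divided by its leading coefficient in K, brings the
    n-th power back into the span.\<close>
  have top: "to_ac c * \<alpha> ^ n \<in> L" for c
  proof -
    have "0 = (\<Sum>i\<le>n. to_ac (coeff f i) * \<alpha> ^ i)"
      using f(2) by (simp add: poly_altdef degree_map_poly coeff_map_poly n_def)
    then have "to_ac (lead_coeff f) * \<alpha> ^ n = - (\<Sum>i<n. to_ac (coeff f i) * \<alpha> ^ i)"
      by (simp add: n_def add_eq_0_iff flip: lessThan_Suc_atMost)
    moreover define e where "e = c / lead_coeff f"
    then have "c = lead_coeff f * e"
      using f(1) by simp
    then have "to_ac c * \<alpha> ^ n = (to_ac (lead_coeff f) * \<alpha> ^ n) * to_ac e"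
      by (simp only: to_ac_mult mult_ac)
    ultimately have "to_ac c * \<alpha> ^ n = - (\<Sum>i<n. to_ac (coeff f i) * \<alpha> ^ i) * to_ac e"
      by simp
    also have "\<dots> = - (\<Sum>i<n. to_ac (coeff f i * e) * \<alpha> ^ i)"
      by (simp add: sum_distrib_right mult.assoc mult.commute[of "to_ac e"])
    also have "\<dots> \<in> L"
      unfolding L_def by (intro rat_vs.span_neg rat_vs.span_sum) (use low in \<open>simp add: L_def del: to_ac_mult\<close>)
    finally show ?thesis .
  qed
  \<comment> \<open>An induction rule for \<open>L\<close> as sums of monomials with coefficients in
    K, so that closure under products is checked on monomials.\<close>
  have Lind: "P y" if y: "y \<in> L" and "P 0" "\<And>c i z. i < n \<Longrightarrow> P z \<Longrightarrow> P (to_ac c * \<alpha> ^ i + z)" for y P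
    using y unfolding L_def
  proof (induction rule: rat_vs.span_induct_alt)
    case base
    show ?case by fact
  next
    case (step q s y)
    then obtain b i where "s = to_ac b * \<alpha> ^ i" "i < n" by (auto simp: S_def)
    then show ?case
      using that(3)[of i y "of_rat q * b"] step.IH by (simp add: to_ac_of_rat mult.assoc)
  qed
  have add: "x + y \<in> L" if "x \<in> L" "y \<in> L" for x y
    using that unfolding L_def by (rule rat_vs.span_add)
  have zero: "0 \<in> L" unfolding L_def by (rule rat_vs.span_zero)
  have const: "to_ac c * y \<in> L" if "y \<in> L" for c y
    using that
  proof (rule Lind)
    fix d i z assume "i < n" "to_ac c * z \<in> L"
    then show "to_ac c * (to_ac d * \<alpha> ^ i + z) \<in> L"
      using add[OF low[of i "c * d"]] by (simp add: algebra_simps)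
  qed (simp add: zero)
  have alpha: "\<alpha> * y \<in> L" if "y \<in> L" for y
    using that
  proof (rule Lind)
    fix d i z assume "i < n" "\<alpha> * z \<in> L"
    moreover have "to_ac d * \<alpha> ^ Suc i \<in> L"
      using \<open>i < n\<close> low[of "Suc i" d] top[of d] by (cases "Suc i = n") auto
    ultimately have "to_ac d * \<alpha> ^ Suc i + \<alpha> * z \<in> L" by (intro add)
    then show "\<alpha> * (to_ac d * \<alpha> ^ i + z) \<in> L"
      by (simp add: algebra_simps)
  qed (simp add: zero)
  have alpha_power: "\<alpha> ^ i * y \<in> L" if "y \<in> L" for i y
    using that by (induction i) (auto simp: mult.assoc intro: alpha)
  have mult: "x * y \<in> L" if "x \<in> L" "y \<in> L" for x y
    using that(1)
  proof (rule Lind)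
    fix d i z assume "i < n" "z * y \<in> L"
    then show "(to_ac d * \<alpha> ^ i + z) * y \<in> L"
      using add[OF const[OF alpha_power[OF that(2)], of d i]] by (simp add: algebra_simps)
  qed (simp add: zero)
  have const_mem: "to_ac c \<in> L" for c
    using low[of 0 c] n by simp
  have power: "x ^ i \<in> L" if "x \<in> L" for x i
    using const_mem[of 1] by (induction i) (auto intro: mult that)
  have alg: "algebraic x" if "x \<in> L" for x
    using algebraic_if_powers_in_span[OF fin] power[OF that] by (simp add: L_def)
  show thesis
  proof (rule that[OF fin L_def])
    show "inverse x \<in> L" if "x \<in> L" for x
      using inverse_in_subspace[of x S] power[OF that] alg[OF that] that
      by (cases "x = 0") (auto simp: L_def)
    show "\<alpha> \<in> L" using alpha[OF const_mem[of 1]] by simp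
  qed (use const_mem mult alg in auto)
qed

lemma alg_closure_algebraic_rat:
  fixes x :: "'k :: field_char_0 alg_closure"
  assumes "number_field TYPE('k)"
  shows "algebraic x"
  by (rule finite_extension[OF assms, of x]) auto

subsection \<open>Finiteness of residue classes\<close>

lemma (in nonarch_absval) residue_class_eq_iff:
  "residue_class v x = residue_class v y \<longleftrightarrow> v (x - y) < 1"
proof
  assume "residue_class v x = residue_class v y"
  moreover have "x \<in> residue_class v x" by (simp add: residue_class_def)
  ultimately show "v (x - y) < 1" by (simp add: residue_class_def)
next
  assume "v (x - y) < 1"
  then have "v (z - x) < 1 \<longleftrightarrow> v (z - y) < 1" for z
    using add_less[of "z - x" 1 "x - y"] diff_less[of "z - y" 1 "x - y"] by auto
  then show "residue_class v x = residue_class v y"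
    by (simp add: residue_class_def)
qed

text \<open>Denominators are cleared by their product \<open>D\<close>, then the gcd is divided out.
  If p divided all quotients, p times the gcd would still be a common divisor.\<close>

lemma primitive_multiple:
  fixes q :: "'b \<Rightarrow> rat"
  assumes "finite T" "\<exists>t\<in>T. q t \<noteq> 0" "prime (p :: nat)"
  shows "\<exists>(r :: rat) (b :: 'b \<Rightarrow> int). (\<forall>t\<in>T. of_int (b t) = r * q t) \<and> (\<exists>t\<in>T. \<not> int p dvd b t)"
proof -
  define den where "den t = snd (quotient_of (q t))" for t
  have den: "den t > 0" for t
    by (simp add: den_def quotient_of_denom_pos')
  define D where "D = (\<Prod>t\<in>T. den t)"
  have D: "D \<noteq> 0" using den by (auto simp: D_def assms(1)) (metis less_irrefl)
  have "\<exists>a. of_int a = of_int D * q t" if "t \<in> T" for t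
  proof -
    obtain n where n: "q t = of_int n / of_int (den t)"
      using quotient_of_div[of "q t"] by (cases "quotient_of (q t)") (auto simp: den_def)
    have "D = den t * (\<Prod>s\<in>T - {t}. den s)"
      unfolding D_def using assms(1) that by (rule prod.remove)
    then have "of_int D * q t = of_int (n * (\<Prod>s\<in>T - {t}. den s))"
      using den[of t] by (simp add: n)
    then show ?thesis by metis
  qed
  then obtain a where a: "\<And>t. t \<in> T \<Longrightarrow> of_int (a t) = of_int D * q t"
    by metis
  define g where "g = Gcd (a ` T)"
  have g: "g \<noteq> 0"
  proof
    assume "g = 0"
    then have "a t = 0" if "t \<in> T" for t using that by (auto simp: g_def)
    then show False using assms(2) a D by fastforce
  qed
  have dvd: "g dvd a t" if "t \<in> T" for t
    using that by (simp add: g_def)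
  show ?thesis
  proof (intro exI conjI ballI)
    show "of_int (a t div g) = of_int D / of_int g * q t" if "t \<in> T" for t
      using a[OF that] dvd[OF that] g by (auto simp: field_simps elim!: dvdE)
    show "\<exists>t\<in>T. \<not> int p dvd a t div g"
    proof (rule ccontr)
      assume "\<not> ?thesis"
      then have "int p * g dvd a t" if "t \<in> T" for t
        using that dvd[OF that] mult_dvd_mono[of "int p" "a t div g" g g] by auto
      then have "int p * g dvd Gcd (a ` T)"
        by (intro Gcd_greatest) auto
      then have "int p * g dvd 1 * g"
        by (simp add: g_def)
      then have "int p dvd 1"
        using g dvd_times_right_cancel_iff[of g "int p" 1] by simp
      then show False using assms(3) by simp
    qed
  qed
qed

lemma (in nonarch_absval) sum_less_bound:
  "(\<And>i. i \<in> I \<Longrightarrow> v (f i) < B) \<Longrightarrow> 0 < B \<Longrightarrow> v (sum f I) < B"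
  by (induction I rule: infinite_finite_induct) (auto intro: add_less)

lemma (in nonarch_absval) of_int_less_1: "v (of_nat p) < 1 \<Longrightarrow> int p dvd c \<Longrightarrow> v (of_int c) < 1"
  using mult_less_1[of "of_nat p"] of_int_le_1 by (auto elim!: dvdE)

text \<open>A family independent over the field with p elements modulo the maximal ideal is
  independent over the rationals, because a rational relation can be made primitive. So its size is
  bounded by \<open>card S\<close>, and the combinations of a maximal family with coefficients
  modulo p represent all residue classes.\<close>

lemma finite_residue_classes:
  fixes v :: "'a :: field_char_0 \<Rightarrow> real"
  assumes "absolute_value v" "nonarchimedean v" "prime p" "v (of_nat p) < 1" "finite S"
  shows "finite (residue_class v ` {x \<in> rat_vs.span S. v x \<le> 1})"
proof -
  interpret nonarch_absval v by unfold_locales fact+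
  define O' where "O' = {x \<in> rat_vs.span S. v x \<le> 1}"
  define good where "good T \<longleftrightarrow> finite T \<and> T \<subseteq> O' \<and>
    (\<forall>c :: 'a \<Rightarrow> int. v (\<Sum>t\<in>T. of_int (c t) * t) < 1 \<longrightarrow> (\<forall>t\<in>T. int p dvd c t))" for T
  have card: "card T \<le> card S" if T: "good T" for T
  proof -
    have fin: "finite T" using T by (simp add: good_def)
    have "rat_vs.independent T"
    proof
      assume "rat_vs.dependent T"
      then obtain q where q: "(\<Sum>t\<in>T. of_rat (q t) * t) = 0" "\<exists>t\<in>T. q t \<noteq> 0"
        using fin by (auto simp: rat_vs.dependent_finite)
      obtain r b where b: "\<forall>t\<in>T. of_int (b t) = r * q t" "\<exists>t\<in>T. \<not> int p dvd b t"
        using primitive_multiple[OF fin q(2) assms(3)] by blast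
      have eq: "(of_int (b t) :: 'a) = of_rat r * of_rat (q t)" if "t \<in> T" for t
        using arg_cong[OF bspec[OF b(1) that], of "of_rat :: rat \<Rightarrow> 'a"] by (simp add: of_rat_mult)
      have "(\<Sum>t\<in>T. of_int (b t) * t) = of_rat r * (\<Sum>t\<in>T. of_rat (q t) * t)"
        by (simp add: eq sum_distrib_left mult.assoc)
      with q(1) have "v (\<Sum>t\<in>T. of_int (b t) * t) < 1" by simp
      with T b(2) show False unfolding good_def by blast
    qed
    moreover have "T \<subseteq> rat_vs.span S" using T by (auto simp: good_def O'_def)
    ultimately show ?thesis
      using rat_vs.independent_span_bound[OF assms(5)] by blast
  qed
  have "good {}" by (simp add: good_def)
  then have "\<exists>T. good T \<and> (\<forall>U. good U \<longrightarrow> card U \<le> card T)"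
    using card by (intro ex_has_greatest_nat[where b = "Suc (card S)"]) (auto simp: less_Suc_eq_le)
  then obtain T where T: "good T" "\<And>U. good U \<Longrightarrow> card U \<le> card T"
    by auto
  have fin: "finite T" and TO: "T \<subseteq> O'" using T(1) by (auto simp: good_def)
  have vT: "v t \<le> 1" if "t \<in> T" for t using that TO by (auto simp: O'_def)
  have rep: "\<exists>c :: 'a \<Rightarrow> int. v (x - (\<Sum>t\<in>T. of_int (c t) * t)) < 1" if x: "x \<in> O'" for x
  proof (cases "x \<in> T")
    case True
    have "(\<Sum>t\<in>T. of_int (if t = x then 1 else 0) * t) = x"
      using fin True by (subst sum.remove[of _ x]) auto
    then show ?thesis
      by (intro exI[of _ "\<lambda>t. if t = x then 1 else 0"]) simp
  next
    case False
    then have "\<not> good (insert x T)"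
      using T(2)[of "insert x T"] fin by auto
    then obtain c :: "'a \<Rightarrow> int" where c: "v (\<Sum>t\<in>insert x T. of_int (c t) * t) < 1"
        "\<exists>t\<in>insert x T. \<not> int p dvd c t"
      using fin TO x unfolding good_def by blast
    define s where "s = (\<Sum>t\<in>T. of_int (c t) * t)"
    have vs: "v (of_int (c x) * x + s) < 1"
      using c(1) False fin by (simp add: s_def)
    have "\<not> int p dvd c x"
    proof
      assume d: "int p dvd c x"
      then have "v (of_int (c x) * x) < 1"
        using x assms(4) by (intro mult_less_1 of_int_less_1) (auto simp: O'_def)
      then have "v s < 1"
        using diff_less[OF vs] by force
      then have "\<forall>t\<in>T. int p dvd c t"
        using T(1) unfolding good_def s_def by blast
      with c(2) d show False by auto
    qed
    then have "coprime (int p) (c x)"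
      using assms(3) by (intro prime_imp_coprime) auto
    \<comment> \<open>d inverts the coefficient of x modulo p; multiplying the relation by d solves
      it for x up to an element of the maximal ideal.\<close>
    then obtain y d where yd: "y * int p + d * c x = 1"
      using bezout_int[of "int p" "c x"] by auto
    have 1: "(1 :: 'a) = of_int y * of_nat p + of_int d * of_int (c x)"
      using arg_cong[OF yd, of "of_int :: int \<Rightarrow> 'a"] by simp
    have "x - (\<Sum>t\<in>T. of_int (- d * c t) * t) = 1 * x + of_int d * s"
      by (simp add: s_def sum_distrib_left mult.assoc sum_negf)
    also have "\<dots> = of_int d * (of_int (c x) * x + s) + of_nat p * (of_int y * x)"
      unfolding 1 by (simp add: algebra_simps)
    also have "v \<dots> < 1"
      using x vs assms(4) by (intro add_less) (auto simp: O'_def mult_less_1 mult_le_1 of_int_le_1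
          mult.commute[of "of_int d"])
    finally show ?thesis by (intro exI[of _ "\<lambda>t. - d * c t"])
  qed
  define F where "F = (T \<rightarrow>\<^sub>E {0..<int p})"
  have "residue_class v ` O' \<subseteq> (\<lambda>c. residue_class v (\<Sum>t\<in>T. of_int (c t) * t)) ` F"
  proof
    fix C assume "C \<in> residue_class v ` O'"
    then obtain x where x: "x \<in> O'" "C = residue_class v x" by auto
    obtain c :: "'a \<Rightarrow> int" where c: "v (x - (\<Sum>t\<in>T. of_int (c t) * t)) < 1"
      using rep[OF x(1)] by blast
    define e where "e = restrict (\<lambda>t. c t mod int p) T"
    have "e \<in> F"
      using assms(3) by (auto simp: F_def e_def prime_gt_0_nat)
    have "v (\<Sum>t\<in>T. of_int (c t - e t) * t) < 1"
      using vT assms(4) by (intro sum_less_bound mult_less_1 of_int_less_1)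
        (auto simp: e_def simp del: of_int_diff)
    then have "v ((x - (\<Sum>t\<in>T. of_int (c t) * t)) + (\<Sum>t\<in>T. of_int (c t - e t) * t)) < 1"
      by (intro add_less c)
    then have "v (x - (\<Sum>t\<in>T. of_int (e t) * t)) < 1"
      by (simp add: left_diff_distrib sum_subtractf)
    then have "C = residue_class v (\<Sum>t\<in>T. of_int (e t) * t)"
      by (simp add: x residue_class_eq_iff)
    with \<open>e \<in> F\<close> show "C \<in> (\<lambda>c. residue_class v (\<Sum>t\<in>T. of_int (c t) * t)) ` F"
      by blast
  qed
  moreover have "finite F"
    using fin by (auto simp: F_def intro: finite_PiE)
  ultimately show ?thesis
    unfolding O'_def by (meson finite_imageI finite_subset)
qed

section \<open>Binary forms\<close>

lemma form_eval_homogeneous: "form_eval d f (c * x) (c * y) = c ^ d * form_eval d f x y"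
proof -
  have "coeff f i * (c * x) ^ i * (c * y) ^ (d - i) = c ^ d * (coeff f i * x ^ i * y ^ (d - i))"
    if "i \<le> d" for i
  proof -
    have "c ^ d = c ^ i * c ^ (d - i)"
      using that by (simp flip: power_add)
    then show ?thesis by (simp add: power_mult_distrib mult_ac)
  qed
  then show ?thesis
    unfolding form_eval_def sum_distrib_left by (intro sum.cong) auto
qed

lemma form_eval_smult: "form_eval d (smult c f) x y = c * form_eval d f x y"
  by (simp add: form_eval_def sum_distrib_left mult.assoc)

lemma form_eval_diff: "form_eval d (f - g) x y = form_eval d f x y - form_eval d g x y"
  by (simp add: form_eval_def sum_subtractf left_diff_distrib)

lemma form_eval_sum: "form_eval d (\<Sum>i\<in>I. f i) x y = (\<Sum>i\<in>I. form_eval d (f i) x y)"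
  unfolding form_eval_def coeff_sum sum_distrib_right by (rule sum.swap)

lemma poly_eq_sum_le:
  fixes f :: "'a :: comm_semiring_1 poly"
  assumes "degree f \<le> d"
  shows "poly f x = (\<Sum>i\<le>d. coeff f i * x ^ i)"
  unfolding poly_altdef using assms by (intro sum.mono_neutral_left) (auto simp: coeff_eq_0)

lemma form_eval_affine:
  assumes "degree f \<le> d"
  shows "form_eval d f x 1 = poly f x"
  using assms by (simp add: form_eval_def poly_eq_sum_le)

lemma form_eval_nonzero:
  assumes "degree f \<le> d" "y \<noteq> 0"
  shows "form_eval d f x y = y ^ d * poly f (x / y)"
  using form_eval_homogeneous[of d f y "x / y" 1] assms by (simp add: form_eval_affine)

lemma form_eval_infinity: "form_eval d f x 0 = coeff f d * x ^ d"
  unfolding form_eval_def by (subst sum.remove[of _ d]) (auto intro!: sum.neutral)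

lemma coeff_mult_le_degrees:
  assumes "degree f \<le> m" "degree g \<le> n"
  shows "coeff (f * g) (m + n) = coeff f m * coeff g n"
proof (cases "degree f = m \<and> degree g = n")
  case True
  then show ?thesis using coeff_mult_degree_sum by blast
next
  case False
  then have "degree (f * g) < m + n"
    using degree_mult_le[of f g] assms by linarith
  moreover have "coeff f m = 0 \<or> coeff g n = 0"
    using False assms by (auto simp: coeff_eq_0)
  ultimately show ?thesis by (auto simp: coeff_eq_0)
qed

lemma form_eval_mult:
  assumes "degree f \<le> m" "degree g \<le> n"
  shows "form_eval (m + n) (f * g) x y = form_eval m f x y * form_eval n g x y"
proof (cases "y = 0")
  case True
  then show ?thesis
    using assms by (simp add: form_eval_infinity coeff_mult_le_degrees power_add)
next
  case False
  have "degree (f * g) \<le> m + n"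
    using degree_mult_le[of f g] assms by linarith
  then show ?thesis
    using False assms by (simp add: form_eval_nonzero power_add)
qed

lemma form_eval_power:
  assumes "degree f \<le> m"
  shows "degree (f ^ n) \<le> m * n" "form_eval (m * n) (f ^ n) x y = form_eval m f x y ^ n"
proof -
  show deg: "degree (f ^ n) \<le> m * n" for n
    using degree_power_le[of f n] assms by (metis mult_le_mono1 order.trans)
  show "form_eval (m * n) (f ^ n) x y = form_eval m f x y ^ n"
  proof (induction n)
    case 0
    then show ?case by (simp add: form_eval_def)
  next
    case (Suc n)
    then show ?case
      using form_eval_mult[OF assms deg[of n]] by simp
  qed
qed

text \<open>This is the binary form of degree e of f evaluated at (p, q). With p, q encoding forms
  it composes morphisms; with p, q linear in a parameter it restricts a form to a line.\<close>

definition form_comp :: "nat \<Rightarrow> 'a :: field poly \<Rightarrow> 'a poly \<Rightarrow> 'a poly \<Rightarrow> 'a poly" where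
  "form_comp e f p q = (\<Sum>i\<le>e. smult (coeff f i) (p ^ i * q ^ (e - i)))"

lemma poly_form_comp: "poly (form_comp e f p q) t = form_eval e f (poly p t) (poly q t)"
  by (simp add: form_comp_def form_eval_def poly_sum mult.assoc)

lemma
  assumes "degree p \<le> d" "degree q \<le> d"
  shows degree_form_comp: "degree (form_comp e f p q) \<le> d * e"
    and form_eval_form_comp: "form_eval (d * e) (form_comp e f p q) x y =
      form_eval e f (form_eval d p x y) (form_eval d q x y)"
proof -
  have deg: "degree (p ^ i * q ^ (e - i)) \<le> d * e"
    and eval: "form_eval (d * e) (p ^ i * q ^ (e - i)) x y =
      form_eval d p x y ^ i * form_eval d q x y ^ (e - i)" if "i \<le> e" for i
  proof -
    have eq: "d * e = d * i + d * (e - i)"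
      using that by (simp flip: distrib_left)
    have le: "degree (p ^ i) \<le> d * i" "degree (q ^ (e - i)) \<le> d * (e - i)"
      using assms by (auto intro: form_eval_power)
    show "degree (p ^ i * q ^ (e - i)) \<le> d * e"
      unfolding eq using degree_mult_le le by (metis add_mono order.trans)
    show "form_eval (d * e) (p ^ i * q ^ (e - i)) x y =
        form_eval d p x y ^ i * form_eval d q x y ^ (e - i)"
      unfolding eq form_eval_mult[OF le] by (simp add: form_eval_power assms)
  qed
  show "degree (form_comp e f p q) \<le> d * e"
    unfolding form_comp_def using deg
    by (intro degree_sum_le) (auto intro: order.trans[OF degree_smult_le])
  show "form_eval (d * e) (form_comp e f p q) x y =
      form_eval e f (form_eval d p x y) (form_eval d q x y)"
    unfolding form_comp_def form_eval_sum form_eval_smult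
    by (simp add: eval form_eval_def[of e] mult.assoc)
qed

text \<open>\<open>form_X\<close> and \<open>form_Y\<close> are the partial derivatives of the
  binary form. The truncated exponents i - 1 and d - i - 1 are harmless, since the factors i and d -
  i vanish where truncation occurs.\<close>

definition form_X :: "nat \<Rightarrow> 'a :: field poly \<Rightarrow> 'a \<Rightarrow> 'a \<Rightarrow> 'a" where
  "form_X d f x y = (\<Sum>i\<le>d. of_nat i * coeff f i * x ^ (i - 1) * y ^ (d - i))"

definition form_Y :: "nat \<Rightarrow> 'a :: field poly \<Rightarrow> 'a \<Rightarrow> 'a \<Rightarrow> 'a" where
  "form_Y d f x y = (\<Sum>i\<le>d. of_nat (d - i) * coeff f i * x ^ i * y ^ (d - i - 1))"

definition jacobian :: "nat \<Rightarrow> 'a :: field poly \<Rightarrow> 'a poly \<Rightarrow> 'a \<Rightarrow> 'a \<Rightarrow> 'a" where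
  "jacobian d f g x y = form_X d f x y * form_Y d g x y - form_Y d f x y * form_X d g x y"

lemma form_euler: "x * form_X d f x y + y * form_Y d f x y = of_nat d * form_eval d f x y"
proof -
  have 1: "x * (of_nat i * coeff f i * x ^ (i - 1) * y ^ (d - i)) =
      of_nat i * (coeff f i * x ^ i * y ^ (d - i))" for i
    by (cases i) auto
  have 2: "y * (of_nat (d - i) * coeff f i * x ^ i * y ^ (d - i - 1)) =
      of_nat (d - i) * (coeff f i * x ^ i * y ^ (d - i))" for i
    by (cases "d - i") auto
  have 3: "(of_nat i + of_nat (d - i) :: 'a) = of_nat d" if "i \<le> d" for i
    using that by (simp flip: of_nat_add)
  show ?thesis
    unfolding form_X_def form_Y_def form_eval_def sum_distrib_left 1 2
    using 3 by (simp add: flip: sum.distrib distrib_right)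
qed

lemma form_X_smult: "form_X d (smult c f) x y = c * form_X d f x y"
  and form_Y_smult: "form_Y d (smult c f) x y = c * form_Y d f x y"
  by (simp_all add: form_X_def form_Y_def sum_distrib_left mult_ac)

lemma form_X_diff: "form_X d (f - g) x y = form_X d f x y - form_X d g x y"
  and form_Y_diff: "form_Y d (f - g) x y = form_Y d f x y - form_Y d g x y"
  by (simp_all add: form_X_def form_Y_def left_diff_distrib right_diff_distrib flip: sum_subtractf)

lemma jacobian_smult: "jacobian d (smult c f) (smult c g) x y = c\<^sup>2 * jacobian d f g x y"
  by (simp add: jacobian_def form_X_smult form_Y_smult power2_eq_square algebra_simps)

lemma pderiv_form_comp:
  "poly (pderiv (form_comp e f p q)) t =
    form_X e f (poly p t) (poly q t) * poly (pderiv p) t +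
    form_Y e f (poly p t) (poly q t) * poly (pderiv q) t"
proof -
  have "poly (pderiv (smult (coeff f i) (p ^ i * q ^ (e - i)))) t =
      of_nat i * coeff f i * poly p t ^ (i - 1) * poly q t ^ (e - i) * poly (pderiv p) t +
      of_nat (e - i) * coeff f i * poly p t ^ i * poly q t ^ (e - i - 1) * poly (pderiv q) t" for i
    by (simp add: pderiv_smult pderiv_mult pderiv_power algebra_simps)
  moreover have "pderiv (\<Sum>i\<in>I. h i) = (\<Sum>i\<in>I. pderiv (h i))" for h :: "nat \<Rightarrow> 'a poly" and I
    by (induction I rule: infinite_finite_induct) (auto simp: pderiv_add)
  ultimately show ?thesis
    by (simp add: form_comp_def form_X_def form_Y_def sum_distrib_right poly_sum flip: sum.distrib)
qed

definition wronskian :: "'a :: field poly \<Rightarrow> 'a poly \<Rightarrow> 'a poly" where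
  "wronskian p q = pderiv p * q - p * pderiv q"

text \<open>The chain rule rewrites the derivatives. The factor e lets Euler's identity rewrite the
  values as well, and the terms regroup into a product of two determinants.\<close>

lemma wronskian_form_comp:
  "of_nat e * poly (wronskian (form_comp e f p q) (form_comp e g p q)) t =
    jacobian e f g (poly p t) (poly q t) * poly (wronskian p q) t"
proof -
  let ?x = "poly p t" and ?y = "poly q t"
  have "of_nat e * poly (wronskian (form_comp e f p q) (form_comp e g p q)) t =
    (form_X e f ?x ?y * poly (pderiv p) t + form_Y e f ?x ?y * poly (pderiv q) t) *
      (of_nat e * form_eval e g ?x ?y) -
    (of_nat e * form_eval e f ?x ?y) *
      (form_X e g ?x ?y * poly (pderiv p) t + form_Y e g ?x ?y * poly (pderiv q) t)"
    by (simp add: wronskian_def pderiv_form_comp poly_form_comp algebra_simps)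
  also have "\<dots> = jacobian e f g ?x ?y * poly (wronskian p q) t"
    unfolding form_euler[symmetric] by (simp add: wronskian_def jacobian_def algebra_simps)
  finally show ?thesis .
qed

text \<open>The multiplicativity of the Jacobian determinant is obtained by restricting to a line.\<close>

lemma jacobian_form_comp:
  fixes f1 g1 f2 g2 :: "'a :: field_char_0 poly"
  assumes "degree f1 \<le> d" "degree g1 \<le> d" "d > 0" "e > 0" "(a, b) \<noteq> (0, 0)"
  shows "jacobian (d * e) (form_comp e f2 f1 g1) (form_comp e g2 f1 g1) a b =
    jacobian e f2 g2 (form_eval d f1 a b) (form_eval d g1 a b) * jacobian d f1 g1 a b"
proof -
  \<comment> \<open>In a direction not proportional to (a, b) the line through (a, b) misses the
    origin, and the Wronskian of its coordinates is a nonzero constant.\<close>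
  obtain u v where uv: "u * b - a * v \<noteq> 0"
    using assms(5) that[of 1 0] that[of 0 1] by (cases "b = 0") auto
  define p q where "p = [:a, u:]" and "q = [:b, v:]"
  have w: "poly (wronskian p q) 0 = u * b - a * v" and p0: "poly p 0 = a" and q0: "poly q 0 = b"
    by (simp_all add: wronskian_def p_def q_def pderiv_pCons)
  define F G where "F = form_comp d f1 p q" and "G = form_comp d g1 p q"
  have eq: "form_comp e h F G = form_comp (d * e) (form_comp e h f1 g1) p q" for h
    by (rule poly_ext) (simp add: poly_form_comp F_def G_def form_eval_form_comp assms)
  \<comment> \<open>One Wronskian is computed twice: from the composed forms on the line, and from
    the second pair of forms on the restriction of the first.\<close>
  have "of_nat (d * e) * poly (wronskian (form_comp e f2 F G) (form_comp e g2 F G)) 0 =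
      jacobian (d * e) (form_comp e f2 f1 g1) (form_comp e g2 f1 g1) a b * (u * b - a * v)"
    using wronskian_form_comp[of "d * e" "form_comp e f2 f1 g1" p q "form_comp e g2 f1 g1" 0]
    unfolding eq w p0 q0 .
  moreover have "of_nat e * poly (wronskian (form_comp e f2 F G) (form_comp e g2 F G)) 0 =
      jacobian e f2 g2 (form_eval d f1 a b) (form_eval d g1 a b) * poly (wronskian F G) 0"
    using wronskian_form_comp[of e f2 F G g2 0] by (simp add: F_def G_def poly_form_comp p0 q0)
  moreover have "of_nat d * poly (wronskian F G) 0 = jacobian d f1 g1 a b * (u * b - a * v)"
    using wronskian_form_comp[of d f1 p q g1 0] unfolding F_def G_def w p0 q0 .
  ultimately have "jacobian (d * e) (form_comp e f2 f1 g1) (form_comp e g2 f1 g1) a b * (u * b - a * v) =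
      jacobian e f2 g2 (form_eval d f1 a b) (form_eval d g1 a b) * (jacobian d f1 g1 a b * (u * b - a * v))"
    by (metis (no_types, lifting) mult.assoc mult.left_commute of_nat_mult)
  then show ?thesis using uv by simp
qed

section \<open>Lifts and ramification\<close>

lemma coprime_if_no_common_root:
  fixes p q :: "'a :: alg_closed_field poly"
  assumes "\<And>x. poly p x \<noteq> 0 \<or> poly q x \<noteq> 0"
  shows "coprime p q"
proof (rule coprimeI)
  fix h assume h: "h dvd p" "h dvd q"
  have "degree h = 0"
  proof (rule ccontr)
    assume "degree h \<noteq> 0"
    then obtain r where "poly h r = 0"
      using alg_closed_imp_poly_has_root by blast
    then show False
      using h assms[of r] by (auto elim!: dvdE)
  qed
  moreover have "h \<noteq> 0"
    using h assms[of 0] by auto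
  ultimately show "is_unit h" by (simp add: is_unit_iff_degree)
qed

text \<open>Over an algebraically closed field, coprimality and the degree condition together mean
  that the forms have no common zero on the projective line. This version passes directly to
  compositions.\<close>

lemma has_lift_iff:
  fixes f g :: "'a :: alg_closed_field poly"
  shows "has_lift d f g \<Phi> \<longleftrightarrow> degree f \<le> d \<and> degree g \<le> d \<and>
    (\<forall>x y. (x, y) \<noteq> (0, 0) \<longrightarrow> (form_eval d f x y, form_eval d g x y) \<noteq> (0, 0) \<and>
      \<Phi> (hpt x y) = hpt (form_eval d f x y) (form_eval d g x y))"
    (is "_ \<longleftrightarrow> ?R")
proof
  assume L: "has_lift d f g \<Phi>"
  then have cop: "coprime f g" and max: "max (degree f) (degree g) = d"
    by (auto simp: has_lift_def)
  have deg: "degree f \<le> d" "degree g \<le> d" using max by auto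
  have nz: "f \<noteq> 0 \<or> g \<noteq> 0"
    using cop by auto
  have "(form_eval d f x y, form_eval d g x y) \<noteq> (0, 0)" if xy: "(x, y) \<noteq> (0, 0)" for x y
  proof
    assume *: "(form_eval d f x y, form_eval d g x y) = (0, 0)"
    show False
    proof (cases "y = 0")
      case True
      with * xy have "coeff f d = 0" "coeff g d = 0"
        by (auto simp: form_eval_infinity)
      with max have "f = 0 \<and> degree g \<le> degree f \<or> g = 0 \<and> degree f \<le> degree g"
        by (auto simp: max_def split: if_splits)
      then have "degree f = 0" "degree g = 0" by auto
      with max \<open>coeff f d = 0\<close> \<open>coeff g d = 0\<close> have "f = 0" "g = 0"
        by (auto elim!: degree_eq_zeroE)
      with nz show False by simp
    next
      case False
      with * deg have "poly f (x / y) = 0" "poly g (x / y) = 0"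
        by (auto simp: form_eval_nonzero)
      then have "[:- (x / y), 1:] dvd f" "[:- (x / y), 1:] dvd g"
        by (simp_all only: poly_eq_0_iff_dvd)
      then have "is_unit [:- (x / y), 1:]"
        using cop not_coprimeI by blast
      then show False by (simp add: is_unit_poly_iff)
    qed
  qed
  with L deg show ?R by (auto simp: has_lift_def)
next
  assume R: ?R
  have "coeff f d \<noteq> 0 \<or> coeff g d \<noteq> 0"
    using R[THEN conjunct2, THEN conjunct2, rule_format, of 1 0] by (auto simp: form_eval_infinity)
  then have "degree f \<ge> d \<or> degree g \<ge> d" and nz: "f \<noteq> 0 \<or> g \<noteq> 0"
    by (auto intro: le_degree)
  with R have max: "max (degree f) (degree g) = d" by auto
  have "coprime f g"
  proof (rule coprime_if_no_common_root)
    fix x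
    have "(form_eval d f x 1, form_eval d g x 1) \<noteq> (0, 0)" using R by simp
    then show "poly f x \<noteq> 0 \<or> poly g x \<noteq> 0"
      using R by (auto simp: form_eval_affine)
  qed
  with R max show "has_lift d f g \<Phi>" by (auto simp: has_lift_def)
qed

lemma hpt_eq_iff_cross:
  assumes "(x, y) \<noteq> (0, 0)" "(x', y') \<noteq> (0, 0)"
  shows "hpt x y = hpt x' y' \<longleftrightarrow> x * y' = x' * y"
proof
  assume "hpt x y = hpt x' y'"
  then show "x * y' = x' * y" using assms by (auto simp: hpt_eq_iff)
next
  assume *: "x * y' = x' * y"
  show "hpt x y = hpt x' y'"
  proof (cases "x = 0")
    case True
    with assms * have "x' = 0" "y \<noteq> 0" "y' \<noteq> 0" by auto
    with True assms show ?thesis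
      by (subst hpt_eq_iff) (auto intro!: exI[of _ "y' / y"])
  next
    case False
    with assms * have "x' \<noteq> 0" by auto
    with False assms * show ?thesis
      by (subst hpt_eq_iff) (auto intro!: exI[of _ "x' / x"] simp: field_simps)
  qed
qed

text \<open>Two lifts of one map satisfy f * g' = f' * g, and by coprimality f and f' divide each
  other, as do g and g'. Uniqueness matters because \<open>has_ramification_index\<close> admits any
  lift.\<close>

lemma has_lift_unique:
  fixes f g :: "'a :: {alg_closed_field, field_char_0, field_gcd} poly"
  assumes L: "has_lift d f g \<Phi>" and L': "has_lift d' f' g' \<Phi>"
  shows "d = d'" "\<exists>c. c \<noteq> 0 \<and> f' = smult c f \<and> g' = smult c g"
proof -
  have cop: "coprime f g" "coprime f' g'"
    using L L' by (auto simp: has_lift_def)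
  have "poly (f * g') x = poly (f' * g) x" for x
  proof -
    have "hpt (form_eval d f x 1) (form_eval d g x 1) = hpt (form_eval d' f' x 1) (form_eval d' g' x 1)"
      using L L' by (simp add: has_lift_def)
    moreover have "(form_eval d f x 1, form_eval d g x 1) \<noteq> (0, 0)"
      "(form_eval d' f' x 1, form_eval d' g' x 1) \<noteq> (0, 0)"
      using L L' unfolding has_lift_iff by auto
    ultimately have "form_eval d f x 1 * form_eval d' g' x 1 = form_eval d' f' x 1 * form_eval d g x 1"
      by (simp add: hpt_eq_iff_cross)
    then show ?thesis
      using L L' by (simp add: has_lift_iff form_eval_affine)
  qed
  then have eq: "f * g' = f' * g"
    by (rule poly_ext)
  have dvd: "f dvd f'" "f' dvd f" "g dvd g'" "g' dvd g"
    using cop eq by (metis coprime_commute coprime_dvd_mult_left_iff coprime_dvd_mult_right_iff dvd_triv_left dvd_triv_right)+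
  have unit: "\<exists>c. c \<noteq> 0 \<and> h' = smult c h" if h: "h dvd h'" "h' dvd h" "h \<noteq> 0" for h h' :: "'a poly"
  proof -
    obtain k where k: "h' = h * k" using h(1) by (elim dvdE)
    have "k \<noteq> 0" using k h by auto
    moreover have "degree h' = degree h"
      using h k \<open>k \<noteq> 0\<close> by (intro antisym dvd_imp_degree_le) auto
    ultimately have "degree k = 0"
      using k h(3) by (simp add: degree_mult_eq)
    then show ?thesis
      using k \<open>k \<noteq> 0\<close> by (auto elim!: degree_eq_zeroE)
  qed
  show ex: "\<exists>c. c \<noteq> 0 \<and> f' = smult c f \<and> g' = smult c g"
  proof (cases "f = 0")
    case True
    then have "f' = 0" "g \<noteq> 0" using dvd cop by auto
    with True unit[OF dvd(3,4)] show ?thesis by auto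
  next
    case False
    then obtain c where c: "c \<noteq> 0" "f' = smult c f"
      using unit[OF dvd(1,2)] by auto
    with eq have "f * g' = f * smult c g" by simp
    with False have "g' = smult c g" using mult_left_cancel[of f g' "smult c g"] by blast
    with c show ?thesis by blast
  qed
  then show "d = d'"
    using L L' by (auto simp: has_lift_def)
qed

section \<open>Ramification as vanishing of the Jacobian\<close>

lemma form_X_infinity: "d > 0 \<Longrightarrow> form_X d f x 0 = of_nat d * coeff f d * x ^ (d - 1)"
  unfolding form_X_def by (subst sum.remove[of _ d]) (auto intro!: sum.neutral)

lemma form_Y_infinity: "d > 0 \<Longrightarrow> form_Y d f x 0 = coeff f (d - 1) * x ^ (d - 1)"
proof -
  assume d: "d > 0"
  have "of_nat (d - i) * coeff f i * x ^ i * 0 ^ (d - i - 1) = 0" if "i \<in> {..d} - {d - 1}" for i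
    using that d by (cases "i = d") auto
  then have "(\<Sum>i\<in>{..d} - {d - 1}. of_nat (d - i) * coeff f i * x ^ i * 0 ^ (d - i - 1)) = 0"
    by (intro sum.neutral) auto
  then show ?thesis
    unfolding form_Y_def using d by (subst sum.remove[of _ "d - 1"]) auto
qed

lemma form_X_nonzero:
  assumes "degree f \<le> d" "d > 0" "y \<noteq> 0"
  shows "form_X d f x y = y ^ (d - 1) * poly (pderiv f) (x / y)"
proof -
  obtain e where d: "d = Suc e" using assms(2) by (cases d) auto
  have "form_X d f x y = (\<Sum>i\<le>e. of_nat (Suc i) * coeff f (Suc i) * x ^ i * y ^ (e - i))"
    unfolding form_X_def d by (subst sum.atMost_Suc_shift) simp
  also have "\<dots> = form_eval e (pderiv f) x y"
    by (simp add: form_eval_def coeff_pderiv)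
  also have "\<dots> = y ^ e * poly (pderiv f) (x / y)"
    using assms by (intro form_eval_nonzero degree_le) (auto simp: d coeff_pderiv coeff_eq_0)
  finally show ?thesis by (simp add: d)
qed

lemma order_ge_2_iff:
  fixes h :: "'a :: field poly"
  assumes "h \<noteq> 0"
  shows "Polynomial.order r h \<ge> 2 \<longleftrightarrow> poly h r = 0 \<and> poly (pderiv h) r = 0"
proof (cases "poly h r = 0")
  case True
  then obtain q where q: "h = [:- r, 1:] * q"
    by (auto simp: poly_eq_0_iff_dvd elim: dvdE)
  have "Polynomial.order r h \<ge> 2 \<longleftrightarrow> [:- r, 1:]\<^sup>2 dvd h"
    using assms by (simp add: order_divides)
  also have "\<dots> \<longleftrightarrow> [:- r, 1:] dvd q"
    unfolding q power2_eq_square by (subst dvd_mult_cancel_left) auto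
  also have "\<dots> \<longleftrightarrow> poly (pderiv h) r = 0"
    unfolding q pderiv_mult by (simp add: pderiv_pCons poly_eq_0_iff_dvd[symmetric] del: mult_pCons_left)
  finally show ?thesis using True by simp
next
  case False
  then show ?thesis by (simp add: order_0I)
qed

text \<open>Partial derivatives treat affine points and infinity alike. At infinity the two top
  coefficients decide; at an affine point Euler's identity trades the Y-derivative for the value,
  and the double-root criterion applies.\<close>

lemma form_order_ge_2_iff:
  fixes h :: "'a :: field_char_0 poly"
  assumes "h \<noteq> 0" "degree h \<le> d" "d > 0" "(a, b) \<noteq> (0, 0)"
  shows "form_order d h a b \<ge> 2 \<longleftrightarrow> form_X d h a b = 0 \<and> form_Y d h a b = 0"
proof (cases "b = 0")
  case True
  with assms have a: "a \<noteq> 0" by simp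
  have "form_order d h a b \<ge> 2 \<longleftrightarrow> degree h < d - 1"
    using True assms by (auto simp: form_order_def)
  also have "\<dots> \<longleftrightarrow> coeff h d = 0 \<and> coeff h (d - 1) = 0"
  proof
    assume *: "coeff h d = 0 \<and> coeff h (d - 1) = 0"
    then have "degree h \<noteq> d" "degree h \<noteq> d - 1"
      using assms(1) by (metis leading_coeff_0_iff)+
    with assms show "degree h < d - 1" by linarith
  qed (auto simp: coeff_eq_0)
  also have "\<dots> \<longleftrightarrow> form_X d h a b = 0 \<and> form_Y d h a b = 0"
    using assms a True by (simp add: form_X_infinity form_Y_infinity)
  finally show ?thesis .
next
  case False
  have "form_X d h a b = 0 \<and> form_Y d h a b = 0 \<longleftrightarrow>
      form_X d h a b = 0 \<and> a * form_X d h a b + b * form_Y d h a b = 0"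
    using False by auto
  also have "\<dots> \<longleftrightarrow> poly (pderiv h) (a / b) = 0 \<and> poly h (a / b) = 0"
    unfolding form_euler using assms False by (simp add: form_X_nonzero form_eval_nonzero)
  finally show ?thesis
    using False order_ge_2_iff[OF assms(1), of "a / b"] by (auto simp: form_order_def)
qed

lemma lift_combination_nonzero:
  fixes f g :: "'a :: field poly"
  assumes "coprime f g" "max (degree f) (degree g) > 0" "(c, e) \<noteq> (0, 0)"
  shows "smult e f - smult c g \<noteq> 0"
proof
  assume eq: "smult e f - smult c g = 0"
  have unit: "degree h = 0" if "h dvd f" "h dvd g" for h
  proof -
    have "is_unit h" using that assms(1) coprime_common_divisor by blast
    then show ?thesis by (auto simp: is_unit_poly_iff)
  qed
  show False
  proof (cases "e = 0")
    case True
    with assms eq have "g = 0" by simp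
    with unit[of f] assms(2) show False by simp
  next
    case False
    have "f = smult (c / e) g"
      using arg_cong[OF eq, of "smult (inverse e)"] False
      by (simp add: smult_diff_right divide_inverse mult.commute)
    then have "g dvd f" by (simp add: dvd_smult)
    with unit[of g] have "degree g = 0" by simp
    moreover have "degree f \<le> degree g"
      unfolding \<open>f = smult (c / e) g\<close> by (rule degree_smult_le)
    ultimately show False using assms(2) by simp
  qed
qed

lemma degree_lift_combination:
  assumes "has_lift d f g \<Phi>"
  shows "degree (smult e f - smult c g) \<le> d"
  using assms by (intro degree_diff_le order.trans[OF degree_smult_le]) (auto simp: has_lift_def)

text \<open>By Euler's identity, d times the gradient of the fibre form at [a : b] is the vector (b,
  -a) times the Jacobian, up to a nonzero factor.\<close>

lemma form_order_lift_iff: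
  fixes f g :: "'a :: {alg_closed_field, field_char_0} poly"
  assumes L: "has_lift d f g \<Phi>" and d: "d > 0" and ab: "(a, b) \<noteq> (0, 0)"
    and ce: "(c, e) \<noteq> (0, 0)" "\<Phi> (hpt a b) = hpt c e"
  shows "form_order d (smult e f - smult c g) a b \<ge> 2 \<longleftrightarrow> jacobian d f g a b = 0"
proof -
  define F G where "F = form_eval d f a b" and "G = form_eval d g a b"
  have FG: "(F, G) \<noteq> (0, 0)" "hpt F G = hpt c e"
    using L ab ce(2) unfolding has_lift_iff F_def G_def by auto
  obtain k where k: "k \<noteq> 0" "c = k * F" "e = k * G"
    using FG(2) hpt_eq_iff[OF FG(1) ce(1)] by blast
  define h where "h = smult e f - smult c g"
  have "h \<noteq> 0"
    unfolding h_def using L d ce by (intro lift_combination_nonzero) (auto simp: has_lift_def)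
  moreover have "degree h \<le> d"
    unfolding h_def by (rule degree_lift_combination[OF L])
  ultimately have "form_order d h a b \<ge> 2 \<longleftrightarrow> form_X d h a b = 0 \<and> form_Y d h a b = 0"
    using d ab by (intro form_order_ge_2_iff)
  moreover have "of_nat d * form_X d h a b = k * b * jacobian d f g a b"
  proof -
    have "of_nat d * form_X d h a b =
        k * ((of_nat d * G) * form_X d f a b - (of_nat d * F) * form_X d g a b)"
      by (simp add: h_def k form_X_diff form_X_smult algebra_simps)
    also have "\<dots> = k * b * jacobian d f g a b"
      unfolding F_def G_def form_euler[symmetric] by (simp add: jacobian_def algebra_simps)
    finally show ?thesis .
  qed
  moreover have "of_nat d * form_Y d h a b = - (k * a * jacobian d f g a b)"
  proof -
    have "of_nat d * form_Y d h a b =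
        k * ((of_nat d * G) * form_Y d f a b - (of_nat d * F) * form_Y d g a b)"
      by (simp add: h_def k form_Y_diff form_Y_smult algebra_simps)
    also have "\<dots> = - (k * a * jacobian d f g a b)"
      unfolding F_def G_def form_euler[symmetric] by (simp add: jacobian_def algebra_simps)
    finally show ?thesis .
  qed
  ultimately show ?thesis
    using d k(1) ab unfolding h_def
    by (metis mult_eq_0_iff neg_equal_0_iff_equal of_nat_eq_0_iff less_numeral_extra(3))
qed

lemma ramification_points_iff:
  fixes f g :: "'a :: {alg_closed_field, field_char_0, field_gcd} poly"
  assumes L: "has_lift d f g \<Phi>" and d: "d > 0" and ab: "(a, b) \<noteq> (0, 0)"
  shows "hpt a b \<in> ramification_points \<Phi> \<longleftrightarrow> jacobian d f g a b = 0"
proof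
  assume "hpt a b \<in> ramification_points \<Phi>"
  then obtain d' f' g' a' b' c e where *: "has_lift d' f' g' \<Phi>" "(a', b') \<noteq> (0, 0)" "hpt a b = hpt a' b'"
      "(c, e) \<noteq> (0, 0)" "\<Phi> (hpt a b) = hpt c e" "form_order d' (smult e f' - smult c g') a' b' \<ge> 2"
    unfolding ramification_points_def has_ramification_index_def by blast
  have d': "d' = d" using has_lift_unique(1)[OF L *(1)] by simp
  obtain k where k: "k \<noteq> 0" "f' = smult k f" "g' = smult k g"
    using has_lift_unique(2)[OF L *(1)] by blast
  have "jacobian d f' g' a' b' = 0"
    using form_order_lift_iff[of d f' g' \<Phi> a' b' c e] * d d' by simp
  then have J: "jacobian d f g a' b' = 0"
    using k by (simp add: jacobian_smult)
  obtain s where s: "s \<noteq> 0" "a' = s * a" "b' = s * b"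
    using *(3) hpt_eq_iff[OF ab *(2)] by blast
  \<comment> \<open>The Jacobian is homogeneous, so its vanishing does not depend on the coordinates
    chosen for the point.\<close>
  have X: "form_X d h (s * a) (s * b) = s ^ (d - 1) * form_X d h a b"
    and Y: "form_Y d h (s * a) (s * b) = s ^ (d - 1) * form_Y d h a b" for h
  proof -
    have "of_nat i * coeff h i * (s * a) ^ (i - 1) * (s * b) ^ (d - i) =
        s ^ (d - 1) * (of_nat i * coeff h i * a ^ (i - 1) * b ^ (d - i))" if "i \<le> d" for i
    proof (cases i)
      case (Suc j)
      then have "s ^ (d - 1) = s ^ (i - 1) * s ^ (d - i)"
        using that by (simp flip: power_add)
      then show ?thesis by (simp add: power_mult_distrib mult_ac)
    qed simp
    then show "form_X d h (s * a) (s * b) = s ^ (d - 1) * form_X d h a b"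
      unfolding form_X_def sum_distrib_left by (intro sum.cong) auto
    have "of_nat (d - i) * coeff h i * (s * a) ^ i * (s * b) ^ (d - i - 1) =
        s ^ (d - 1) * (of_nat (d - i) * coeff h i * a ^ i * b ^ (d - i - 1))" if "i \<le> d" for i
    proof (cases "d - i")
      case (Suc j)
      then have "d - 1 = i + (d - i - 1)" using that by linarith
      then have "s ^ (d - 1) = s ^ i * s ^ (d - i - 1)"
        by (metis power_add)
      then show ?thesis by (simp add: power_mult_distrib mult_ac)
    qed simp
    then show "form_Y d h (s * a) (s * b) = s ^ (d - 1) * form_Y d h a b"
      unfolding form_Y_def sum_distrib_left by (intro sum.cong) auto
  qed
  have "(s ^ (d - 1))\<^sup>2 * jacobian d f g a b = jacobian d f g a' b'"
    unfolding s jacobian_def X Y by (simp add: power2_eq_square algebra_simps)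
  with J s(1) show "jacobian d f g a b = 0" by simp
next
  assume J: "jacobian d f g a b = 0"
  have "(form_eval d f a b, form_eval d g a b) \<noteq> (0, 0)"
    "\<Phi> (hpt a b) = hpt (form_eval d f a b) (form_eval d g a b)"
    using L ab unfolding has_lift_iff by auto
  with form_order_lift_iff[OF L d ab this] J L ab show "hpt a b \<in> ramification_points \<Phi>"
    unfolding ramification_points_def has_ramification_index_def by blast
qed

instance alg_closure :: (field) field_gcd ..

section \<open>Compositions and iterates\<close>

lemma has_lift_comp:
  fixes f1 g1 f2 g2 :: "'a :: alg_closed_field poly"
  assumes L1: "has_lift d f1 g1 \<Phi>" and L2: "has_lift e f2 g2 \<Psi>"
  shows "has_lift (d * e) (form_comp e f2 f1 g1) (form_comp e g2 f1 g1) (\<Psi> \<circ> \<Phi>)"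
  unfolding has_lift_iff
proof (intro conjI allI impI)
  have deg: "degree f1 \<le> d" "degree g1 \<le> d"
    using L1 by (auto simp: has_lift_iff)
  show "degree (form_comp e f2 f1 g1) \<le> d * e" "degree (form_comp e g2 f1 g1) \<le> d * e"
    using deg by (auto intro: degree_form_comp)
  fix x y :: 'a assume xy: "(x, y) \<noteq> (0, 0)"
  define x' y' where "x' = form_eval d f1 x y" and "y' = form_eval d g1 x y"
  have 1: "(x', y') \<noteq> (0, 0)" "\<Phi> (hpt x y) = hpt x' y'"
    using L1 xy unfolding has_lift_iff x'_def y'_def by blast+
  have 2: "(form_eval e f2 x' y', form_eval e g2 x' y') \<noteq> (0, 0)"
    "\<Psi> (hpt x' y') = hpt (form_eval e f2 x' y') (form_eval e g2 x' y')"
    using L2 1(1) unfolding has_lift_iff by blast+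
  show "(form_eval (d * e) (form_comp e f2 f1 g1) x y, form_eval (d * e) (form_comp e g2 f1 g1) x y) \<noteq> (0, 0)"
    using 2(1) unfolding form_eval_form_comp[OF deg] x'_def y'_def .
  show "(\<Psi> \<circ> \<Phi>) (hpt x y) = hpt (form_eval (d * e) (form_comp e f2 f1 g1) x y)
      (form_eval (d * e) (form_comp e g2 f1 g1) x y)"
    using 1(2) 2(2) unfolding form_eval_form_comp[OF deg] x'_def y'_def by simp
qed

lemma has_lift_id: "has_lift 1 [:0, 1:] [:1 :: 'a :: field:] id"
  by (auto simp: has_lift_def form_eval_def simp flip: one_pCons)

lemma ramification_points_comp:
  fixes f1 g1 f2 g2 :: "'a :: {alg_closed_field, field_char_0, field_gcd} poly"
  assumes L1: "has_lift d f1 g1 \<Phi>" and L2: "has_lift e f2 g2 \<Psi>" and pos: "d > 0" "e > 0"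
  shows "ramification_points (\<Psi> \<circ> \<Phi>) = ramification_points \<Phi> \<union> \<Phi> -` ramification_points \<Psi>"
proof (rule Set.set_eqI)
  fix P :: "'a proj_line"
  obtain a b where ab: "(a, b) \<noteq> (0, 0)" "P = hpt a b" by (rule hpt_cases)
  define a' b' where "a' = form_eval d f1 a b" and "b' = form_eval d g1 a b"
  have ab': "(a', b') \<noteq> (0, 0)" "\<Phi> P = hpt a' b'" and deg: "degree f1 \<le> d" "degree g1 \<le> d"
    using L1 ab unfolding has_lift_iff a'_def b'_def by blast+
  show "P \<in> ramification_points (\<Psi> \<circ> \<Phi>) \<longleftrightarrow> P \<in> ramification_points \<Phi> \<union> \<Phi> -` ramification_points \<Psi>"
    using ramification_points_iff[OF has_lift_comp[OF L1 L2] _ ab(1)] pos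
      ramification_points_iff[OF L1 pos(1) ab(1)] ramification_points_iff[OF L2 pos(2) ab'(1)]
      jacobian_form_comp[OF deg pos ab(1), of f2 g2]
    by (auto simp: ab(2) ab'(2)[unfolded ab(2)] a'_def[symmetric] b'_def[symmetric])
qed

lemma ramification_points_id:
  "ramification_points (id :: 'a :: {alg_closed_field, field_char_0, field_gcd} proj_line \<Rightarrow> _) = {}"
proof -
  have "P \<notin> ramification_points id" for P :: "'a proj_line"
  proof -
    obtain a b where ab: "(a, b) \<noteq> (0, 0)" "P = hpt a b" by (rule hpt_cases)
    have "jacobian 1 [:0, 1:] [:1:] a b = 1"
      by (simp add: jacobian_def form_X_def form_Y_def)
    then show ?thesis
      using ramification_points_iff[OF has_lift_id _ ab(1)] ab(2) by simp
  qed
  then show ?thesis by blast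
qed

lemma has_lift_funpow:
  fixes f g :: "'a :: alg_closed_field poly"
  assumes "has_lift d f g \<Phi>"
  shows "\<exists>f' g'. has_lift (d ^ n) f' g' (\<Phi> ^^ n)"
proof (induction n)
  case 0
  then show ?case using has_lift_id by (auto simp: id_def)
next
  case (Suc n)
  then obtain f' g' where "has_lift (d ^ n) f' g' (\<Phi> ^^ n)" by blast
  from has_lift_comp[OF this assms] show ?case
    unfolding funpow.simps power_Suc mult.commute[of d] by blast
qed

lemma ramification_points_funpow:
  fixes f g :: "'a :: {alg_closed_field, field_char_0, field_gcd} poly"
  assumes L: "has_lift d f g \<Phi>" and d: "d > 0"
  shows "ramification_points (\<Phi> ^^ n) = {P. \<exists>i<n. (\<Phi> ^^ i) P \<in> ramification_points \<Phi>}"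
proof (induction n)
  case 0
  then show ?case using ramification_points_id by (simp add: id_def)
next
  case (Suc n)
  obtain f' g' where L': "has_lift (d ^ n) f' g' (\<Phi> ^^ n)"
    using has_lift_funpow[OF L] by blast
  have eq: "ramification_points (\<Phi> ^^ Suc n) =
      ramification_points (\<Phi> ^^ n) \<union> (\<Phi> ^^ n) -` ramification_points \<Phi>"
    using ramification_points_comp[OF L' L] d unfolding funpow.simps by simp
  show ?case
    unfolding eq Suc by (auto simp: less_Suc_eq)
qed

text \<open>A zero of the form e F - c G lies over [c : e]; if its coefficient of X^d vanishes,
  infinity is such a zero. Surjectivity is later used to continue orbits backwards.\<close>

lemma lift_surj:
  fixes f g :: "'a :: {alg_closed_field, field_char_0} poly"
  assumes L: "has_lift d f g \<Phi>" and d: "d > 0"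
  shows "\<exists>P. \<Phi> P = Q"
proof -
  obtain c e where ce: "(c, e) \<noteq> (0, 0)" "Q = hpt c e" by (rule hpt_cases)
  define h where "h = smult e f - smult c g"
  have "degree h \<le> d"
    unfolding h_def by (rule degree_lift_combination[OF L])
  have "\<exists>x y. (x, y) \<noteq> (0, 0) \<and> form_eval d h x y = 0"
  proof (cases "coeff h d = 0")
    case True
    then show ?thesis
      by (intro exI[of _ 1] exI[of _ 0]) (simp add: form_eval_infinity)
  next
    case False
    then have "degree h > 0"
      using d le_degree[of h d] by linarith
    then obtain r where "poly h r = 0"
      using alg_closed_imp_poly_has_root by blast
    then show ?thesis
      using \<open>degree h \<le> d\<close>
      by (intro exI[of _ r] exI[of _ 1]) (simp add: form_eval_affine)
  qed
  then obtain x y where xy: "(x, y) \<noteq> (0, 0)" "form_eval d h x y = 0" by blast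
  have "\<Phi> (hpt x y) = hpt (form_eval d f x y) (form_eval d g x y)"
    "(form_eval d f x y, form_eval d g x y) \<noteq> (0, 0)"
    using L xy(1) unfolding has_lift_iff by blast+
  moreover have "e * form_eval d f x y = c * form_eval d g x y"
    using xy(2) by (simp add: h_def form_eval_diff form_eval_smult)
  ultimately show ?thesis
    using ce by (intro exI[of _ "hpt x y"]) (simp add: hpt_eq_iff_cross mult.commute)
qed

lemma funpow_surj:
  fixes f g :: "'a :: {alg_closed_field, field_char_0} poly"
  assumes L: "has_lift d f g \<Phi>" and d: "d > 0"
  shows "\<exists>P. (\<Phi> ^^ n) P = Q"
proof (induction n arbitrary: Q)
  case (Suc n)
  obtain Q' where "\<Phi> Q' = Q" using lift_surj[OF L d] by blast
  moreover obtain P where "(\<Phi> ^^ n) P = Q'" using Suc by blast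
  ultimately show ?case by auto
qed simp

text \<open>If the Wronskian vanished, coprimality would make f and g divide their own derivatives,
  so both would be constant in characteristic 0.\<close>

lemma wronskian_nonzero:
  fixes f g :: "'a :: {field_char_0, field_gcd} poly"
  assumes "coprime f g" "max (degree f) (degree g) > 0"
  shows "wronskian f g \<noteq> 0"
proof
  assume "wronskian f g = 0"
  then have eq: "pderiv f * g = f * pderiv g" by (simp add: wronskian_def)
  have deriv: "pderiv h = 0" if "h dvd pderiv h" for h :: "'a poly"
  proof (rule ccontr)
    assume *: "pderiv h \<noteq> 0"
    then have "degree h \<le> degree (pderiv h)"
      using that by (intro dvd_imp_degree_le)
    then have "degree h = 0" by (simp add: degree_pderiv)
    with * show False by (simp add: pderiv_eq_0_iff)
  qed
  have "f dvd pderiv f * g" "g dvd f * pderiv g"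
    unfolding eq by (simp, simp flip: eq)
  then have "f dvd pderiv f" "g dvd pderiv g"
    using assms(1) by (simp_all add: coprime_dvd_mult_left_iff coprime_dvd_mult_right_iff coprime_commute)
  then have "pderiv f = 0" "pderiv g = 0" by (auto intro: deriv)
  then show False using assms(2) by (simp add: pderiv_eq_0_iff)
qed

text \<open>In the affine chart the Jacobian is d times the Wronskian, so apart from infinity the
  ramification points are roots of a nonzero polynomial.\<close>

lemma finite_ramification_points:
  fixes f g :: "'a :: {alg_closed_field, field_char_0, field_gcd} poly"
  assumes L: "has_lift d f g \<Phi>" and d: "d > 0"
  shows "finite (ramification_points \<Phi>)"
proof -
  have W: "wronskian f g \<noteq> 0"
    using L d by (intro wronskian_nonzero) (auto simp: has_lift_def)
  have deg: "degree f \<le> d" "degree g \<le> d" using L by (auto simp: has_lift_iff)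
  have "ramification_points \<Phi> \<subseteq> insert (hpt 1 0) ((\<lambda>x. hpt x 1) ` {x. poly (wronskian f g) x = 0})"
  proof
    fix P assume P: "P \<in> ramification_points \<Phi>"
    obtain a b where ab: "(a, b) \<noteq> (0, 0)" "P = hpt a b" by (rule hpt_cases)
    show "P \<in> insert (hpt 1 0) ((\<lambda>x. hpt x 1) ` {x. poly (wronskian f g) x = 0})"
    proof (cases "b = 0")
      case True
      then have "P = hpt 1 0" using ab by (simp add: hpt_eq_iff_cross)
      then show ?thesis by simp
    next
      case False
      then have eq: "P = hpt (a / b) 1" using ab by (simp add: hpt_eq_iff_cross)
      then have J: "jacobian d f g (a / b) 1 = 0"
        using P ramification_points_iff[OF L d, of "a / b" 1] by simp
      have id: "form_comp d h [:0, 1:] [:1:] = h" if "degree h \<le> d" for h :: "'a poly"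
        by (rule poly_ext) (simp add: poly_form_comp form_eval_affine that)
      have "of_nat d * poly (wronskian f g) (a / b) = 0"
        using wronskian_form_comp[of d f "[:0, 1:]" "[:1:]" g "a / b"] J by (simp add: id deg)
      then have "poly (wronskian f g) (a / b) = 0" using d by simp
      with eq show ?thesis by blast
    qed
  qed
  moreover have "finite {x. poly (wronskian f g) x = 0}"
    using W by (rule poly_roots_finite)
  ultimately show ?thesis
    by (meson finite_imageI finite_insert finite_subset)
qed

section \<open>A non-archimedean Rolle theorem\<close>

lemma (in nonarch_absval) diff_eq: "v y < v x \<Longrightarrow> v (x - y) = v x"
  using add_eq[of "- y" x] by simp

text \<open>Each factor z - b is z up to a smaller error. The leading term is tracked, and not just
  its absolute value, so that several such products can be added.\<close>

lemma (in nonarch_absval) prod_diff_less: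
  assumes "finite B" "\<And>b. b \<in> B \<Longrightarrow> v b < v z" "z \<noteq> 0"
  shows "v ((\<Prod>b\<in>B. z - b) - z ^ card B) < v z ^ card B"
  using assms(1,2)
proof (induction B rule: finite_induct)
  case (insert b B)
  have eq: "(\<Prod>b\<in>insert b B. z - b) - z ^ card (insert b B) =
      z * ((\<Prod>b\<in>B. z - b) - z ^ card B) - b * (\<Prod>b\<in>B. z - b)"
    using insert.hyps by (simp add: algebra_simps)
  have "v (\<Prod>b\<in>B. z - b) = v z ^ card B"
    using insert.prems by (simp add: prod diff_eq)
  then have "v (b * (\<Prod>b\<in>B. z - b)) < v z ^ card (insert b B)"
    using insert assms(3) by (simp add: mult)
  moreover have "v (z * ((\<Prod>b\<in>B. z - b) - z ^ card B)) < v z ^ card (insert b B)"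
    using insert assms(3) by (simp add: mult)
  ultimately show ?case
    unfolding eq by (rule diff_less[rotated])
qed simp

lemma (in nonarch_absval) poly_open_disc_factorization:
  assumes "p \<noteq> 0"
  obtains A e h where "finite A" "\<And>a. a \<in> A \<Longrightarrow> v a < 1 \<and> e a > 0"
    "\<And>z. v z < 1 \<Longrightarrow> poly h z \<noteq> 0" "p = (\<Prod>a\<in>A. [:- a, 1:] ^ e a) * h" "sum e A \<le> degree p"
proof -
  have "\<exists>A e h. finite A \<and> (\<forall>a\<in>A. v a < 1 \<and> e a > 0) \<and> (\<forall>z. v z < 1 \<longrightarrow> poly h z \<noteq> 0) \<and>
      p = (\<Prod>a\<in>A. [:- a, 1:] ^ e a) * h \<and> sum e A \<le> degree p"
    using assms
  proof (induction p rule: poly_root_order_induct)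
    case (no_roots p)
    then show ?case
      by (intro exI[of _ "{}"] exI[of _ "\<lambda>_. 0"] exI[of _ p]) auto
  next
    case (root p x n)
    then have "p \<noteq> 0" by auto
    with root obtain A e h where A: "finite A" "\<forall>a\<in>A. v a < 1 \<and> e a > 0"
        "\<forall>z. v z < 1 \<longrightarrow> poly h z \<noteq> 0" "p = (\<Prod>a\<in>A. [:- a, 1:] ^ e a) * h" "sum e A \<le> degree p"
      by blast
    have deg: "degree ([:- x, 1:] ^ n * p) = n + degree p"
      using \<open>p \<noteq> 0\<close> by (simp add: degree_mult_eq degree_power_eq)
    show ?case
    proof (cases "v x < 1")
      case True
      have x: "x \<notin> A"
      proof
        assume "x \<in> A"
        then have "poly (\<Prod>a\<in>A. [:- a, 1:] ^ e a) x = 0"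
          using A by (auto simp: poly_prod)
        with A(4) root(2) show False by (metis mult_zero_left poly_mult)
      qed
      define e' where "e' = e(x := n)"
      have e'x: "e' x = n" by (simp add: e'_def)
      have 1: "(\<Prod>a\<in>A. [:- a, 1:] ^ e' a) = (\<Prod>a\<in>A. [:- a, 1:] ^ e a)" "sum e' A = sum e A"
        using x by (auto simp: e'_def intro!: prod.cong sum.cong)
      show ?thesis
      proof (intro exI conjI)
        show "finite (insert x A)" using A by simp
        show "\<forall>a\<in>insert x A. v a < 1 \<and> 0 < e' a"
          using A True root(1) by (auto simp: e'_def)
        show "\<forall>z. v z < 1 \<longrightarrow> poly h z \<noteq> 0" by fact
        show "[:- x, 1:] ^ n * p = (\<Prod>a\<in>insert x A. [:- a, 1:] ^ e' a) * h"
          using A(1) x by (subst prod.insert) (auto simp: 1 e'x mult.assoc A(4))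
        show "sum e' (insert x A) \<le> degree ([:- x, 1:] ^ n * p)"
          using A(1,5) x unfolding deg by (subst sum.insert) (auto simp: 1 e'x)
      qed
    next
      case False
      show ?thesis
      proof (intro exI conjI)
        show "\<forall>z. v z < 1 \<longrightarrow> poly ([:- x, 1:] ^ n * h) z \<noteq> 0"
          using A(3) False by auto
        show "[:- x, 1:] ^ n * p = (\<Prod>a\<in>A. [:- a, 1:] ^ e a) * ([:- x, 1:] ^ n * h)"
          by (simp add: A(4))
        show "sum e A \<le> degree ([:- x, 1:] ^ n * p)"
          unfolding deg using A(5) by simp
      qed (use A in auto)
    qed
  qed simp
  then show thesis using that by blast
qed

locale nonarch_absval_closed = nonarch_absval v
  for v :: "'a :: {alg_closed_field, field_char_0} \<Rightarrow> real"
begin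

text \<open>For z in the disc and a root x outside it, v (z - x) = v x, which is at least 1. So v is
  constant along the disc, and the logarithmic derivative, a sum of terms n / (z - x), is at most
  1.\<close>

lemma no_root_open_disc:
  assumes "\<And>z. v z < 1 \<Longrightarrow> poly h z \<noteq> 0" "v z < 1"
  shows "v (poly h z) = v (poly h 0) \<and> v (poly (pderiv h) z) \<le> v (poly h 0)"
  using assms
proof (induction h rule: poly_root_order_induct)
  case 0
  then show ?case by simp
next
  case (no_roots p)
  have "degree p = 0"
    using alg_closed_imp_poly_has_root[of p] no_roots(1) by blast
  then show ?case by (auto elim!: degree_eq_zeroE)
next
  case (root p x n)
  have x: "v x \<ge> 1"
    using root.prems(1)[of x] root(1) by (cases "v x < 1") auto
  have p: "v (poly p z) = v (poly p 0)" "v (poly (pderiv p) z) \<le> v (poly p 0)"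
    using root.IH root.prems by auto
  have zx: "v (z - x) = v x"
    using diff_eq[of z x] x root.prems(2) diff_commute[of z x] by simp
  have 1: "v (poly ([:- x, 1:] ^ n * p) y) = v x ^ n * v (poly p y)" if "v (y - x) = v x" for y
    using that by (simp add: mult power)
  obtain m where n: "n = Suc m" using root(1) by (cases n) auto
  have "v (poly (pderiv ([:- x, 1:] ^ n * p)) z) \<le> v x ^ n * v (poly p 0)"
  proof -
    have "poly (pderiv ([:- x, 1:] ^ n * p)) z =
        (z - x) ^ n * poly (pderiv p) z + of_nat n * ((z - x) ^ m * poly p z)"
      unfolding pderiv_mult pderiv_power n by (simp add: pderiv_pCons algebra_simps)
    also have "v \<dots> \<le> v x ^ n * v (poly p 0)"
    proof (rule add_le)
      show "v ((z - x) ^ n * poly (pderiv p) z) \<le> v x ^ n * v (poly p 0)"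
        using p by (simp add: mult power zx mult_left_mono)
      have "v (of_nat n) * (v x ^ m * v (poly p 0)) \<le> 1 * (v x ^ n * v (poly p 0))"
        using x by (intro mult_mono of_nat_le_1 power_increasing) (auto simp: n)
      then show "v (of_nat n * ((z - x) ^ m * poly p z)) \<le> v x ^ n * v (poly p 0)"
        by (simp add: mult power zx p)
    qed
    finally show ?thesis .
  qed
  with 1[of z] 1[of 0] zx p(1) show ?case by simp
qed

text \<open>A square root of b has the geometric mean of v b and 1 as its absolute value. Algebraic
  closedness thus gives room between the roots and the boundary of the disc.\<close>

lemma sqrt_exists:
  assumes "b \<noteq> 0" "v b < 1"
  obtains z where "v b < v z" "v z < 1"
proof -
  obtain z where z: "z ^ 2 = b" using nth_root_exists[of 2 b] by auto
  then have eq: "v z * v z = v b" by (metis mult power2_eq_square)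
  have "v z > 0" using z assms(1) by auto
  have "v z < 1"
  proof (rule ccontr)
    assume "\<not> v z < 1"
    then have "1 * 1 \<le> v z * v z" by (intro mult_mono) auto
    with eq assms(2) show False by simp
  qed
  moreover from this \<open>v z > 0\<close> have "v z * v z < v z * 1"
    by (intro mult_strict_left_mono)
  ultimately show thesis using that eq by simp
qed

text \<open>
  Dividing the Wronskian of \<open>h\<close> and \<open>q\<close> by the roots of \<open>h\<close> in the open unit disc, taken with
  multiplicities reduced by one, leaves \<open>T\<close>. If \<open>T\<close> had no root in the disc, then \<open>v \<circ> T\<close> would be
  constant there; but it is larger at a point farther from \<open>0\<close> than all the roots of \<open>h\<close> than it is
  at the root \<open>0\<close>. The multiplicities have to be units for this.
\<close>

lemma wronskian_root:
  assumes h: "h \<noteq> 0" "poly h 0 = 0" "poly h t = 0" and t: "t \<noteq> 0" "v t < 1"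
    and tame: "\<And>n. 0 < n \<Longrightarrow> n \<le> degree h \<Longrightarrow> v (of_nat n) = 1"
    and q: "\<And>z. v z < 1 \<Longrightarrow> v (poly q z) = 1" "\<And>z. v z < 1 \<Longrightarrow> v (poly (pderiv q) z) \<le> 1"
  shows "\<exists>s. v s < 1 \<and> poly h s \<noteq> 0 \<and> poly (wronskian h q) s = 0"
proof -
  obtain A e k where A: "finite A" "\<And>a. a \<in> A \<Longrightarrow> v a < 1 \<and> e a > 0"
    and k: "\<And>z. v z < 1 \<Longrightarrow> poly k z \<noteq> 0"
    and hk: "h = (\<Prod>a\<in>A. [:- a, 1:] ^ e a) * k" and se: "sum e A \<le> degree h"
    using poly_open_disc_factorization[OF h(1)] by blast
  have mem: "s \<in> A" if "v s < 1" "poly h s = 0" for s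
    using that k[OF that(1)] A(1) by (auto simp: hk poly_prod)
  have A0: "0 \<in> A" "t \<in> A" using mem h t by auto
  \<comment> \<open>\<open>R\<close> is the product of the distinct linear factors in the disc, and
    \<open>M\<close> is \<open>R\<close> times the logarithmic derivative of that part of h. The
    Wronskian becomes \<open>Z * T\<close>.\<close>
  define Z where "Z = (\<Prod>a\<in>A. [:- a, 1:] ^ (e a - 1))"
  define N where "N a = (\<Prod>b\<in>A - {a}. [:- b, 1:])" for a
  define M where "M = (\<Sum>a\<in>A. smult (of_nat (e a)) (N a))"
  define R where "R = (\<Prod>a\<in>A. [:- a, 1:])"
  define T where "T = M * k * q + R * (pderiv k * q - k * pderiv q)"
  have pow: "[:- a, 1:] ^ e a = [:- a, 1:] ^ (e a - 1) * [:- a, 1:]" if "a \<in> A" for a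
    using A(2)[OF that] by (cases "e a") (auto simp: mult.commute)
  have ZR: "(\<Prod>a\<in>A. [:- a, 1:] ^ e a) = Z * R"
    unfolding Z_def R_def using pow by (simp flip: prod.distrib)
  have "pderiv (\<Prod>a\<in>A. [:- a, 1:] ^ e a) = Z * M"
  proof -
    have "(\<Prod>b\<in>A - {a}. [:- b, 1:] ^ e b) * pderiv ([:- a, 1:] ^ e a) = Z * smult (of_nat (e a)) (N a)"
      if a: "a \<in> A" for a
    proof -
      have "(\<Prod>b\<in>A - {a}. [:- b, 1:] ^ e b) = (\<Prod>b\<in>A - {a}. [:- b, 1:] ^ (e b - 1)) * N a"
        unfolding N_def using pow by (simp flip: prod.distrib)
      moreover have "Z = [:- a, 1:] ^ (e a - 1) * (\<Prod>b\<in>A - {a}. [:- b, 1:] ^ (e b - 1))"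
        unfolding Z_def using A(1) a by (rule prod.remove)
      moreover have "pderiv ([:- a, 1:] ^ e a) = smult (of_nat (e a)) ([:- a, 1:] ^ (e a - 1))"
        by (simp add: pderiv_power pderiv_pCons)
      ultimately show ?thesis by (simp add: mult_ac)
    qed
    then show ?thesis
      by (simp add: pderiv_prod M_def sum_distrib_left)
  qed
  then have W: "wronskian h q = Z * T"
    unfolding wronskian_def hk pderiv_mult T_def ZR by (simp add: algebra_simps)
  have R0: "poly R a = 0" if "a \<in> A" for a
    using that A(1) by (auto simp: R_def poly_prod)
  have Ma: "poly M a = of_nat (e a) * (\<Prod>b\<in>A - {a}. a - b)" if "a \<in> A" for a
  proof -
    have "poly (N c) a = 0" if "c \<in> A - {a}" for c
      using that \<open>a \<in> A\<close> A(1) by (auto simp: N_def poly_prod)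
    then have "(\<Sum>c\<in>A - {a}. of_nat (e c) * poly (N c) a) = 0"
      by (intro sum.neutral) auto
    then have "poly M a = of_nat (e a) * poly (N a) a"
      unfolding M_def poly_sum using A(1) that by (subst sum.remove[of _ a]) auto
    then show ?thesis by (simp add: N_def poly_prod)
  qed
  have "\<exists>s. v s < 1 \<and> poly T s = 0"
  proof (rule ccontr)
    assume "\<nexists>s. v s < 1 \<and> poly T s = 0"
    then have const: "v (poly T z) = v (poly T 0)" if "v z < 1" for z
      using no_root_open_disc[of T z] that by blast
    define r where "r = card (A - {0})"
    have r: "r > 0"
      unfolding r_def using A0 t(1) A(1) by (subst card_gt_0_iff) auto
    have cardA: "card (A - {a}) = r" if "a \<in> A" for a
      using that A0(1) A(1) by (simp add: r_def card_Diff_singleton)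
    have "Max (v ` (A - {0})) \<in> v ` (A - {0})"
      using A0 t(1) A(1) by (intro Max_in) auto
    then obtain b where b: "b \<in> A - {0}" "Max (v ` (A - {0})) = v b" by auto
    have bmax: "v a \<le> v b" if "a \<in> A" for a
    proof (cases "a = 0")
      case False
      then have "v a \<le> Max (v ` (A - {0}))"
        using that A(1) by (intro Max_ge) auto
      then show ?thesis by (simp add: b(2))
    qed simp
    \<comment> \<open>z is farther from 0 than all roots in \<open>A\<close> but still in the disc,
      so v (z - a) = v z for each of them.\<close>
    obtain z where z: "v b < v z" "v z < 1"
      using sqrt_exists[of b] b(1) A(2)[of b] by auto
    have za: "v a < v z" if "a \<in> A" for a
      using bmax[OF that] z(1) by simp
    have vz: "v z > 0"
      using z(1) nonneg[of b] by linarith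
    then have z0: "z \<noteq> 0" by simp
    have vk: "v (poly k z) = v (poly k 0)" "v (poly (pderiv k) z) \<le> v (poly k 0)"
      using no_root_open_disc[OF k z(2)] by auto
    have k0: "v (poly k 0) > 0" using k[of 0] by simp
    define n where "n = sum e A"
    have n: "0 < n" "n \<le> degree h"
      using A0(1) A se by (auto simp: n_def intro!: sum_pos)
    \<comment> \<open>Each product in \<open>M\<close> is z^r up to a smaller error, so
      \<open>M\<close> has leading term n * z^r with n the total multiplicity, a unit by
      \<open>tame\<close>.\<close>
    have "v (poly M z - of_nat n * z ^ r) < v z ^ r"
    proof -
      have "poly M z - of_nat n * z ^ r = (\<Sum>a\<in>A. of_nat (e a) * ((\<Prod>b\<in>A - {a}. z - b) - z ^ r))"
        by (simp add: M_def N_def poly_sum poly_prod n_def sum_distrib_right right_diff_distrib sum_subtractf)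
      also have "v \<dots> < v z ^ r"
      proof (rule sum_less_bound)
        fix a assume a: "a \<in> A"
        have *: "v ((\<Prod>b\<in>A - {a}. z - b) - z ^ r) < v z ^ r"
          using prod_diff_less[of "A - {a}" z] A(1) za z0 cardA[OF a] by simp
        have "v (of_nat (e a)) * v ((\<Prod>b\<in>A - {a}. z - b) - z ^ r) \<le>
            1 * v ((\<Prod>b\<in>A - {a}. z - b) - z ^ r)"
          by (intro mult_right_mono of_nat_le_1) simp
        with * show "v (of_nat (e a) * ((\<Prod>b\<in>A - {a}. z - b) - z ^ r)) < v z ^ r"
          by (simp add: mult)
      qed (use vz in simp)
      finally show ?thesis .
    qed
    moreover have "v (of_nat n * z ^ r) = v z ^ r"
      using tame[OF n] by (simp add: mult power)
    ultimately have vM: "v (poly M z) = v z ^ r"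
      using add_eq[of "poly M z - of_nat n * z ^ r" "of_nat n * z ^ r"] by simp
    \<comment> \<open>\<open>R\<close> has one factor more than the products in \<open>M\<close>. As
      v z < 1, the summand of \<open>T\<close> containing derivatives is negligible.\<close>
    have vR: "v (poly R z) = v z ^ Suc r"
    proof -
      have "v (poly R z) = (\<Prod>a\<in>A. v z)"
        unfolding R_def poly_prod prod using za by (intro prod.cong) (auto simp: diff_eq)
      also have "card A = Suc r"
        using A0(1) A(1) by (simp add: r_def card_Diff_singleton card_gt_0_iff) (metis card_gt_0_iff Suc_pred empty_iff)
      then have "(\<Prod>a\<in>A. v z) = v z ^ Suc r" by simp
      finally show ?thesis .
    qed
    have "v (poly (pderiv k) z * poly q z - poly k z * poly (pderiv q) z) \<le> v (poly k 0)"
    proof (rule diff_le)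
      show "v (poly (pderiv k) z * poly q z) \<le> v (poly k 0)"
        using vk q(1)[OF z(2)] by (simp add: mult)
      have "v (poly k 0) * v (poly (pderiv q) z) \<le> v (poly k 0) * 1"
        using q(2)[OF z(2)] by (intro mult_left_mono) auto
      then show "v (poly k z * poly (pderiv q) z) \<le> v (poly k 0)"
        by (simp add: mult vk)
    qed
    then have "v (poly (R * (pderiv k * q - k * pderiv q)) z) \<le> v z ^ Suc r * v (poly k 0)"
      using vz by (simp add: mult vR mult_left_mono)
    also have "\<dots> < v z ^ r * v (poly k 0)"
      using z(2) vz k0 by simp
    also have main: "v z ^ r * v (poly k 0) = v (poly (M * k * q) z)"
      using vM vk q(1)[OF z(2)] by (simp add: mult)
    finally have Tz: "v (poly T z) = v z ^ r * v (poly k 0)"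
      unfolding T_def poly_add using add_eq main by simp
    \<comment> \<open>At 0 the factor \<open>R\<close> vanishes and a single product of
      \<open>M\<close> survives; its r factors are all smaller than v z.\<close>
    have "v (poly T 0) = v (of_nat (e 0)) * (\<Prod>b\<in>A - {0}. v b) * v (poly k 0)"
      using q(1)[of 0] by (simp add: T_def R0[OF A0(1)] Ma[OF A0(1)] mult prod)
    also have "\<dots> \<le> 1 * (\<Prod>b\<in>A - {0}. v b) * v (poly k 0)"
      by (intro mult_right_mono of_nat_le_1 prod_nonneg) auto
    also have "\<dots> < v z ^ r * v (poly k 0)"
    proof -
      have "(\<Prod>b\<in>A - {0}. v b) < (\<Prod>b\<in>A - {0}. v z)"
        using za A(1) b(1) by (intro prod_mono_strict[of b]) (auto simp: less_imp_le vz z0)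
      then show ?thesis using k0 by (simp add: r_def)
    qed
    finally show False using Tz const[OF z(2)] by simp
  qed
  then obtain s where s: "v s < 1" "poly T s = 0" by blast
  \<comment> \<open>At a root of h in the disc one product of \<open>M\<close> survives and makes
    \<open>T\<close> nonzero. Hence s is no root of h, which will make the image of the ramification
    point different.\<close>
  have "poly h s \<noteq> 0"
  proof
    assume "poly h s = 0"
    then have sA: "s \<in> A" using mem s(1) by blast
    have "poly T s = of_nat (e s) * (\<Prod>b\<in>A - {s}. s - b) * poly k s * poly q s"
      by (simp add: T_def R0[OF sA] Ma[OF sA])
    moreover have "poly q s \<noteq> 0" using q(1)[OF s(1)] by auto
    moreover have "(\<Prod>b\<in>A - {s}. s - b) \<noteq> 0" using A(1) by simp
    ultimately show False
      using s A(2)[OF sA] k[OF s(1)] by simp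
  qed
  with s W show ?thesis by auto
qed

end

section \<open>Reduction of points\<close>

context nonarch_absval
begin

text \<open>\<open>near P Q\<close> says that \<open>P\<close> and \<open>Q\<close> have the same reduction.\<close>

definition near :: "'a proj_line \<Rightarrow> 'a proj_line \<Rightarrow> bool" where
  "near P Q \<longleftrightarrow> (\<exists>x y x' y'. P = hpt x y \<and> Q = hpt x' y' \<and> max (v x) (v y) = 1 \<and>
    max (v x') (v y') = 1 \<and> v (x - x') < 1 \<and> v (y - y') < 1)"

lemma nearI:
  "max (v x) (v y) = 1 \<Longrightarrow> max (v x') (v y') = 1 \<Longrightarrow> v (x - x') < 1 \<Longrightarrow> v (y - y') < 1 \<Longrightarrow>
    near (hpt x y) (hpt x' y')"
  unfolding near_def by blast

lemma near_sym: "near P Q \<Longrightarrow> near Q P"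
  unfolding near_def by (metis diff_commute)

lemma normalized_nonzero: "max (v x) (v y) = 1 \<Longrightarrow> (x, y) \<noteq> (0, 0)"
  by auto

lemma normalized_le: "max (v x) (v y) = 1 \<Longrightarrow> v x \<le> 1" "max (v x) (v y) = 1 \<Longrightarrow> v y \<le> 1"
  by linarith+

lemma normalized_cases: "max (v x) (v y) = 1 \<Longrightarrow> v x = 1 \<or> v y = 1"
  by linarith

text \<open>Divide by the larger coordinate. The form of the factor is recorded so that normalized
  coordinates stay in a given subfield.\<close>

lemma normalize_point:
  assumes "(x, y) \<noteq> (0, 0)"
  obtains c where "c \<in> {inverse x, inverse y}" "max (v (c * x)) (v (c * y)) = 1"
    "hpt x y = hpt (c * x) (c * y)"
proof -
  have *: "hpt x y = hpt (c * x) (c * y)" if "c \<noteq> 0" for c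
    using that assms by (simp add: hpt_eq_iff_cross)
  have "x \<noteq> 0" if "v y \<le> v x"
    using that assms nonneg[of y] eq_0_iff[of y] by fastforce
  moreover have "y \<noteq> 0" if "v x \<le> v y"
    using that assms nonneg[of x] eq_0_iff[of x] by fastforce
  ultimately consider "v y \<le> v x" "x \<noteq> 0" | "v x \<le> v y" "y \<noteq> 0"
    by linarith
  then show thesis
  proof cases
    case 1
    then have "v (inverse x * y) \<le> 1"
      by (simp only: mult inverse) (simp add: field_simps)
    then have "max (v (inverse x * x)) (v (inverse x * y)) = 1"
      using 1 by simp
    then show thesis
      using 1 by (intro that[of "inverse x"] *) simp_all
  next
    case 2
    then have "v (inverse y * x) \<le> 1"
      by (simp only: mult inverse) (simp add: field_simps)
    then have "max (v (inverse y * x)) (v (inverse y * y)) = 1"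
      using 2 by simp
    then show thesis
      using 2 by (intro that[of "inverse y"] *) simp_all
  qed
qed

lemma near_if_reduction_eq:
  assumes "reduction v P = reduction v Q"
  shows "near P Q"
proof -
  obtain a b where "(a, b) \<noteq> (0, 0)" "P = hpt a b" by (rule hpt_cases)
  then obtain x y where xy: "P = hpt x y" "max (v x) (v y) = 1"
    by (metis normalize_point)
  then have "(residue_class v x, residue_class v y) \<in> reduction v P"
    unfolding reduction_def by blast
  then have "(residue_class v x, residue_class v y) \<in> reduction v Q"
    by (simp add: assms)
  then obtain x' y' where "residue_class v x = residue_class v x'" "residue_class v y = residue_class v y'"
      "max (v x') (v y') = 1" "Q = hpt x' y'"
    unfolding reduction_def by blast
  then show ?thesis
    using xy by (auto simp: residue_class_eq_iff intro: nearI)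
qed

lemma reduction_eqI:
  assumes "max (v x) (v y) = 1" "max (v x') (v y') = 1"
    and "residue_class v x = residue_class v x'" "residue_class v y = residue_class v y'"
  shows "reduction v (hpt x y) = reduction v (hpt x' y')"
proof -
  have *: "residue_class v (u * z) = residue_class v (u * z')"
    if "v u = 1" "residue_class v z = residue_class v z'" for u z z'
    using that unfolding residue_class_eq_iff right_diff_distrib[symmetric] mult by simp
  have "(\<lambda>u. (residue_class v (u * x), residue_class v (u * y))) ` {u. v u = 1} =
      (\<lambda>u. (residue_class v (u * x'), residue_class v (u * y'))) ` {u. v u = 1}"
    using *[OF _ assms(3)] *[OF _ assms(4)] by (intro image_cong) auto
  then show ?thesis
    unfolding reduction_hpt[OF absolute_value assms(1)] reduction_hpt[OF absolute_value assms(2)]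
    by (simp add: setcompr_eq_image)
qed

lemma power_diff_less_1:
  assumes "v x \<le> 1" "v x' \<le> 1" "v (x - x') < 1"
  shows "v (x ^ n - x' ^ n) < 1"
proof (induction n)
  case (Suc n)
  have "x ^ Suc n - x' ^ Suc n = (x - x') * x ^ n + (x ^ n - x' ^ n) * x'"
    by (simp add: algebra_simps)
  also have "v \<dots> < 1"
    using Suc assms by (intro add_less mult_less_1 power_le_1)
  finally show ?case .
qed simp

lemma form_eval_diff_less_1:
  assumes "\<And>i. v (coeff h i) \<le> 1" "v x \<le> 1" "v y \<le> 1" "v x' \<le> 1" "v y' \<le> 1"
    and "v (x - x') < 1" "v (y - y') < 1"
  shows "v (form_eval d h x y - form_eval d h x' y') < 1"
proof -
  have "form_eval d h x y - form_eval d h x' y' =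
      (\<Sum>i\<le>d. ((x ^ i - x' ^ i) * y ^ (d - i) + (y ^ (d - i) - y' ^ (d - i)) * x' ^ i) * coeff h i)"
    unfolding form_eval_def by (simp add: algebra_simps flip: sum_subtractf)
  also have "v \<dots> < 1"
    using assms by (intro sum_less_bound mult_less_1 add_less power_le_1 power_diff_less_1) auto
  finally show ?thesis .
qed

text \<open>If v a = 1, scale the first coordinate of Q to a and move in direction (0, 1); if v b =
  1, move in direction (1, 0). The unit coordinate stays fixed, so points remain normalized along
  the disc, which serves as a chart around P.\<close>

lemma near_line:
  assumes "near P Q" "P \<noteq> Q"
  obtains a b u w t where "P = hpt a b" "Q = hpt (a + t * u) (b + t * w)" "v a \<le> 1" "v b \<le> 1"
    "v u \<le> 1" "v w \<le> 1" "u * b - a * w \<noteq> 0" "t \<noteq> 0" "v t < 1"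
    "\<And>s. v s < 1 \<Longrightarrow> max (v (a + s * u)) (v (b + s * w)) = 1"
proof -
  obtain a b a' b' where P: "P = hpt a b" and Q: "Q = hpt a' b'" and ab: "max (v a) (v b) = 1"
    and ab': "max (v a') (v b') = 1" and near: "v (a - a') < 1" "v (b - b') < 1"
    using assms(1) unfolding near_def by blast
  have le: "v a \<le> 1" "v b \<le> 1" "v a' \<le> 1" "v b' \<le> 1"
    using normalized_le[OF ab] normalized_le[OF ab'] by auto
  have shift: "\<exists>t. t \<noteq> 0 \<and> v t < 1 \<and> x' * (y + t) = x * y'"
    if "v x = 1" "v (x - x') < 1" "v (y' * x - y * x') < 1" "y' * x - y * x' \<noteq> 0" for x x' y y'
  proof -
    have x': "v x' = 1"
      using diff_eq[of "x - x'" x] that(1,2) by simp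
    then have "x' * (y + (y' * x - y * x') / x') = x * y'"
      by (auto simp: distrib_left)
    with x' show ?thesis
      using that(3,4) by (intro exI[of _ "(y' * x - y * x') / x'"]) (auto simp: divide)
  qed
  have cross: "v (b' * a - b * a') < 1"
  proof -
    have "b' * a - b * a' = (a - a') * b - (b - b') * a"
      by (simp add: algebra_simps)
    also have "v \<dots> < 1"
      by (rule diff_less[OF mult_less_1[OF near(1) le(2)] mult_less_1[OF near(2) le(1)]])
    finally show ?thesis .
  qed
  have cross0: "b' * a - b * a' \<noteq> 0"
    using assms(2) hpt_eq_iff_cross[OF normalized_nonzero[OF ab] normalized_nonzero[OF ab']]
    by (auto simp: P Q mult.commute)
  from normalized_cases[OF ab] show thesis
  proof
    assume a: "v a = 1"
    then obtain t where t: "t \<noteq> 0" "v t < 1" "a' * (b + t) = a * b'"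
      using shift[of a a' b' b] near(1) cross cross0 by (auto simp: mult.commute)
    have Q': "Q = hpt (a + t * 0) (b + t * 1)"
      unfolding Q using a t(3) normalized_nonzero[OF ab']
      by (subst hpt_eq_iff_cross) (auto simp: mult.commute)
    show thesis
    proof (rule that[OF P Q' le(1,2) _ _ _ t(1,2)])
      show "max (v (a + s * 0)) (v (b + s * 1)) = 1" if "v s < 1" for s
        using a add_le[of b 1 s] le that by simp
    qed (use a in auto)
  next
    assume b: "v b = 1"
    then obtain t where t: "t \<noteq> 0" "v t < 1" "b' * (a + t) = b * a'"
      using shift[of b b' a' a] near(2) cross cross0 by (auto simp: mult.commute diff_commute)
    have Q': "Q = hpt (a + t * 1) (b + t * 0)"
      unfolding Q using b t(3) normalized_nonzero[OF ab']
      by (subst hpt_eq_iff_cross) (auto simp: mult.commute)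
    show thesis
    proof (rule that[OF P Q' le(1,2) _ _ _ t(1,2)])
      show "max (v (a + s * 1)) (v (b + s * 0)) = 1" if "v s < 1" for s
        using b add_le[of a 1 s] le that by simp
    qed (use b in auto)
  qed
qed

end

text \<open>\<open>good\<close> says that the reduced forms have no common zero, so \<Phi> is
  compatible with reduction; \<open>tame\<close> supplies the units for the Rolle argument.\<close>

locale good_reduction = nonarch_absval_closed v
  for v :: "'a :: {alg_closed_field, field_char_0, field_gcd} \<Rightarrow> real" +
  fixes d :: nat and f g :: "'a poly" and \<Phi> :: "'a proj_line \<Rightarrow> 'a proj_line"
  assumes lift: "has_lift d f g \<Phi>" and d_pos: "d > 0"
    and coeff_le: "\<And>i. v (coeff f i) \<le> 1" "\<And>i. v (coeff g i) \<le> 1"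
    and good: "\<And>x y. max (v x) (v y) = 1 \<Longrightarrow> max (v (form_eval d f x y)) (v (form_eval d g x y)) = 1"
    and tame: "\<And>n. 0 < n \<Longrightarrow> n \<le> d \<Longrightarrow> v (of_nat n) = 1"
begin

lemma apply_hpt:
  "max (v x) (v y) = 1 \<Longrightarrow> \<Phi> (hpt x y) = hpt (form_eval d f x y) (form_eval d g x y)"
  using lift normalized_nonzero[of x y] unfolding has_lift_iff by blast

lemma near_apply:
  assumes "near P Q"
  shows "near (\<Phi> P) (\<Phi> Q)"
proof -
  obtain x y x' y' where P: "P = hpt x y" "max (v x) (v y) = 1" and Q: "Q = hpt x' y'" "max (v x') (v y') = 1"
    and near: "v (x - x') < 1" "v (y - y') < 1"
    using assms unfolding near_def by blast
  show ?thesis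
    unfolding P(1) Q(1) apply_hpt[OF P(2)] apply_hpt[OF Q(2)]
    using normalized_le[OF P(2)] normalized_le[OF Q(2)] near coeff_le
    by (intro nearI good P Q form_eval_diff_less_1)
qed

lemma near_funpow: "near P Q \<Longrightarrow> near ((\<Phi> ^^ n) P) ((\<Phi> ^^ n) Q)"
  by (induction n) (auto intro: near_apply)

lemma line_derivative_le:
  assumes "v x \<le> 1" "v y \<le> 1" "v u \<le> 1" "v w \<le> 1" "\<And>i. v (coeff h i) \<le> 1"
  shows "v (form_X d h x y * u + form_Y d h x y * w) \<le> 1"
  unfolding form_X_def form_Y_def using assms
  by (intro add_le mult_le_1 sum_le_bound power_le_1 of_nat_le_1) auto

text \<open>In a parameter s around A the map is [p(s) : q(s)], and the fibre of
  \<open>\<Phi> A\<close> is the zero set of h = q(0) p - p(0) q, with roots 0 and t.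
  \<open>wronskian_root\<close> gives a zero of the Wronskian outside this fibre.\<close>

lemma ramification_between:
  assumes near: "near A B" and ne: "A \<noteq> B" and eq: "\<Phi> A = \<Phi> B"
  shows "\<exists>R\<in>ramification_points \<Phi>. near A R \<and> \<Phi> R \<noteq> \<Phi> A"
proof -
  obtain a b u w t where A: "A = hpt a b" and B: "B = hpt (a + t * u) (b + t * w)"
    and le: "v a \<le> 1" "v b \<le> 1" "v u \<le> 1" "v w \<le> 1" and det: "u * b - a * w \<noteq> 0"
    and t: "t \<noteq> 0" "v t < 1" and norm: "\<And>s. v s < 1 \<Longrightarrow> max (v (a + s * u)) (v (b + s * w)) = 1"
    using near_line[OF near ne] by metis
  define l m where "l = [:a, u:]" and "m = [:b, w:]"
  define p q where "p = form_comp d f l m" and "q = form_comp d g l m"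
  have lm: "poly l s = a + s * u" "poly m s = b + s * w" for s
    by (simp_all add: l_def m_def)
  have pq: "poly p s = form_eval d f (a + s * u) (b + s * w)"
      "poly q s = form_eval d g (a + s * u) (b + s * w)" for s
    by (simp_all add: p_def q_def poly_form_comp lm)
  have deg: "degree p \<le> d" "degree q \<le> d"
    unfolding p_def q_def using degree_form_comp[of l 1 m d] by (auto simp: l_def m_def)
  have norm_le: "v (a + s * u) \<le> 1" "v (b + s * w) \<le> 1" if "v s < 1" for s
    using normalized_le[OF norm[OF that]] by auto
  have \<Phi>: "\<Phi> (hpt (a + s * u) (b + s * w)) = hpt (poly p s) (poly q s)"
      "max (v (poly p s)) (v (poly q s)) = 1" if "v s < 1" for s
    using apply_hpt[OF norm[OF that]] good[OF norm[OF that]] by (simp_all add: pq)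
  have deriv: "v (poly (pderiv p) s) \<le> 1" "v (poly (pderiv q) s) \<le> 1" if "v s < 1" for s
    unfolding p_def q_def pderiv_form_comp lm using norm_le[OF that] le coeff_le
    by (auto simp: l_def m_def pderiv_pCons intro!: line_derivative_le)
  have less: "v (poly p s - poly p 0) < 1" "v (poly q s - poly q 0) < 1" if "v s < 1" for s
  proof -
    have "v (s * u) < 1" "v (s * w) < 1"
      using that le by (auto intro: mult_less_1)
    then show "v (poly p s - poly p 0) < 1" "v (poly q s - poly q 0) < 1"
      unfolding pq using norm_le[OF that] le coeff_le
      by (auto intro!: form_eval_diff_less_1)
  qed
  have unit: "v (poly r s) = 1" if "v (poly r 0) = 1" "v (poly r s - poly r 0) < 1" for r s
    using add_eq[of "poly r s - poly r 0" "poly r 0"] that by simp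
  define h where "h = smult (poly q 0) p - smult (poly p 0) q"
  have deg_h: "degree h \<le> d"
    unfolding h_def using deg by (intro degree_diff_le) (auto intro: order.trans[OF degree_smult_le])
  have fiber: "\<Phi> (hpt (a + s * u) (b + s * w)) = \<Phi> A \<longleftrightarrow> poly h s = 0" if "v s < 1" for s
    using \<Phi>[OF that] \<Phi>[of 0] normalized_nonzero
    by (simp add: A hpt_eq_iff_cross h_def mult.commute)
  have roots: "poly h 0 = 0" "poly h t = 0"
    using fiber[OF t(2)] eq B by (simp_all add: h_def)
  have W: "of_nat d * poly (wronskian p q) s = jacobian d f g (a + s * u) (b + s * w) * (u * b - a * w)" for s
    using wronskian_form_comp[of d f l m g s]
    by (simp add: p_def q_def lm wronskian_def l_def m_def pderiv_pCons algebra_simps)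
  have ram: "hpt (a + s * u) (b + s * w) \<in> ramification_points \<Phi>"
    if "v s < 1" "poly (wronskian p q) s = 0" for s
    using ramification_points_iff[OF lift d_pos normalized_nonzero[OF norm[OF that(1)]]] W[of s] det that(2)
    by simp
  \<comment> \<open>The line misses the origin, so it meets every direction [x : 1] except possibly
    one. If h vanished, the nonzero fibre form k would vanish at almost all points.\<close>
  have h0: "h \<noteq> 0"
  proof
    assume "h = 0"
    define k where "k = smult (poly q 0) f - smult (poly p 0) g"
    have "(poly p 0, poly q 0) \<noteq> (0, 0)"
      using \<Phi>(2)[of 0] by auto
    then have "k \<noteq> 0"
      unfolding k_def using lift d_pos
      by (intro lift_combination_nonzero) (auto simp: has_lift_def)
    have "degree k \<le> d"
      unfolding k_def by (rule degree_lift_combination[OF lift])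
    have "poly k x = 0" if x: "u - x * w \<noteq> 0" for x
    proof -
      define s where "s = (x * b - a) / (u - x * w)"
      have eq: "a + s * u = x * (b + s * w)"
        using x by (simp add: s_def field_simps)
      have "b + s * w \<noteq> 0"
      proof
        assume 0: "b + s * w = 0"
        with eq have "a + s * u = 0" by simp
        with 0 have "a = - (s * u)" "b = - (s * w)" by (simp_all add: eq_neg_iff_add_eq_0)
        with det show False by simp
      qed
      moreover have "form_eval d k (x * (b + s * w)) (b + s * w) = 0"
        using arg_cong[OF \<open>h = 0\<close>[unfolded h_def], of "\<lambda>h. poly h s"]
        by (simp add: k_def form_eval_diff form_eval_smult pq flip: eq)
      ultimately show ?thesis
        using \<open>degree k \<le> d\<close> by (simp add: form_eval_nonzero)
    qed
    then have "UNIV \<subseteq> {x. poly k x = 0} \<union> {x. poly [:u, - w:] x = 0}"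
      by auto
    moreover have "[:u, - w:] \<noteq> 0" using det by auto
    ultimately have "finite (UNIV :: 'a set)"
      using poly_roots_finite[OF \<open>k \<noteq> 0\<close>] poly_roots_finite[of "[:u, - w:]"]
      by (meson finite_Un finite_subset)
    then show False by (simp add: infinite_UNIV_char_0)
  qed
  have tame': "v (of_nat n) = 1" if "0 < n" "n \<le> degree h" for n
    using tame that deg_h by simp
  \<comment> \<open>One of p(0), q(0) is a unit, hence the same polynomial is a unit on the whole
    disc and can be the \<open>q\<close> of \<open>wronskian_root\<close>. Replacing the other
    polynomial by h changes the Wronskian by a nonzero constant.\<close>
  have "\<exists>s. v s < 1 \<and> poly h s \<noteq> 0 \<and> poly (wronskian p q) s = 0"
  proof -
    have "max (v (poly p 0)) (v (poly q 0)) = 1"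
      using \<Phi>(2)[of 0] by simp
    from normalized_cases[OF this] show ?thesis
    proof
      assume "v (poly q 0) = 1"
      then have "\<exists>s. v s < 1 \<and> poly h s \<noteq> 0 \<and> poly (wronskian h q) s = 0"
        using unit less(2) deriv(2) by (intro wronskian_root[OF h0 roots t tame']) auto
      moreover have "wronskian h q = smult (poly q 0) (wronskian p q)"
        by (simp add: wronskian_def h_def pderiv_diff pderiv_smult algebra_simps smult_diff_right)
      moreover have "poly q 0 \<noteq> 0" using \<open>v (poly q 0) = 1\<close> by auto
      ultimately show ?thesis by auto
    next
      assume "v (poly p 0) = 1"
      then have "\<exists>s. v s < 1 \<and> poly h s \<noteq> 0 \<and> poly (wronskian h p) s = 0"
        using unit less(1) deriv(1) by (intro wronskian_root[OF h0 roots t tame']) auto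
      moreover have "wronskian h p = smult (poly p 0) (wronskian p q)"
        by (simp add: wronskian_def h_def pderiv_diff pderiv_smult algebra_simps smult_diff_right)
      moreover have "poly p 0 \<noteq> 0" using \<open>v (poly p 0) = 1\<close> by auto
      ultimately show ?thesis by auto
    qed
  qed
  then obtain s where s: "v s < 1" "poly h s \<noteq> 0" "poly (wronskian p q) s = 0" by blast
  have "near A (hpt (a + s * u) (b + s * w))"
    unfolding A using norm[of 0] norm[OF s(1)] mult_less_1[OF s(1)] le
    by (intro nearI) auto
  with s fiber[OF s(1)] ram[OF s(1,3)] show ?thesis by blast
qed

end

section \<open>Postcritical points\<close>

definition postcritical_points :: "('a :: field proj_line \<Rightarrow> 'a proj_line) \<Rightarrow> 'a proj_line set" where
  "postcritical_points \<Phi> = {(\<Phi> ^^ i) R | R i. R \<in> ramification_points \<Phi> \<and> i \<ge> 1}"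

lemma postcritical_pointsI: "R \<in> ramification_points \<Phi> \<Longrightarrow> i \<ge> 1 \<Longrightarrow> (\<Phi> ^^ i) R \<in> postcritical_points \<Phi>"
  unfolding postcritical_points_def by blast

lemma apply_postcritical: "P \<in> postcritical_points \<Phi> \<Longrightarrow> \<Phi> P \<in> postcritical_points \<Phi>"
  unfolding postcritical_points_def by (force intro: exI[of _ "Suc _"])

lemma funpow_postcritical: "P \<in> postcritical_points \<Phi> \<Longrightarrow> (\<Phi> ^^ n) P \<in> postcritical_points \<Phi>"
  by (induction n) (auto intro: apply_postcritical)

lemma finite_orbit:
  assumes "P \<in> preperiodic_points \<Phi>"
  shows "finite (range (\<lambda>i. (\<Phi> ^^ i) P))"
proof -
  obtain m n where mn: "n \<ge> 1" "(\<Phi> ^^ (m + n)) P = (\<Phi> ^^ m) P"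
    using assms by (auto simp: preperiodic_points_def)
  have "\<exists>j<m + n. (\<Phi> ^^ i) P = (\<Phi> ^^ j) P" for i
  proof (induction i rule: less_induct)
    case (less i)
    show ?case
    proof (cases "i < m + n")
      case False
      then have "(\<Phi> ^^ i) P = (\<Phi> ^^ (i - (m + n))) ((\<Phi> ^^ (m + n)) P)"
        by (simp flip: funpow_add[unfolded o_def, THEN fun_cong])
      also have "\<dots> = (\<Phi> ^^ (i - n)) P"
        unfolding mn(2) using False by (simp flip: funpow_add[unfolded o_def, THEN fun_cong])
      finally show ?thesis
        using less[of "i - n"] mn(1) False by auto
    qed auto
  qed
  then have "range (\<lambda>i. (\<Phi> ^^ i) P) \<subseteq> (\<lambda>i. (\<Phi> ^^ i) P) ` {..<m + n}"
    by fastforce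
  then show ?thesis by (rule finite_subset) simp
qed

lemma finite_postcritical_points:
  assumes "finite (ramification_points \<Phi>)" "ramification_points \<Phi> \<subseteq> preperiodic_points \<Phi>"
  shows "finite (postcritical_points \<Phi>)"
proof -
  have "postcritical_points \<Phi> \<subseteq> (\<Union>R\<in>ramification_points \<Phi>. range (\<lambda>i. (\<Phi> ^^ i) R))"
    by (auto simp: postcritical_points_def)
  moreover have "finite (\<Union>R\<in>ramification_points \<Phi>. range (\<lambda>i. (\<Phi> ^^ i) R))"
  proof (rule finite_UN_I[OF assms(1)])
    fix R assume "R \<in> ramification_points \<Phi>"
    then show "finite (range (\<lambda>i. (\<Phi> ^^ i) R))"
      using assms(2) by (intro finite_orbit) auto
  qed
  ultimately show ?thesis by (rule finite_subset)
qed

lemma first_collision: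
  assumes "P \<noteq> Q" "(\<Phi> ^^ n) P = (\<Phi> ^^ n) Q"
  shows "\<exists>m<n. (\<Phi> ^^ m) P \<noteq> (\<Phi> ^^ m) Q \<and> \<Phi> ((\<Phi> ^^ m) P) = \<Phi> ((\<Phi> ^^ m) Q)"
  using assms
proof (induction n)
  case (Suc n)
  then show ?case
    by (cases "(\<Phi> ^^ n) P = (\<Phi> ^^ n) Q") (auto intro: less_SucI)
qed simp

section \<open>Iterates at a place of good reduction\<close>

context good_reduction
begin

lemma ramified_funpow_postcritical:
  assumes "P \<in> ramification_points (\<Phi> ^^ n)"
  shows "(\<Phi> ^^ n) P \<in> postcritical_points \<Phi>"
proof -
  obtain i where i: "i < n" "(\<Phi> ^^ i) P \<in> ramification_points \<Phi>"
    using assms ramification_points_funpow[OF lift d_pos] by auto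
  then have "(\<Phi> ^^ (n - i)) ((\<Phi> ^^ i) P) \<in> postcritical_points \<Phi>"
    by (intro postcritical_pointsI) auto
  also have "(\<Phi> ^^ (n - i)) ((\<Phi> ^^ i) P) = (\<Phi> ^^ n) P"
    using i(1) funpow_add[of "n - i" i \<Phi>] by simp
  finally show ?thesis .
qed

context
  assumes separated: "\<And>P Q. P \<in> postcritical_points \<Phi> \<Longrightarrow> Q \<in> postcritical_points \<Phi> \<Longrightarrow> near P Q \<Longrightarrow> P = Q"
begin

lemma no_collision_postcritical:
  assumes "near A B" "A \<noteq> B" "\<Phi> A = \<Phi> B" "\<Phi> A \<in> postcritical_points \<Phi>"
  shows False
proof -
  obtain R where R: "R \<in> ramification_points \<Phi>" "near A R" "\<Phi> R \<noteq> \<Phi> A"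
    using ramification_between[OF assms(1-3)] by blast
  have "\<Phi> R \<in> postcritical_points \<Phi>"
    using postcritical_pointsI[OF R(1), of 1] by simp
  then show False
    using separated[OF assms(4) _ near_apply[OF R(2)]] R(3) by simp
qed

lemma no_collision:
  assumes "near A B" "A \<noteq> B" "\<Phi> A = \<Phi> B" and k: "(\<Phi> ^^ k) (\<Phi> A) \<in> postcritical_points \<Phi>"
  shows False
proof -
  obtain R where R: "R \<in> ramification_points \<Phi>" "near A R" "\<Phi> R \<noteq> \<Phi> A"
    using ramification_between[OF assms(1-3)] by blast
  have RC: "\<Phi> R \<in> postcritical_points \<Phi>"
    using postcritical_pointsI[OF R(1), of 1] by simp
  have near: "near (\<Phi> R) (\<Phi> A)" by (rule near_apply[OF near_sym[OF R(2)]])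
  have "(\<Phi> ^^ k) (\<Phi> R) = (\<Phi> ^^ k) (\<Phi> A)"
    by (rule separated[OF funpow_postcritical[OF RC] k near_funpow[OF near]])
  from first_collision[OF R(3) this] obtain m
    where m: "(\<Phi> ^^ m) (\<Phi> R) \<noteq> (\<Phi> ^^ m) (\<Phi> A)"
      "\<Phi> ((\<Phi> ^^ m) (\<Phi> R)) = \<Phi> ((\<Phi> ^^ m) (\<Phi> A))"
    by blast
  \<comment> \<open>The merging point is on the orbit of \<open>\<Phi> R\<close>, hence
    postcritical, and the simpler case applies to the two orbit points just before it.\<close>
  show False
    by (rule no_collision_postcritical[OF near_funpow[OF near] m])
      (rule apply_postcritical[OF funpow_postcritical[OF RC]])
qed

lemma critically_good_funpow: "critically_good_at v (\<Phi> ^^ n)"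
  unfolding critically_good_at_def
proof (intro conjI inj_onI)
  fix P Q assume "P \<in> (\<Phi> ^^ n) ` ramification_points (\<Phi> ^^ n)"
    "Q \<in> (\<Phi> ^^ n) ` ramification_points (\<Phi> ^^ n)" and red: "reduction v P = reduction v Q"
  then have "P \<in> postcritical_points \<Phi>" "Q \<in> postcritical_points \<Phi>"
    by (auto intro: ramified_funpow_postcritical)
  then show "P = Q"
    using near_if_reduction_eq[OF red] by (rule separated)
next
  fix P Q assume P: "P \<in> ramification_points (\<Phi> ^^ n)" and Q: "Q \<in> ramification_points (\<Phi> ^^ n)"
    and red: "reduction v P = reduction v Q"
  have near: "near P Q" using red by (rule near_if_reduction_eq)
  have eq: "(\<Phi> ^^ n) P = (\<Phi> ^^ n) Q"
    by (rule separated[OF ramified_funpow_postcritical[OF P] ramified_funpow_postcritical[OF Q]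
        near_funpow[OF near]])
  show "P = Q"
  proof (rule ccontr)
    assume "P \<noteq> Q"
    from first_collision[OF this eq] obtain m
      where m: "m < n" "(\<Phi> ^^ m) P \<noteq> (\<Phi> ^^ m) Q" "\<Phi> ((\<Phi> ^^ m) P) = \<Phi> ((\<Phi> ^^ m) Q)"
      by blast
    have "(\<Phi> ^^ (n - Suc m)) ((\<Phi> ^^ Suc m) P) = (\<Phi> ^^ n) P"
      using m(1) funpow_add[of "n - Suc m" "Suc m" \<Phi>] by simp
    then have "(\<Phi> ^^ (n - Suc m)) (\<Phi> ((\<Phi> ^^ m) P)) \<in> postcritical_points \<Phi>"
      using ramified_funpow_postcritical[OF P] by simp
    then show False
      by (rule no_collision[OF near_funpow[OF near] m(2,3)])
  qed
qed

end

end

section \<open>Good reduction outside finitely many places\<close>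

lemma (in nonarch_absval) poly_le_1:
  assumes "\<And>i. v (coeff p i) \<le> 1" "v x \<le> 1"
  shows "v (poly p x) \<le> 1"
  unfolding poly_altdef using assms by (intro sum_le_bound mult_le_1 power_le_1) auto

lemma (in nonarch_absval) bezout_ge_1:
  assumes "a * p + b * q = 1" "\<And>i. v (coeff a i) \<le> 1" "\<And>i. v (coeff b i) \<le> 1" "v x \<le> 1"
  shows "v (poly p x) \<ge> 1 \<or> v (poly q x) \<ge> 1"
proof (rule ccontr)
  assume "\<not> ?thesis"
  then have "v (poly p x * poly a x + poly q x * poly b x) < 1"
    using assms by (intro add_less mult_less_1 poly_le_1) auto
  moreover have "poly p x * poly a x + poly q x * poly b x = 1"
    using arg_cong[OF assms(1), of "\<lambda>p. poly p x"] by (simp add: mult.commute)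
  ultimately show False by simp
qed

text \<open>Zero is left out because v x = 1 will be demanded of all elements collected in an
  exceptional set.\<close>

definition nonzero_coeffs :: "'a :: zero poly \<Rightarrow> 'a set" where
  "nonzero_coeffs p = coeff p ` {..degree p} - {0}"

lemma finite_nonzero_coeffs: "finite (nonzero_coeffs p)"
  by (simp add: nonzero_coeffs_def)

lemma (in absval) coeff_le_1:
  assumes "\<And>x. x \<in> nonzero_coeffs p \<Longrightarrow> v x = 1"
  shows "v (coeff p i) \<le> 1"
proof (cases "coeff p i = 0")
  case False
  then have "coeff p i \<in> nonzero_coeffs p"
    by (auto simp: nonzero_coeffs_def intro!: imageI le_degree)
  then show ?thesis using assms by simp
qed simp

text \<open>When the coefficients of f, g and of Bezout cofactors are integral, the Bezout identity
  keeps one of the two forms a unit at every normalized point. There is one identity for each chart: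
  \<open>f'\<close> and \<open>g'\<close> are f and g in the coordinate y / x.\<close>

lemma good_reduction_cofinite:
  fixes f g :: "'a :: {alg_closed_field, field_char_0, field_gcd} poly"
  assumes L: "has_lift d f g \<Phi>" and d: "d > 0"
  shows "\<exists>E. finite E \<and> 0 \<notin> E \<and>
    (\<forall>v. nonarch_absval v \<longrightarrow> (\<forall>x\<in>E. v x = 1) \<longrightarrow> good_reduction v d f g \<Phi>)"
proof -
  have deg: "degree f \<le> d" "degree g \<le> d"
    and nz: "\<And>x y. (x, y) \<noteq> (0, 0) \<Longrightarrow> (form_eval d f x y, form_eval d g x y) \<noteq> (0, 0)"
    using L unfolding has_lift_iff by blast+
  define f' g' where "f' = form_comp d f [:1:] [:0, 1:]" and "g' = form_comp d g [:1:] [:0, 1:]"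
  have rev: "poly f' t = form_eval d f 1 t" "poly g' t = form_eval d g 1 t" for t
    by (simp_all add: f'_def g'_def poly_form_comp)
  have "coprime f g" using L by (simp add: has_lift_def)
  then obtain a b where ab: "a * f + b * g = 1"
    using bezout_coefficients_fst_snd[of f g] by (metis coprime_imp_gcd_eq_1)
  have "coprime f' g'"
    using nz[of 1] by (intro coprime_if_no_common_root) (auto simp: rev)
  then obtain a' b' where ab': "a' * f' + b' * g' = 1"
    using bezout_coefficients_fst_snd[of f' g'] by (metis coprime_imp_gcd_eq_1)
  define E where "E = (\<Union>p\<in>{f, g, a, b, a', b'}. nonzero_coeffs p) \<union> of_nat ` {1..d}"
  show ?thesis
  proof (intro exI conjI allI impI)
    show "finite E" by (simp add: E_def finite_nonzero_coeffs)
    show "0 \<notin> E" by (auto simp: E_def nonzero_coeffs_def)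
    fix v :: "'a \<Rightarrow> real"
    assume "nonarch_absval v" and E: "\<forall>x\<in>E. v x = 1"
    interpret nonarch_absval v by fact
    have le: "v (coeff p i) \<le> 1" if "p \<in> {f, g, a, b, a', b'}" for p i
      using that by (intro coeff_le_1 bspec[OF E]) (auto simp: E_def)
    show "good_reduction v d f g \<Phi>"
    proof unfold_locales
      show "v (coeff f i) \<le> 1" "v (coeff g i) \<le> 1" for i by (simp_all add: le)
      show "v (of_nat n) = 1" if "0 < n" "n \<le> d" for n
        using that by (intro bspec[OF E]) (auto simp: E_def)
      fix x y assume xy: "max (v x) (v y) = 1"
      have upper: "v (form_eval d h x y) \<le> 1" if "h \<in> {f, g}" for h
        unfolding form_eval_def using normalized_le[OF xy] that
        by (intro sum_le_bound mult_le_1 power_le_1 le) auto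
      have "v (form_eval d f x y) \<ge> 1 \<or> v (form_eval d g x y) \<ge> 1"
        using normalized_cases[OF xy]
      proof
        assume y: "v y = 1"
        then have "y \<noteq> 0" by auto
        have "v (x / y) \<le> 1" using normalized_le[OF xy] y by (simp add: divide)
        then have "v (poly f (x / y)) \<ge> 1 \<or> v (poly g (x / y)) \<ge> 1"
          by (intro bezout_ge_1[OF ab] le) auto
        then show ?thesis
          using deg \<open>y \<noteq> 0\<close> y by (simp add: form_eval_nonzero mult power)
      next
        assume x: "v x = 1"
        then have "x \<noteq> 0" by auto
        have "v (y / x) \<le> 1" using normalized_le[OF xy] x by (simp add: divide)
        then have "v (poly f' (y / x)) \<ge> 1 \<or> v (poly g' (y / x)) \<ge> 1"
          by (intro bezout_ge_1[OF ab'] le) auto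
        moreover have "form_eval d h x y = x ^ d * form_eval d h 1 (y / x)" for h
          using form_eval_homogeneous[of d h x 1 "y / x"] \<open>x \<noteq> 0\<close> by simp
        ultimately show ?thesis
          using x by (simp add: rev mult power)
      qed
      then show "max (v (form_eval d f x y)) (v (form_eval d g x y)) = 1"
        using upper[of f] upper[of g] by auto
    qed (use L d in auto)
  qed
qed

text \<open>If the determinant a * b' - a' * b and the nonzero coordinates are units, normalizing
  the coordinates changes the determinant by units, whereas equal reductions would make it smaller
  than 1.\<close>

lemma not_near_cofinite:
  fixes P Q :: "'a :: field proj_line"
  assumes "P \<noteq> Q"
  shows "\<exists>E. finite E \<and> 0 \<notin> E \<and>
    (\<forall>v. nonarch_absval v \<longrightarrow> (\<forall>x\<in>E. v x = 1) \<longrightarrow> \<not> nonarch_absval.near v P Q)"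
proof -
  obtain a b where P: "(a, b) \<noteq> (0, 0)" "P = hpt a b" by (rule hpt_cases)
  obtain a' b' where Q: "(a', b') \<noteq> (0, 0)" "Q = hpt a' b'" by (rule hpt_cases)
  define E where "E = {a, b, a', b', a * b' - a' * b} - {0}"
  have "\<not> nonarch_absval.near v P Q" if "nonarch_absval v" and E: "\<forall>x\<in>E. v x = 1" for v
  proof
    interpret nonarch_absval v by fact
    assume "near P Q"
    then obtain x y x' y' where xy: "P = hpt x y" "max (v x) (v y) = 1" and xy': "Q = hpt x' y'" "max (v x') (v y') = 1"
      and near: "v (x - x') < 1" "v (y - y') < 1"
      unfolding near_def by blast
    have scalar: "v c = 1"
      if "(s, t) \<noteq> (0, 0)" "s \<in> {a, b, a', b'}" "t \<in> {a, b, a', b'}" "max (v (c * s)) (v (c * t)) = 1" for c s t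
    proof -
      have "v s = 1 \<or> s = 0" "v t = 1 \<or> t = 0"
        using E that by (auto simp: E_def)
      then show ?thesis
        using that(1,4) by (auto simp: mult max_def split: if_splits)
    qed
    obtain c where c: "x = c * a" "y = c * b"
      using hpt_eq_iff[OF P(1) normalized_nonzero[OF xy(2)]] P(2) xy(1) by auto
    obtain c' where c': "x' = c' * a'" "y' = c' * b'"
      using hpt_eq_iff[OF Q(1) normalized_nonzero[OF xy'(2)]] Q(2) xy'(1) by auto
    have vc: "v c = 1" "v c' = 1"
      using scalar[OF P(1), of c] xy(2) scalar[OF Q(1), of c'] xy'(2) by (auto simp: c c')
    have "a * b' - a' * b \<noteq> 0"
      using assms hpt_eq_iff_cross[OF P(1) Q(1)] by (auto simp: P(2) Q(2))
    then have "v (a * b' - a' * b) = 1"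
      using E by (auto simp: E_def)
    moreover have "x * y' - x' * y = c * c' * (a * b' - a' * b)"
      by (simp add: c c' algebra_simps)
    ultimately have "v (x * y' - x' * y) = 1"
      using vc by (simp add: mult)
    moreover have "x * y' - x' * y = (x - x') * y - (y - y') * x"
      by (simp add: algebra_simps)
    moreover have "v ((x - x') * y - (y - y') * x) < 1"
      using normalized_le[OF xy(2)]
      by (intro diff_less[OF mult_less_1[OF near(1)] mult_less_1[OF near(2)]])
    ultimately show False by simp
  qed
  then show ?thesis
    by (intro exI[of _ E]) (auto simp: E_def)
qed

section \<open>Finiteness of the exceptional places\<close>

lemma (in nonarch_absval) prime_factor_less_1:
  assumes "n > 0" "v (of_nat n) < 1"
  shows "\<exists>p. prime p \<and> p dvd n \<and> v (of_nat p) < 1"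
  using assms
proof (induction n rule: less_induct)
  case (less n)
  then have "n \<noteq> 1" by auto
  then obtain p where p: "prime p" "p dvd n" using prime_factor_nat by blast
  then obtain m where m: "n = p * m" by (elim dvdE)
  show ?case
  proof (cases "v (of_nat p) < 1")
    case False
    then have "v (of_nat p) = 1" using of_nat_le_1[of p] by simp
    then have "v (of_nat m) < 1" using less.prems by (simp add: m mult)
    moreover have "0 < m" "m < n"
      using less.prems(1) prime_gt_1_nat[OF p(1)] by (auto simp: m)
    ultimately obtain q where "prime q" "q dvd m" "v (of_nat q) < 1"
      using less.IH by blast
    then show ?thesis by (auto simp: m)
  qed (use p in blast)
qed

text \<open>N is, up to sign, the product of the leading and the constant coefficient of an integral
  equation of x. If both are units, the leading term dominates for v x > 1 and the constant term for
  v x < 1, so the equation fails.\<close>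

lemma algebraic_unit_cofinite:
  fixes x :: "'a :: field_char_0"
  assumes "algebraic x" "x \<noteq> 0"
  shows "\<exists>N > 0. \<forall>v. nonarch_absval v \<longrightarrow> v x \<noteq> 1 \<longrightarrow> v (of_nat N) < 1"
proof -
  obtain q where q: "q \<noteq> 0" "coeff q 0 \<noteq> 0" "poly (map_poly of_int q) x = 0"
    using algebraicE'_nonzero[OF assms] by blast
  define n where "n = degree q"
  define N where "N = nat \<bar>coeff q n * coeff q 0\<bar>"
  have sum: "(\<Sum>i\<le>n. of_int (coeff q i) * x ^ i) = 0"
    using q(3) by (simp add: poly_altdef degree_map_poly coeff_map_poly n_def)
  have "v (of_nat N) < 1" if "nonarch_absval v" "v x \<noteq> 1" for v
  proof (rule ccontr)
    interpret nonarch_absval v by fact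
    assume "\<not> v (of_nat N) < 1"
    then have "v (of_int (coeff q n) * of_int (coeff q 0)) \<ge> 1"
      unfolding N_def of_int[symmetric] by simp
    then have "v (of_int (coeff q n)) * v (of_int (coeff q 0)) \<ge> 1"
      by (simp add: mult)
    then have unit: "v (of_int (coeff q n)) = 1" "v (of_int (coeff q 0)) = 1"
      using of_int_le_1[of "coeff q n"] of_int_le_1[of "coeff q 0"]
        mult_left_mono[of "v (of_int (coeff q 0))" 1 "v (of_int (coeff q n))"]
        mult_right_mono[of "v (of_int (coeff q n))" 1 "v (of_int (coeff q 0))"] by auto
    have term_le: "v (of_int (coeff q i) * x ^ i) \<le> v x ^ i" for i
      using mult_right_mono[OF of_int_le_1[of "coeff q i"], of "v x ^ i"] by (simp add: mult power)
    from that(2) consider "v x > 1" | "v x < 1" by linarith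
    then show False
    proof cases
      case 1
      have "of_int (coeff q n) * x ^ n = - (\<Sum>i<n. of_int (coeff q i) * x ^ i)"
        using sum by (simp add: add_eq_0_iff flip: lessThan_Suc_atMost)
      moreover have "v (\<Sum>i<n. of_int (coeff q i) * x ^ i) < v x ^ n"
      proof (rule sum_less_bound)
        show "v (of_int (coeff q i) * x ^ i) < v x ^ n" if "i \<in> {..<n}" for i
          using that 1 by (intro order.strict_trans1[OF term_le] power_strict_increasing) auto
        show "0 < v x ^ n"
          using 1 by (intro zero_less_power) linarith
      qed
      ultimately have "v (of_int (coeff q n) * x ^ n) < v x ^ n" by simp
      then show False using unit by (simp add: mult power)
    next
      case 2
      have "of_int (coeff q 0) = - (\<Sum>i<n. of_int (coeff q (Suc i)) * x ^ Suc i)"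
        using sum by (simp add: sum.atMost_shift add_eq_0_iff2 add.commute)
      moreover have "v (\<Sum>i<n. of_int (coeff q (Suc i)) * x ^ Suc i) < 1"
        using 2 by (intro sum_less_bound order.strict_trans1[OF term_le]) (auto simp: power_less_one_iff simp del: power_Suc)
      ultimately show False using unit by simp
    qed
  qed
  moreover have "N > 0"
    using q by (simp add: N_def n_def)
  ultimately show ?thesis by blast
qed

lemma extensions_nonarch: "w \<in> extensions V \<Longrightarrow> nonarch_absval w"
  by (simp add: extensions_def nonarch_absval_def nonarch_absval_axioms_def absval_def)

text \<open>A bad place lies above a prime dividing one of finitely many integers N x, and there are
  finitely many places above each prime.\<close>

lemma finite_bad_places:
  fixes E :: "'k :: field_char_0 alg_closure set"
  assumes "number_field TYPE('k)" "finite E" "0 \<notin> E"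
  shows "finite {V \<in> places :: ('k \<Rightarrow> real) set set. \<exists>w\<in>extensions V. \<exists>x\<in>E. w x \<noteq> 1}"
proof -
  have "\<forall>x\<in>E. \<exists>N>0. \<forall>w. nonarch_absval w \<longrightarrow> w x \<noteq> 1 \<longrightarrow> w (of_nat N) < 1"
    using assms(3) by (metis alg_closure_algebraic_rat[OF assms(1)] algebraic_unit_cofinite)
  then obtain N where N: "\<And>x. x \<in> E \<Longrightarrow> N x > 0"
      "\<And>x w. x \<in> E \<Longrightarrow> nonarch_absval w \<Longrightarrow> w x \<noteq> 1 \<Longrightarrow> w (of_nat (N x)) < 1"
    by metis
  define B where "B p = {V \<in> places. \<exists>v\<in>V. nonarchimedean v \<and> v (of_nat p :: 'k) < 1}" for p
  have "{V \<in> places :: ('k \<Rightarrow> real) set set. \<exists>w\<in>extensions V. \<exists>x\<in>E. w x \<noteq> 1} \<subseteq>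
      (\<Union>x\<in>E. \<Union>p\<in>{p. prime p \<and> p dvd N x}. B p)"
  proof
    fix V assume "V \<in> {V \<in> places :: ('k \<Rightarrow> real) set set. \<exists>w\<in>extensions V. \<exists>x\<in>E. w x \<noteq> 1}"
    then obtain w x where V: "V \<in> places" and w: "w \<in> extensions V" and x: "x \<in> E" "w x \<noteq> 1"
      by blast
    interpret nonarch_absval w by (rule extensions_nonarch[OF w])
    have "w (of_nat (N x)) < 1"
      by (rule N(2)[OF x(1) nonarch_absval_axioms x(2)])
    from prime_factor_less_1[OF N(1)[OF x(1)] this] obtain p
      where p: "prime p" "p dvd N x" "w (of_nat p) < 1"
      by blast
    have "nonarchimedean (w \<circ> to_ac)" "w \<circ> to_ac \<in> V"
      using w by (auto simp: extensions_def nonarchimedean_def)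
    then have "V \<in> B p"
      unfolding B_def using V p(3) by (auto intro!: bexI[of _ "w \<circ> to_ac"])
    then show "V \<in> (\<Union>x\<in>E. \<Union>p\<in>{p. prime p \<and> p dvd N x}. B p)"
      using x(1) p by blast
  qed
  moreover have "finite (\<Union>x\<in>E. \<Union>p\<in>{p. prime p \<and> p dvd N x}. B p)"
  proof (intro finite_UN_I assms)
    fix x assume "x \<in> E"
    then show "finite {p. prime p \<and> p dvd N x}"
      using N(1) finite_divisors_nat[of "N x"] by (auto intro: finite_subset[rotated])
    fix p assume "p \<in> {p. prime p \<and> p dvd N x}"
    then show "finite (B p)"
      unfolding B_def using finite_places_above_prime[OF assms(1)] by simp
  qed
  ultimately show ?thesis by (rule finite_subset)
qed

lemma finitely_critical_if_postcritically_finite: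
  fixes \<Phi> :: "'k :: field_char_0 alg_closure proj_line \<Rightarrow> 'k alg_closure proj_line"
  assumes "number_field TYPE('k)" and L: "has_lift d f g \<Phi>" and d: "d > 0"
    and pcf: "ramification_points \<Phi> \<subseteq> preperiodic_points \<Phi>"
  shows "finitely_critical \<Phi>"
proof -
  obtain E where E: "finite E" "0 \<notin> E"
      "\<forall>v. nonarch_absval v \<longrightarrow> (\<forall>x\<in>E. v x = 1) \<longrightarrow> good_reduction v d f g \<Phi>"
    using good_reduction_cofinite[OF L d] by (elim exE conjE)
  let ?C = "postcritical_points \<Phi>"
  have fin: "finite ?C"
    by (rule finite_postcritical_points[OF finite_ramification_points[OF L d] pcf])
  define D where "D = {(P, Q) \<in> ?C \<times> ?C. P \<noteq> Q}"
  have "finite D"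
    using fin by (auto simp: D_def intro: finite_subset[of _ "?C \<times> ?C"])
  have "\<forall>z\<in>D. \<exists>E. finite E \<and> 0 \<notin> E \<and>
      (\<forall>v. nonarch_absval v \<longrightarrow> (\<forall>x\<in>E. v x = 1) \<longrightarrow> \<not> nonarch_absval.near v (fst z) (snd z))"
    using not_near_cofinite by (auto simp: D_def)
  from bchoice[OF this] obtain e where e: "\<And>z. z \<in> D \<Longrightarrow> finite (e z)" "\<And>z. z \<in> D \<Longrightarrow> 0 \<notin> e z"
      "\<And>z v. z \<in> D \<Longrightarrow> nonarch_absval v \<Longrightarrow> (\<forall>x\<in>e z. v x = 1) \<Longrightarrow> \<not> nonarch_absval.near v (fst z) (snd z)"
    by blast
  define E' where "E' = E \<union> (\<Union>z\<in>D. e z)"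
  have E': "finite E'" "0 \<notin> E'"
    using E e \<open>finite D\<close> by (auto simp: E'_def)
  define S where "S = archimedean_places \<union>
    {V \<in> places :: ('k \<Rightarrow> real) set set. \<exists>w\<in>extensions V. \<exists>x\<in>E'. w x \<noteq> 1}"
  show ?thesis
    unfolding finitely_critical_def
  proof (intro exI[of _ S] conjI allI impI ballI)
    show "finite S"
      unfolding S_def
      by (intro finite_UnI finite_archimedean_places finite_bad_places assms(1) E')
    show "S \<subseteq> places" "archimedean_places \<subseteq> S"
      by (auto simp: S_def archimedean_places_def)
    fix n :: nat and V :: "('k \<Rightarrow> real) set"
    assume V: "V \<in> places - S"
    show "critically_good_reduction V (\<Phi> ^^ n)"
      unfolding critically_good_reduction_def
    proof
      fix w assume w: "w \<in> extensions V"
      then have unit: "w x = 1" if "x \<in> E'" for x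
        using V that by (auto simp: S_def)
      interpret nonarch_absval w by (rule extensions_nonarch[OF w])
      interpret good_reduction w d f g \<Phi>
        using unit by (intro E(3)[rule_format] nonarch_absval_axioms) (auto simp: E'_def)
      show "critically_good_at w (\<Phi> ^^ n)"
      proof (rule critically_good_funpow)
        fix P Q assume "P \<in> ?C" "Q \<in> ?C" "near P Q"
        then show "P = Q"
          using e(3)[of "(P, Q)" w] unit nonarch_absval_axioms by (auto simp: D_def E'_def)
      qed
    qed
  qed
qed

section \<open>Preperiodicity of the ramification points\<close>

text \<open>An absolute value of the closure above p is restricted to K. Any other prime q is a unit
  there, so different primes give different places, and these cannot all lie in the finite set
  \<open>S\<close>.\<close>

lemma prime_place_exists:
  fixes S :: "('k :: field_char_0 \<Rightarrow> real) set set"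
  assumes "number_field TYPE('k)" "finite S"
  shows "\<exists>p V w. prime p \<and> V \<in> places - S \<and> w \<in> extensions V \<and> w (of_nat p) < 1"
proof -
  have "\<exists>w :: 'k alg_closure \<Rightarrow> real. absolute_value w \<and> nonarchimedean w \<and> w (of_nat p) < 1"
    if "prime p" for p
    using padic_absolute_value_exists[OF that alg_closure_algebraic_rat[OF assms(1)]] by blast
  then obtain w :: "nat \<Rightarrow> 'k alg_closure \<Rightarrow> real" where w: "\<And>p. prime p \<Longrightarrow> absolute_value (w p)"
      "\<And>p. prime p \<Longrightarrow> nonarchimedean (w p)" "\<And>p. prime p \<Longrightarrow> w p (of_nat p) < 1"
    by metis
  define u where "u p = w p \<circ> to_ac" for p
  define V where "V p = absolute_value_equiv `` {u p}" for p
  have u: "nontrivial_absolute_value (u p)" if "prime p" for p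
  proof -
    have "absolute_value (u p)"
      using w(1)[OF that] by (simp add: absolute_value_def u_def)
    moreover have "u p (of_nat p) < 1" using w(3)[OF that] by (simp add: u_def)
    moreover have "(of_nat p :: 'k) \<noteq> 0" using that by auto
    ultimately show ?thesis
      unfolding nontrivial_absolute_value_def by (metis less_irrefl)
  qed
  have V: "V p \<in> places" "u p \<in> V p" if "prime p" for p
    using u[OF that] equiv_class_self[OF equiv_absolute_value_equiv, of "u p"]
    by (auto simp: V_def places_def intro: quotientI)
  have "inj_on V {p. prime p}"
  proof (rule inj_onI, rule ccontr)
    fix p q assume "p \<in> {p. prime p}" "q \<in> {p. prime p}" and eq: "V p = V q" and ne: "p \<noteq> q"
    then have pq: "prime p" "prime q" by auto
    interpret nonarch_absval "w p" by unfold_locales (rule w[OF pq(1)])+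
    have "\<not> p dvd q" using primes_dvd_imp_eq[OF pq] ne by blast
    then have "w p (of_nat q) = 1" by (rule of_nat_eq_1[OF pq(1) w(3)[OF pq(1)]])
    moreover have "u q \<in> V p"
      using V(2)[OF pq(2)] by (simp only: eq)
    then have "(u p, u q) \<in> absolute_value_equiv"
      by (simp add: V_def)
    then obtain s where "\<forall>x. u q x = u p x powr s"
      by (auto simp: absolute_value_equiv_def)
    then have "u q (of_nat q) = u p (of_nat q) powr s" by blast
    ultimately have "w q (of_nat q) = 1"
      by (simp add: u_def)
    with w(3)[OF pq(2)] show False by simp
  qed
  then have "infinite (V ` {p. prime p})"
    using primes_infinite finite_imageD by blast
  then have "\<not> V ` {p. prime p} \<subseteq> S"
    using finite_subset[OF _ assms(2)] by metis
  then obtain p where p: "prime p" "V p \<notin> S" by blast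
  moreover have "w p \<in> extensions (V p)"
    using w[OF p(1)] V(2)[OF p(1)] by (simp add: extensions_def u_def)
  ultimately show ?thesis
    using V(1)[OF p(1)] w(3)[OF p(1)] by blast
qed

lemma preperiodic_if_finitely_critical:
  fixes \<Phi> :: "'k :: field_char_0 alg_closure proj_line \<Rightarrow> 'k alg_closure proj_line"
  assumes K: "number_field TYPE('k)"
    and L: "has_lift d (map_poly to_ac f) (map_poly to_ac g) \<Phi>" and d: "d > 0"
    and crit: "finitely_critical \<Phi>" and P: "P \<in> ramification_points \<Phi>"
  shows "P \<in> preperiodic_points \<Phi>"
proof -
  obtain S :: "('k \<Rightarrow> real) set set" where S: "finite S"
      "\<And>n V. n \<ge> 1 \<Longrightarrow> V \<in> places - S \<Longrightarrow> critically_good_reduction V (\<Phi> ^^ n)"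
    using crit by (auto simp: finitely_critical_def)
  obtain p V w where p: "prime p" and V: "V \<in> places - S" and w: "w \<in> extensions V" "w (of_nat p) < 1"
    using prime_place_exists[OF K S(1)] by blast
  interpret nonarch_absval w by (rule extensions_nonarch[OF w(1)])
  obtain a b where ab: "(a, b) \<noteq> (0, 0)" "P = hpt a b" by (rule hpt_cases)
  \<comment> \<open>\<open>L\<close> contains coordinates of P and is preserved by forms over K. If
    b = 0, then a / b is 0 by convention, and P = [1 : 0] has coordinates in K.\<close>
  obtain B L where B: "finite B" "L = rat_vs.span B" "range to_ac \<subseteq> L" "a / b \<in> L"
      "\<And>x y. x \<in> L \<Longrightarrow> y \<in> L \<Longrightarrow> x * y \<in> L" "\<And>x. x \<in> L \<Longrightarrow> inverse x \<in> L"
    using finite_extension[OF K, of "a / b"] by metis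
  have const: "to_ac c \<in> L" for c using B(3) by auto
  have one: "1 \<in> L" and zero: "0 \<in> L"
    using const[of 1] const[of 0] by simp_all
  have power: "x ^ n \<in> L" if "x \<in> L" for x n
    using that by (induction n) (auto intro: one B(5))
  have form: "form_eval d (map_poly to_ac h) x y \<in> L" if "x \<in> L" "y \<in> L" for h x y
    unfolding form_eval_def B(2)
  proof (rule rat_vs.span_sum)
    fix i
    have "coeff (map_poly to_ac h) i * x ^ i * y ^ (d - i) \<in> L"
      by (intro B(5) power that) (simp add: coeff_map_poly const)
    then show "coeff (map_poly to_ac h) i * x ^ i * y ^ (d - i) \<in> rat_vs.span B"
      by (simp add: B(2))
  qed
  have rat: "\<exists>x\<in>L. \<exists>y\<in>L. (x, y) \<noteq> (0, 0) \<and> (\<Phi> ^^ i) P = hpt x y" for i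
  proof (induction i)
    case 0
    show ?case
    proof (cases "b = 0")
      case True
      then have "P = hpt 1 0" using ab by (simp add: hpt_eq_iff_cross)
      then show ?thesis
        using one zero by (intro bexI[of _ 1] bexI[of _ 0]) auto
    next
      case False
      then have "P = hpt (a / b) 1" using ab by (simp add: hpt_eq_iff_cross)
      then show ?thesis
        using one B(4) by (intro bexI[of _ "a / b"] bexI[of _ 1]) auto
    qed
  next
    case (Suc i)
    then obtain x y where xy: "x \<in> L" "y \<in> L" "(x, y) \<noteq> (0, 0)" "(\<Phi> ^^ i) P = hpt x y" by blast
    let ?x = "form_eval d (map_poly to_ac f) x y" and ?y = "form_eval d (map_poly to_ac g) x y"
    have "(?x, ?y) \<noteq> (0, 0)" "\<Phi> (hpt x y) = hpt ?x ?y"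
      using L xy(3) unfolding has_lift_iff by blast+
    then show ?case
      using form[OF xy(1,2)] xy(4) by auto
  qed
  have "\<exists>x y. x \<in> L \<and> y \<in> L \<and> max (w x) (w y) = 1 \<and> (\<Phi> ^^ i) P = hpt x y" for i
  proof -
    obtain x y where xy: "x \<in> L" "y \<in> L" "(x, y) \<noteq> (0, 0)" "(\<Phi> ^^ i) P = hpt x y" using rat by blast
    obtain c where "c \<in> {inverse x, inverse y}" "max (w (c * x)) (w (c * y)) = 1"
        "hpt x y = hpt (c * x) (c * y)"
      using normalize_point[OF xy(3)] by blast
    then show ?thesis
      using xy B(5,6) by (metis empty_iff insert_iff)
  qed
  then obtain x y where xy: "\<And>i. x i \<in> L" "\<And>i. y i \<in> L" "\<And>i. max (w (x i)) (w (y i)) = 1"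
      "\<And>i. (\<Phi> ^^ i) P = hpt (x i) (y i)"
    by metis
  define rr where "rr i = (residue_class w (x i), residue_class w (y i))" for i :: nat
  let ?R = "residue_class w ` {z \<in> L. w z \<le> 1}"
  have "rr ` {1..} \<subseteq> ?R \<times> ?R"
    using xy normalized_le[OF xy(3)] by (auto simp: rr_def)
  moreover have "finite ?R"
    unfolding B(2) using finite_residue_classes[OF absolute_value nonarchimedean p w(2) B(1)] .
  ultimately have "finite (rr ` {1..})"
    by (meson finite_SigmaI finite_subset)
  then have "\<not> inj_on rr {1..}"
    using finite_imageD infinite_Ici by blast
  then obtain i j where ij: "1 \<le> i" "i < j" "rr i = rr j"
    unfolding inj_on_def by (metis atLeast_iff linorder_neqE_nat)
  \<comment> \<open>A preimage Q of P under the (j - k)-th iterate is ramified for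
    \<open>\<Phi> ^^ j\<close>, as its orbit meets P before time j. This uses k \<ge> 1, hence the
    pigeonhole argument over indices from 1; the common exponent j lets one injectivity statement
    compare both points.\<close>
  have orbit: "(\<Phi> ^^ k) P \<in> (\<Phi> ^^ j) ` ramification_points (\<Phi> ^^ j)" if k: "1 \<le> k" "k \<le> j" for k
  proof -
    obtain Q where Q: "(\<Phi> ^^ (j - k)) Q = P" using funpow_surj[OF L d] by blast
    have "Q \<in> ramification_points (\<Phi> ^^ j)"
      unfolding ramification_points_funpow[OF L d] using Q P k by (auto intro!: exI[of _ "j - k"])
    moreover have "(\<Phi> ^^ j) Q = (\<Phi> ^^ k) P"
      using funpow_add[of k "j - k" \<Phi>] k Q by simp
    ultimately show ?thesis by (metis imageI)
  qed
  have "critically_good_at w (\<Phi> ^^ j)"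
    using S(2)[OF _ V, of j] w(1) ij by (auto simp: critically_good_reduction_def)
  then have inj: "inj_on (reduction w) ((\<Phi> ^^ j) ` ramification_points (\<Phi> ^^ j))"
    by (simp add: critically_good_at_def)
  have "reduction w ((\<Phi> ^^ i) P) = reduction w ((\<Phi> ^^ j) P)"
    unfolding xy(4) using ij(3) xy(3) by (intro reduction_eqI) (auto simp: rr_def)
  then have "(\<Phi> ^^ i) P = (\<Phi> ^^ j) P"
    using orbit[of i] orbit[of j] ij by (intro inj_onD[OF inj]) auto
  then have "(\<Phi> ^^ (i + (j - i))) P = (\<Phi> ^^ i) P" "j - i \<ge> 1"
    using ij by auto
  then show ?thesis
    unfolding preperiodic_points_def by blast
qed

theorem theorem2:
  fixes \<Phi> :: "'k :: field_char_0 alg_closure proj_line \<Rightarrow> 'k alg_closure proj_line"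
    and d :: nat
  assumes "number_field TYPE('k)"
    and "endomorphism_over_base d \<Phi>"
    and "d \<ge> 2"
  shows "finitely_critical \<Phi> \<longleftrightarrow> ramification_points \<Phi> \<subseteq> preperiodic_points \<Phi>"
proof -
  obtain f g where L: "has_lift d (map_poly to_ac f) (map_poly to_ac g) \<Phi>"
    using assms(2) by (auto simp: endomorphism_over_base_def)
  have d: "d > 0" using assms(3) by simp
  show ?thesis
    using preperiodic_if_finitely_critical[OF assms(1) L d]
      finitely_critical_if_postcritically_finite[OF assms(1) L d] by blast
qed

end
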